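(* Let $n,d,e\ge 1$ be integers with $d-e+1\ge 0$. Let $I\subset\mathbb{C}[x]=\mathbb{C}[x_1,\dots,x_n]$ be the ideal generated by $e$ general forms $T_d,T_{d-1},\dots,T_{d-e+1}$, where $T_i$ is homogeneous of degree $i$. Then the value of the Hilbert function of $I$ in degree $d+1$, namely $\dim_{\mathbb{C}}\bigl(\mathbb{C}[x]_{d+1}/I_{d+1}\bigr)$, equals the codimension of the Taylor variety $\mathcal{T}^n_{d,e,d+1}$ in $\mathbb{P}^{\binom{n+d+1}{n}-1}$.
   Context: "General forms" means that the statement holds for all tuples $(T_d,\dots,T_{d-e+1})$ of forms of the given degrees in a suitable nonempty Zariski open subset of the space of all such tuples. $\mathbb{C}[x]_{d+1}$ and $I_{d+1}$ denote the homogeneous components of degree $d+1$. Let $\mathbb{P}^{\binom{n+m}{n}-1}$ be the projective space of nonzero polynomials in $x=(x_1,\dots,x_n)$ over $\mathbb{C}$ of degree $\le m$ up to scaling. The Taylor variety $\mathcal{T}^n_{d,e,m}\subseteq\mathbb{P}^{\binom{n+m}{n}-1}$ is the Zariski closure of the set of all order-$m$ Taylor polynomials at the origin (Taylor series truncated after total degree $m$) of rational functions $P/Q$ with $P,Q\in\mathbb{C}[x]$, $\deg P\le d$, $\deg Q\le e$, $P(0)=Q(0)=1$. *)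

theory Defs
  imports "HOL-Analysis.Analysis" "HOL-Library.Poly_Mapping" "HOL-Library.Extended_Nat"
begin

section \<open>Complex polynomials in variables indexed by a type\<close>

text \<open>A monomial is its finitely supported exponent vector, and a polynomial is the finitely
  supported family of its coefficients; the ring structure is the convolution product provided by
  \<^theory>\<open>HOL-Library.Poly_Mapping\<close>.  The ring of complex polynomials in \<open>n\<close> variables is
  the whole type \<open>'n cpoly\<close> with \<open>'n :: finite\<close> and \<open>CARD('n) = n\<close>.\<close>

type_synonym 'v monomial = "'v \<Rightarrow>\<^sub>0 nat"
type_synonym 'v cpoly = "'v monomial \<Rightarrow>\<^sub>0 complex"

definition mono_degree :: "'v monomial \<Rightarrow> nat" where
  "mono_degree a = (\<Sum>i\<in>Poly_Mapping.keys a. Poly_Mapping.lookup a i)"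

definition forms :: "nat \<Rightarrow> 'v cpoly set" where
  "forms k = {p. \<forall>a\<in>Poly_Mapping.keys p. mono_degree a = k}"

definition polys_le :: "nat \<Rightarrow> 'v cpoly set" where
  "polys_le m = {p. \<forall>a\<in>Poly_Mapping.keys p. mono_degree a \<le> m}"

definition cscale :: "complex \<Rightarrow> 'v cpoly \<Rightarrow> 'v cpoly" where
  "cscale c p = Poly_Mapping.single 0 c * p"

definition mono_eval :: "('v \<Rightarrow> complex) \<Rightarrow> 'v monomial \<Rightarrow> complex" where
  "mono_eval x a = (\<Prod>i\<in>Poly_Mapping.keys a. x i ^ Poly_Mapping.lookup a i)"

definition poly_eval :: "('v \<Rightarrow> complex) \<Rightarrow> 'v cpoly \<Rightarrow> complex" where
  "poly_eval x p = (\<Sum>a\<in>Poly_Mapping.keys p. Poly_Mapping.lookup p a * mono_eval x a)"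

lemma mono_degree_superset:
  assumes "finite A" "Poly_Mapping.keys a \<subseteq> A"
  shows "mono_degree a = (\<Sum>i\<in>A. Poly_Mapping.lookup a i)"
  unfolding mono_degree_def using assms
  by (intro sum.mono_neutral_left) (auto simp: in_keys_iff)

lemma mono_eval_superset:
  assumes "finite A" "Poly_Mapping.keys a \<subseteq> A"
  shows "mono_eval x a = (\<Prod>i\<in>A. x i ^ Poly_Mapping.lookup a i)"
  unfolding mono_eval_def using assms
  by (intro prod.mono_neutral_left) (auto simp: in_keys_iff)

lemma poly_eval_superset:
  assumes "finite A" "Poly_Mapping.keys p \<subseteq> A"
  shows "poly_eval x p = (\<Sum>a\<in>A. Poly_Mapping.lookup p a * mono_eval x a)"
  unfolding poly_eval_def using assms
  by (intro sum.mono_neutral_left) (auto simp: in_keys_iff)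

lemma mono_degree_add: "mono_degree (a + b) = mono_degree a + mono_degree b"
proof -
  let ?A = "Poly_Mapping.keys a \<union> Poly_Mapping.keys b"
  have "Poly_Mapping.keys (a + b) \<subseteq> ?A" by (rule keys_add)
  then show ?thesis
    by (simp add: mono_degree_superset[of ?A] lookup_add sum.distrib)
qed

lemma mono_eval_add: "mono_eval x (a + b) = mono_eval x a * mono_eval x b"
proof -
  let ?A = "Poly_Mapping.keys a \<union> Poly_Mapping.keys b"
  have "Poly_Mapping.keys (a + b) \<subseteq> ?A" by (rule keys_add)
  then show ?thesis
    by (simp add: mono_eval_superset[of ?A] lookup_add power_add prod.distrib)
qed

lemma poly_eval_zero [simp]: "poly_eval x 0 = 0"
  by (simp add: poly_eval_def)

lemma poly_eval_single: "poly_eval x (Poly_Mapping.single a c) = c * mono_eval x a"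
  by (cases "c = 0") (simp_all add: poly_eval_def)

lemma poly_eval_one [simp]: "poly_eval x 1 = 1"
  by (simp add: poly_eval_def mono_eval_def)

lemma poly_eval_add: "poly_eval x (p + q) = poly_eval x p + poly_eval x q"
proof -
  let ?A = "Poly_Mapping.keys p \<union> Poly_Mapping.keys q"
  have "Poly_Mapping.keys (p + q) \<subseteq> ?A" by (rule keys_add)
  then show ?thesis
    by (simp add: poly_eval_superset[of ?A] lookup_add sum.distrib distrib_right)
qed

lemma cpoly_induct [case_names single add]:
  fixes p :: "'v cpoly"
  assumes "\<And>a c. P (Poly_Mapping.single a c)" and "\<And>p q. P p \<Longrightarrow> P q \<Longrightarrow> P (p + q)"
  shows "P p"
proof (induction p rule: update_induct)
  case const
  have "P (Poly_Mapping.single 0 0)" by (rule assms)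
  then show ?case by simp
next
  case (update f a b)
  have "Poly_Mapping.update a b f = f + Poly_Mapping.single a b"
    using update.hyps
    by (intro poly_mapping_eqI)
       (auto simp: lookup_update lookup_add lookup_single when_def in_keys_iff)
  then show ?case using assms update.IH by metis
qed

lemma poly_eval_mult: "poly_eval x (p * q) = poly_eval x p * poly_eval x q"
proof (induction p rule: cpoly_induct)
  case (single a c)
  show ?case
    by (induction q rule: cpoly_induct)
       (simp_all add: mult_single poly_eval_single mono_eval_add poly_eval_add distrib_left)
qed (simp add: poly_eval_add distrib_right)

lemma forms_mult:
  assumes "p \<in> forms k" "q \<in> forms l"
  shows "p * q \<in> forms (k + l)"
proof -
  have "mono_degree a = k + l" if "a \<in> Poly_Mapping.keys (p * q)" for a
  proof -
    obtain b c where "a = b + c" "b \<in> Poly_Mapping.keys p" "c \<in> Poly_Mapping.keys q"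
      using \<open>a \<in> _\<close> keys_mult[of p q] by blast
    with assms show ?thesis by (simp add: forms_def mono_degree_add)
  qed
  then show ?thesis by (simp add: forms_def)
qed

lemma forms_one: "1 \<in> forms 0"
  by (simp add: forms_def mono_degree_def)


section \<open>Hilbert function of an ideal\<close>

definition ideal_gen :: "'v cpoly set \<Rightarrow> 'v cpoly set" where
  "ideal_gen S = module.span (*) S"

text \<open>For a subspace \<open>W\<close> of \<open>V\<close>: the classes \<open>b + W\<close>, \<open>b \<in> B\<close>, are pairwise distinct and form a
  basis of the quotient space \<open>V / W\<close>.\<close>

definition quotient_basis :: "'v cpoly set \<Rightarrow> 'v cpoly set \<Rightarrow> 'v cpoly set \<Rightarrow> bool" where
  "quotient_basis V W B \<longleftrightarrow> finite B \<and> B \<subseteq> V \<and>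
     (\<forall>v\<in>V. \<exists>!c. c \<in> B \<rightarrow>\<^sub>E UNIV \<and> v - (\<Sum>b\<in>B. cscale (c b) b) \<in> W)"

definition quotient_dim :: "'v cpoly set \<Rightarrow> 'v cpoly set \<Rightarrow> nat" where
  "quotient_dim V W = card (SOME B. quotient_basis V W B)"

definition hilbert_function :: "'v cpoly set \<Rightarrow> nat \<Rightarrow> nat" where
  "hilbert_function I k = quotient_dim (forms k) (I \<inter> forms k)"


section \<open>Zariski topology on the space of tuples of forms\<close>

text \<open>Tuples \<open>(T\<^sub>i)\<close>, \<open>i \<in> J\<close>, of forms with \<open>T\<^sub>i\<close> of degree \<open>i\<close>, extended by zero
  outside \<open>J\<close>.\<close>

definition form_tuples :: "nat set \<Rightarrow> (nat \<Rightarrow> 'v cpoly) set" where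
  "form_tuples J = {T. \<forall>i. T i \<in> (if i \<in> J then forms i else {0})}"

text \<open>The coordinates of a tuple are the coefficients of its entries.  The index type also
  contains pairs \<open>(i, a)\<close> with \<open>i \<notin> J\<close> or \<open>a\<close> not of degree \<open>i\<close>; these coordinates
  vanish on all tuples and contribute no further closed sets.\<close>

definition tuple_coord :: "(nat \<Rightarrow> 'v cpoly) \<Rightarrow> nat \<times> 'v monomial \<Rightarrow> complex" where
  "tuple_coord T = (\<lambda>(i, a). Poly_Mapping.lookup (T i) a)"

definition form_zeros :: "nat set \<Rightarrow> (nat \<times> 'v monomial) cpoly set \<Rightarrow> (nat \<Rightarrow> 'v cpoly) set" where
  "form_zeros J S = {T \<in> form_tuples J. \<forall>F\<in>S. poly_eval (tuple_coord T) F = 0}"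

definition form_tuple_space :: "nat set \<Rightarrow> (nat \<Rightarrow> 'v cpoly) topology" where
  "form_tuple_space J = topology (\<lambda>U. \<exists>S. U = form_tuples J - form_zeros J S)"

lemma istopology_form_tuple_space:
  "istopology (\<lambda>U. \<exists>S. U = form_tuples J - form_zeros J S)"
  (is "istopology ?O")
  unfolding istopology_def
proof (intro conjI allI impI)
  fix U V :: "(nat \<Rightarrow> 'a cpoly) set"
  assume "?O U" "?O V"
  then obtain S R where U: "U = form_tuples J - form_zeros J S"
    and V: "V = form_tuples J - form_zeros J R"
    by blast
  let ?P = "{F * G |F G. F \<in> S \<and> G \<in> R}"
  have "T \<in> form_zeros J ?P \<longleftrightarrow> T \<in> form_zeros J S \<or> T \<in> form_zeros J R" for T
  proof
    assume T: "T \<in> form_zeros J ?P"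
    have "poly_eval (tuple_coord T) F = 0 \<or> poly_eval (tuple_coord T) G = 0"
      if "F \<in> S" "G \<in> R" for F G
    proof -
      have "poly_eval (tuple_coord T) (F * G) = 0"
        using T that unfolding form_zeros_def by blast
      then show ?thesis by (simp add: poly_eval_mult)
    qed
    with T show "T \<in> form_zeros J S \<or> T \<in> form_zeros J R"
      unfolding form_zeros_def by blast
  qed (auto simp: form_zeros_def poly_eval_mult)
  then have "U \<inter> V = form_tuples J - form_zeros J ?P"
    unfolding U V by blast
  then show "?O (U \<inter> V)" by (rule exI)
next
  fix \<U> :: "(nat \<Rightarrow> 'a cpoly) set set"
  assume "\<forall>U\<in>\<U>. ?O U"
  then have "\<exists>S. \<forall>U\<in>\<U>. U = form_tuples J - form_zeros J (S U)" by (rule bchoice)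
  then obtain S where S: "\<forall>U\<in>\<U>. U = form_tuples J - form_zeros J (S U)" ..
  have "\<Union>\<U> = (\<Union>U\<in>\<U>. form_tuples J - form_zeros J (S U))"
    using SUP_cong[OF refl, of \<U> "\<lambda>U. U" "\<lambda>U. form_tuples J - form_zeros J (S U)"] S
    by simp
  also have "\<dots> = form_tuples J - form_zeros J (\<Union>U\<in>\<U>. S U)"
    by (auto simp: form_zeros_def)
  finally show "?O (\<Union>\<U>)" by (rule exI)
qed

lemma openin_form_tuple_space:
  "openin (form_tuple_space J) U \<longleftrightarrow> (\<exists>S. U = form_tuples J - form_zeros J S)"
  unfolding form_tuple_space_def topology_inverse'[OF istopology_form_tuple_space] ..


section \<open>Projective space of polynomials of degree at most \<open>m\<close>\<close>

definition scaling_rel :: "nat \<Rightarrow> ('v cpoly \<times> 'v cpoly) set" where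
  "scaling_rel m = {(f, g). f \<in> polys_le m - {0} \<and> g \<in> polys_le m - {0} \<and>
     (\<exists>c. c \<noteq> 0 \<and> g = cscale c f)}"

definition proj_points :: "nat \<Rightarrow> 'v cpoly set set" where
  "proj_points m = (polys_le m - {0}) // scaling_rel m"

definition proj_class :: "nat \<Rightarrow> 'v cpoly \<Rightarrow> 'v cpoly set" where
  "proj_class m f = scaling_rel m `` {f}"

text \<open>Closed sets are the zero loci of sets of homogeneous polynomials in the coefficients, i.e. of
  polynomials whose variables are indexed by the monomials.  Coordinates belonging to monomials of
  degree greater than \<open>m\<close> vanish identically.\<close>

definition proj_zeros :: "nat \<Rightarrow> 'v monomial cpoly set \<Rightarrow> 'v cpoly set set" where
  "proj_zeros m S =
     {L \<in> proj_points m. \<forall>f\<in>L. \<forall>F\<in>S. poly_eval (Poly_Mapping.lookup f) F = 0}"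

definition proj_space :: "nat \<Rightarrow> 'v cpoly set topology" where
  "proj_space m = topology (\<lambda>U. \<exists>S. S \<subseteq> (\<Union>k. forms k) \<and> U = proj_points m - proj_zeros m S)"

lemma cscale_lookup: "Poly_Mapping.lookup (cscale c f) a = c * Poly_Mapping.lookup f a"
  by (simp add: cscale_def mult_map_scale_conv_mult[symmetric] Poly_Mapping.map.rep_eq when_def)

lemma poly_eval_homogeneous:
  assumes "F \<in> forms k"
  shows "poly_eval (\<lambda>i. c * x i) F = c ^ k * poly_eval x F"
proof -
  have "mono_eval (\<lambda>i. c * x i) a = c ^ mono_degree a * mono_eval x a" for a :: "'a monomial"
    by (simp add: mono_eval_def mono_degree_def power_mult_distrib prod.distrib power_sum)
  with assms show ?thesis
    by (auto simp: poly_eval_def forms_def sum_distrib_left intro!: sum.cong)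
qed

lemma proj_class_vanish:
  assumes "L \<in> proj_points m" "F \<in> forms k" "f \<in> L" "g \<in> L"
    "poly_eval (Poly_Mapping.lookup f) F = 0"
  shows "poly_eval (Poly_Mapping.lookup g) F = 0"
proof -
  from assms(1,3,4) obtain h c d where "c \<noteq> 0" "f = cscale c h" "g = cscale d h"
    by (auto simp: proj_points_def scaling_rel_def quotient_def)
  then have g: "Poly_Mapping.lookup g = (\<lambda>a. (d / c) * Poly_Mapping.lookup f a)"
    by (auto simp: cscale_lookup)
  show ?thesis
    unfolding g poly_eval_homogeneous[OF assms(2)] using assms(5) by simp
qed

lemma istopology_proj_space:
  "istopology (\<lambda>U. \<exists>S. S \<subseteq> (\<Union>k. forms k) \<and> U = proj_points m - proj_zeros m S)"
  (is "istopology ?O")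
  unfolding istopology_def
proof (intro conjI allI impI)
  fix U V :: "'a cpoly set set"
  assume "?O U" "?O V"
  then obtain S R where S: "S \<subseteq> (\<Union>k. forms k)" and R: "R \<subseteq> (\<Union>k. forms k)"
    and U: "U = proj_points m - proj_zeros m S" and V: "V = proj_points m - proj_zeros m R"
    by blast
  let ?P = "{F * G |F G. F \<in> S \<and> G \<in> R}"
  have "?P \<subseteq> (\<Union>k. forms k)"
  proof
    fix H assume "H \<in> ?P"
    then obtain F G where FG: "H = F * G" "F \<in> S" "G \<in> R" by blast
    with S R obtain k l where "F \<in> forms k" "G \<in> forms l" by blast
    with FG show "H \<in> (\<Union>k. forms k)" using forms_mult by blast
  qed
  moreover have "L \<in> proj_zeros m ?P \<longleftrightarrow> L \<in> proj_zeros m S \<or> L \<in> proj_zeros m R" for L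
  proof
    assume L: "L \<in> proj_zeros m ?P"
    then have Lp: "L \<in> proj_points m" by (simp add: proj_zeros_def)
    show "L \<in> proj_zeros m S \<or> L \<in> proj_zeros m R"
    proof (rule ccontr)
      assume "\<not> ?thesis"
      then obtain f F g G where *: "f \<in> L" "F \<in> S" "poly_eval (Poly_Mapping.lookup f) F \<noteq> 0"
        "g \<in> L" "G \<in> R" "poly_eval (Poly_Mapping.lookup g) G \<noteq> 0"
        using Lp by (auto simp: proj_zeros_def)
      from * R obtain l where "G \<in> forms l" by blast
      with * Lp have "poly_eval (Poly_Mapping.lookup f) G \<noteq> 0"
        using proj_class_vanish by blast
      with * have "poly_eval (Poly_Mapping.lookup f) (F * G) \<noteq> 0"
        by (simp add: poly_eval_mult)
      with L * show False by (auto simp: proj_zeros_def)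
    qed
  qed (auto simp: proj_zeros_def poly_eval_mult)
  ultimately show "?O (U \<inter> V)" by (intro exI[of _ ?P]) (auto simp: U V)
next
  fix \<U> :: "'a cpoly set set set"
  assume "\<forall>U\<in>\<U>. ?O U"
  then have "\<exists>S. \<forall>U\<in>\<U>. S U \<subseteq> (\<Union>k. forms k) \<and> U = proj_points m - proj_zeros m (S U)"
    by (rule bchoice)
  then obtain S where
    S: "\<forall>U\<in>\<U>. S U \<subseteq> (\<Union>k. forms k) \<and> U = proj_points m - proj_zeros m (S U)" ..
  have "\<Union>\<U> = (\<Union>U\<in>\<U>. proj_points m - proj_zeros m (S U))"
    using SUP_cong[OF refl, of \<U> "\<lambda>U. U" "\<lambda>U. proj_points m - proj_zeros m (S U)"] S
    by simp
  also have "\<dots> = proj_points m - proj_zeros m (\<Union>U\<in>\<U>. S U)"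
    by (auto simp: proj_zeros_def)
  finally have "\<Union>\<U> = proj_points m - proj_zeros m (\<Union>U\<in>\<U>. S U)" .
  moreover have "(\<Union>U\<in>\<U>. S U) \<subseteq> (\<Union>k. forms k)"
    using S by (intro UN_least) (rule conjunct1, rule bspec)
  ultimately show "?O (\<Union>\<U>)" by (intro exI conjI)
qed

lemma openin_proj_space:
  "openin (proj_space m) U \<longleftrightarrow>
     (\<exists>S. S \<subseteq> (\<Union>k. forms k) \<and> U = proj_points m - proj_zeros m S)"
  unfolding proj_space_def topology_inverse'[OF istopology_proj_space] ..


section \<open>Codimension of a closed subset of a topological space\<close>

definition irreducible_closedin :: "'a topology \<Rightarrow> 'a set \<Rightarrow> bool" where
  "irreducible_closedin X Z \<longleftrightarrow> closedin X Z \<and> Z \<noteq> {} \<and>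
     (\<forall>A B. closedin X A \<and> closedin X B \<and> Z = A \<union> B \<longrightarrow> Z = A \<or> Z = B)"

text \<open>Supremum of the lengths of strictly increasing chains of irreducible closed sets starting
  with the irreducible closed set \<open>Z\<close>; for an arbitrary closed set, the infimum over the
  irreducible closed subsets.\<close>

definition irreducible_codim :: "'a topology \<Rightarrow> 'a set \<Rightarrow> enat" where
  "irreducible_codim X Z = Sup {enat k |k. \<exists>C :: nat \<Rightarrow> 'a set. C 0 = Z \<and>
     (\<forall>i\<le>k. irreducible_closedin X (C i)) \<and> (\<forall>i<k. C i \<subset> C (Suc i))}"

definition codimension :: "'a topology \<Rightarrow> 'a set \<Rightarrow> enat" where
  "codimension X Y = (INF Z \<in> {Z. irreducible_closedin X Z \<and> Z \<subseteq> Y}. irreducible_codim X Z)"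


section \<open>Taylor polynomials and the Taylor variety\<close>

definition partial_deriv ::
  "'v \<Rightarrow> (('v \<Rightarrow> complex) \<Rightarrow> complex) \<Rightarrow> ('v \<Rightarrow> complex) \<Rightarrow> complex" where
  "partial_deriv i F x = deriv (\<lambda>t. F (x(i := t))) (x i)"

definition mono_fact :: "'v monomial \<Rightarrow> nat" where
  "mono_fact a = (\<Prod>i\<in>Poly_Mapping.keys a. fact (Poly_Mapping.lookup a i))"

text \<open>The coefficient of \<open>x\<^sup>a\<close> is the partial derivative \<open>\<partial>\<^sup>a F\<close> at the origin divided
  by \<open>a!\<close>.  Here \<open>a\<close> is given by a list \<open>vs\<close> in which each variable occurs as often as
  its exponent in \<open>a\<close>; the order of the list is the order of differentiation.\<close>

definition is_taylor_poly ::
  "nat \<Rightarrow> (('v \<Rightarrow> complex) \<Rightarrow> complex) \<Rightarrow> 'v cpoly \<Rightarrow> bool" where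
  "is_taylor_poly m F T \<longleftrightarrow> T \<in> polys_le m \<and>
     (\<forall>vs. length vs \<le> m \<longrightarrow>
        (let a = (\<Sum>v\<leftarrow>vs. Poly_Mapping.single v 1) in
           Poly_Mapping.lookup T a = foldr partial_deriv vs F (\<lambda>_. 0) / of_nat (mono_fact a)))"

definition rational_taylor_polys :: "nat \<Rightarrow> nat \<Rightarrow> nat \<Rightarrow> 'v cpoly set" where
  "rational_taylor_polys d e m = {T. \<exists>P Q. P \<in> polys_le d \<and> Q \<in> polys_le e \<and>
     poly_eval (\<lambda>_. 0) P = 1 \<and> poly_eval (\<lambda>_. 0) Q = 1 \<and>
     is_taylor_poly m (\<lambda>x. poly_eval x P / poly_eval x Q) T}"

definition taylor_variety :: "nat \<Rightarrow> nat \<Rightarrow> nat \<Rightarrow> 'v cpoly set set" where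
  "taylor_variety d e m = proj_space m closure_of (proj_class m ` rational_taylor_polys d e m)"

end

theory Submission
  imports Defs "Jordan_Normal_Form.Determinant"
begin

text \<open>For a polynomial \<open>f\<close> with constant term 1, being a Taylor polynomial of some \<open>P / Q\<close> means that
  the degree \<open>d + 1\<close> part of \<open>Q * f\<close> vanishes for a suitable \<open>Q\<close>, i.e. that the degree \<open>d + 1\<close>
  part of \<open>f\<close> lies in the image of \<open>q \<mapsto> (q * f)\<^bsub>d+1\<^esub>\<close>, where \<open>q\<close> has terms of degree
  \<open>1, \<dots>, e\<close> only.  This image depends only on the parts of \<open>f\<close> of degrees \<open>d + 1 - e, \<dots>, d\<close>
  and is the degree \<open>d + 1\<close> component of the ideal they generate.  Let \<open>r\<close> be its generic
  dimension and \<open>N\<close> the number of monomials of degree \<open>d + 1\<close>; the generic Hilbert function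
  value is \<open>N - r\<close>.

  The codimension is at least \<open>N - r\<close>: enlarging the image by one complementary monomial at a
  time gives a chain of irreducible closed sets, which a product of two determinants (Cramer's rule)
  shows to be strict.  It is at most \<open>N - r\<close>: passing to a strictly larger irreducible closed set
  increases the number of algebraically independent functions on the cone, this number is bounded by
  the number of coordinates, and the Taylor variety has all but \<open>N - r\<close> of the coordinates
  independent.\<close>

section \<open>Polynomials as functions\<close>

text \<open>The number \<open>r\<close> is never computed; both sides of the equation are read off
  one matrix. A tuple \<open>T\<close> enters through the single polynomial \<Sum> T_i, so the ideal
  and the Taylor condition share the same multiplication map, and genericity on either side becomes
  the nonvanishing of one determinant. Since \<open>q\<close> has no constant term, the top part of
  \<open>f\<close> can be altered without moving the image that it is tested against. Connecting
  curves, the chain of closed sets and the prescription of coordinates all rest on this freedom.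
  Codimension is defined by chains, so an upper bound has to control every chain. Counting
  independent functions does this: the vanishing ideal of the cone over an irreducible closed set is
  prime, which makes the count grow at each strict inclusion. When \<open>e = d + 1\<close> the
  constant term is itself an entry of the matrix. The generic polynomial \<open>f1\<close> must
  therefore be nondegenerate and have constant term 1 simultaneously, which a one-parameter
  perturbation followed by rescaling achieves.\<close>

definition subpoly :: "('v monomial \<Rightarrow> bool) \<Rightarrow> 'v cpoly \<Rightarrow> 'v cpoly" where
  "subpoly P p = Poly_Mapping.mapp (\<lambda>a c. if P a then c else 0) p"

lemma lookup_subpoly: "Poly_Mapping.lookup (subpoly P p) a = (if P a then Poly_Mapping.lookup p a else 0)"
  by (auto simp: subpoly_def lookup_mapp when_def in_keys_iff)

lemma keys_subpoly: "Poly_Mapping.keys (subpoly P p) = {a \<in> Poly_Mapping.keys p. P a}"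
  by (auto simp: in_keys_iff lookup_subpoly split: if_splits)

lemma subpoly_add: "subpoly P (p + q) = subpoly P p + subpoly P q"
  by (rule poly_mapping_eqI) (simp add: lookup_subpoly lookup_add)

lemma subpoly_sum: "subpoly P (sum f A) = (\<Sum>a\<in>A. subpoly P (f a))"
  by (rule poly_mapping_eqI) (simp add: lookup_subpoly lookup_sum)

lemma subpoly_cscale: "subpoly P (cscale c p) = cscale c (subpoly P p)"
  by (rule poly_mapping_eqI) (simp add: lookup_subpoly cscale_lookup)

lemma subpoly_split: "p = subpoly P p + subpoly (\<lambda>a. \<not> P a) p"
  by (rule poly_mapping_eqI) (simp add: lookup_subpoly lookup_add)

lemma subpoly_forms: "subpoly (\<lambda>a. mono_degree a = k) p \<in> forms k"
  by (auto simp: forms_def keys_subpoly)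

lemma subpoly_id: "(\<And>a. a \<in> Poly_Mapping.keys p \<Longrightarrow> P a) \<Longrightarrow> subpoly P p = p"
  by (rule poly_mapping_eqI) (auto simp: lookup_subpoly in_keys_iff)

lemma forms_lookup: "p \<in> forms k \<longleftrightarrow> (\<forall>a. mono_degree a \<noteq> k \<longrightarrow> Poly_Mapping.lookup p a = 0)"
  by (auto simp: forms_def in_keys_iff)

lemma polys_le_lookup: "p \<in> polys_le m \<longleftrightarrow> (\<forall>a. mono_degree a > m \<longrightarrow> Poly_Mapping.lookup p a = 0)"
  unfolding polys_le_def by (simp add: in_keys_iff Ball_def) (use not_le in blast)

interpretation cv: vector_space "cscale :: complex \<Rightarrow> 'v cpoly \<Rightarrow> 'v cpoly"
  by unfold_locales
     (auto intro!: poly_mapping_eqI simp: cscale_lookup lookup_add distrib_left distrib_right)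

lemma cscale_mult_left: "cscale c p * q = cscale c (p * q)"
  and cscale_mult_right: "p * cscale c q = cscale c (p * q)"
  by (simp_all add: cscale_def mult_ac)

lemma cscale_single: "cscale c (Poly_Mapping.single a b) = Poly_Mapping.single a (c * b)"
  by (simp add: cscale_def mult_single)

lemma single_expansion:
  assumes "finite A" "Poly_Mapping.keys p \<subseteq> A"
  shows "p = (\<Sum>a\<in>A. Poly_Mapping.single a (Poly_Mapping.lookup p a))"
proof (rule poly_mapping_eqI)
  fix b
  show "Poly_Mapping.lookup p b =
    Poly_Mapping.lookup (\<Sum>a\<in>A. Poly_Mapping.single a (Poly_Mapping.lookup p a)) b"
    using assms by (auto simp: lookup_sum lookup_single when_def sum.delta' in_keys_iff)
qed

lemma lookup_single_mult_add:
  "Poly_Mapping.lookup (Poly_Mapping.single b c * f) (b + a) =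
     c * Poly_Mapping.lookup (f :: 'v cpoly) a"
  by (induction f rule: cpoly_induct)
     (simp_all add: mult_single lookup_single lookup_add when_def distrib_left)

lemma lookup_single_mult_notin:
  assumes "a \<notin> range ((+) b)"
  shows "Poly_Mapping.lookup (Poly_Mapping.single b c * (f :: 'v cpoly)) a = 0"
  using assms
  by (induction f rule: cpoly_induct)
     (auto simp: mult_single lookup_single lookup_add when_def distrib_left)

lemma mono_degree_0 [simp]: "mono_degree 0 = 0"
  by (simp add: mono_degree_def)

lemma mono_degree_single [simp]: "mono_degree (Poly_Mapping.single i k) = k"
  by (cases "k = 0") (simp_all add: mono_degree_def)

lemma mono_degree_eq_0 [simp]: "mono_degree a = 0 \<longleftrightarrow> a = 0"
  by (auto simp: mono_degree_def in_keys_iff intro!: poly_mapping_eqI)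

lemma lookup_le_mono_degree: "Poly_Mapping.lookup a i \<le> mono_degree a"
proof (cases "i \<in> Poly_Mapping.keys a")
  case True
  then show ?thesis unfolding mono_degree_def by (intro member_le_sum) auto
qed (simp add: in_keys_iff)

text \<open>Bounding each exponent separately, instead of the total degree, makes the cardinality an
  exact power. Both sides of the later dimension count have this form.\<close>

lemma finite_bounded_monomials:
  assumes "finite A"
  shows "finite {a :: 'v monomial. Poly_Mapping.keys a \<subseteq> A \<and> (\<forall>i. Poly_Mapping.lookup a i \<le> k)}" (is "finite ?S")
    and "card {a :: 'v monomial. Poly_Mapping.keys a \<subseteq> A \<and> (\<forall>i. Poly_Mapping.lookup a i \<le> k)} = (k + 1) ^ card A"
proof -
  have "bij_betw (\<lambda>a. restrict (Poly_Mapping.lookup a) A) ?S (A \<rightarrow>\<^sub>E {..k})"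
  proof (rule bij_betwI')
    fix a b assume ab: "a \<in> ?S" "b \<in> ?S"
    show "restrict (Poly_Mapping.lookup a) A = restrict (Poly_Mapping.lookup b) A \<longleftrightarrow> a = b"
    proof
      assume *: "restrict (Poly_Mapping.lookup a) A = restrict (Poly_Mapping.lookup b) A"
      show "a = b"
      proof (rule poly_mapping_eqI)
        fix i
        show "Poly_Mapping.lookup a i = Poly_Mapping.lookup b i"
        proof (cases "i \<in> A")
          case True
          then show ?thesis using fun_cong[OF *, of i] by simp
        next
          case False
          then show ?thesis using ab by (metis (mono_tags, lifting) in_keys_iff mem_Collect_eq subsetD)
        qed
      qed
    qed simp
  next
    fix a assume "a \<in> ?S"
    then show "restrict (Poly_Mapping.lookup a) A \<in> A \<rightarrow>\<^sub>E {..k}" by auto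
  next
    fix g assume g: "g \<in> A \<rightarrow>\<^sub>E {..k}"
    define a where "a = (\<Sum>i\<in>A. Poly_Mapping.single i (g i))"
    have l: "Poly_Mapping.lookup a i = (if i \<in> A then g i else 0)" for i
      using assms by (auto simp: a_def lookup_sum lookup_single when_def sum.delta')
    have "a \<in> ?S" using g by (auto simp: l in_keys_iff split: if_splits)
    moreover have "g = restrict (Poly_Mapping.lookup a) A"
      using g by (auto simp: l restrict_def PiE_def extensional_def)
    ultimately show "\<exists>a\<in>?S. g = restrict (Poly_Mapping.lookup a) A" by blast
  qed
  note b = this
  show "finite ?S" using bij_betw_finite[OF b] assms by (simp add: finite_PiE)
  show "card ?S = (k + 1) ^ card A" using bij_betw_same_card[OF b] assms by (simp add: card_PiE)
qed

lemma finite_monomials_le: "finite {a :: 'n::finite monomial. mono_degree a \<le> k}"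
  by (rule finite_subset[OF _ finite_bounded_monomials(1)[of UNIV k]])
     (auto intro: order_trans[OF lookup_le_mono_degree])

lemma finite_monomials_eq: "finite {a :: 'n::finite monomial. mono_degree a = k}"
  by (rule finite_subset[OF _ finite_monomials_le[of k]]) auto

lemma poly_eval_sum: "poly_eval x (sum f A) = (\<Sum>a\<in>A. poly_eval x (f a))"
  by (induction A rule: infinite_finite_induct) (simp_all add: poly_eval_add)

lemma poly_eval_prod: "poly_eval x (prod f A) = (\<Prod>a\<in>A. poly_eval x (f a))"
  by (induction A rule: infinite_finite_induct) (simp_all add: poly_eval_mult)

lemma poly_eval_power: "poly_eval x (p ^ k) = poly_eval x p ^ k"
  by (induction k) (simp_all add: poly_eval_mult)

lemma poly_eval_cscale: "poly_eval x (cscale c p) = c * poly_eval x p"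
  by (simp add: cscale_def poly_eval_mult poly_eval_single mono_eval_def)

lemma mono_eval_single: "mono_eval x (Poly_Mapping.single i k) = x i ^ k"
  by (cases "k = 0") (simp_all add: mono_eval_def)

lemma mono_eval_0 [simp]: "mono_eval x 0 = 1"
  by (simp add: mono_eval_def)

lemma mono_eval_cong: "(\<And>i. i \<in> Poly_Mapping.keys a \<Longrightarrow> x i = y i) \<Longrightarrow> mono_eval x a = mono_eval y a"
  by (auto simp: mono_eval_def intro!: prod.cong)

lemma poly_eval_cong:
  "(\<And>a i. a \<in> Poly_Mapping.keys p \<Longrightarrow> i \<in> Poly_Mapping.keys a \<Longrightarrow> x i = y i) \<Longrightarrow>
    poly_eval x p = poly_eval y p"
  unfolding poly_eval_def by (intro sum.cong refl) (simp add: mono_eval_cong[of _ x y])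

text \<open>A relation among functions on the cone is itself a polynomial function of the
  coordinates, so statements about vanishing of one polynomial apply to it.\<close>

lemma poly_eval_compose:
  "\<exists>H :: 'w cpoly. \<forall>x. poly_eval x H = poly_eval (\<lambda>i. poly_eval x (y i)) R"
proof (induction R rule: cpoly_induct)
  case (single a c)
  show ?case
    by (rule exI[of _ "cscale c (\<Prod>i\<in>Poly_Mapping.keys a. y i ^ Poly_Mapping.lookup a i)"])
       (simp add: poly_eval_single poly_eval_cscale poly_eval_prod poly_eval_power mono_eval_def)
next
  case (add p q)
  then obtain H K where "\<forall>x. poly_eval x H = poly_eval (\<lambda>i. poly_eval x (y i)) p"
    "\<forall>x. poly_eval x K = poly_eval (\<lambda>i. poly_eval x (y i)) q" by blast
  then show ?case by (intro exI[of _ "H + K"]) (simp add: poly_eval_add)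
qed

definition indets :: "'v cpoly \<Rightarrow> 'v set" where
  "indets p = (\<Union>a\<in>Poly_Mapping.keys p. Poly_Mapping.keys a)"

lemma finite_indets: "finite (indets p)"
  by (simp add: indets_def)

text \<open>Divide \<open>R\<close> by the largest power of \<open>v\<close> that divides it; the
  quotient \<open>R'\<close> then stays nonzero when \<open>v\<close> is set to 0, and
  \<open>R0\<close> is what remains. This drives both the induction on variables and the elimination
  of one function from an algebraic relation.\<close>

lemma split_variable:
  fixes R :: "'v cpoly"
  assumes "R \<noteq> 0"
  obtains k R' R0 where "\<And>x. poly_eval x R = x v ^ k * poly_eval x R'"
    "R0 \<noteq> 0" "indets R0 \<subseteq> indets R - {v}" "\<And>x. x v = 0 \<Longrightarrow> poly_eval x R' = poly_eval x R0"
proof -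
  define k where "k = Min ((\<lambda>a. Poly_Mapping.lookup a v) ` Poly_Mapping.keys R)"
  let ?s = "Poly_Mapping.single v k"
  have ne: "Poly_Mapping.keys R \<noteq> {}" using assms by auto
  have k_le: "k \<le> Poly_Mapping.lookup a v" if "a \<in> Poly_Mapping.keys R" for a
    unfolding k_def using that by (intro Min_le) auto
  have "k \<in> (\<lambda>a. Poly_Mapping.lookup a v) ` Poly_Mapping.keys R"
    unfolding k_def using ne by (intro Min_in) auto
  \<comment> \<open>After division by \<open>v ^ k\<close> the monomial \<open>a0\<close> is free of
    \<open>v\<close>; it witnesses that \<open>R0\<close> is nonzero.\<close>
  then obtain a0 where a0: "a0 \<in> Poly_Mapping.keys R" "Poly_Mapping.lookup a0 v = k" by auto
  have inj: "inj (\<lambda>a :: 'v monomial. a + ?s)" by (auto intro: injI)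
  define R' where "R' = Poly_Mapping.map_key (\<lambda>a. a + ?s) R"
  have R'l: "Poly_Mapping.lookup R' a = Poly_Mapping.lookup R (a + ?s)" for a
    unfolding R'_def map_key.rep_eq[OF inj] by simp
  have ex: "a - ?s + ?s = a" if "a \<in> Poly_Mapping.keys R" for a
  proof (rule poly_mapping_eqI)
    fix i
    show "Poly_Mapping.lookup (a - ?s + ?s) i = Poly_Mapping.lookup a i"
      using k_le[OF that] by (cases "i = v") (simp_all add: lookup_add lookup_minus lookup_single)
  qed
  have R: "R = Poly_Mapping.single ?s 1 * R'"
  proof (rule poly_mapping_eqI)
    fix a
    show "Poly_Mapping.lookup R a = Poly_Mapping.lookup (Poly_Mapping.single ?s 1 * R') a"
    proof (cases "a \<in> range ((+) ?s)")
      case True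
      then obtain b where "a = ?s + b" by auto
      then show ?thesis unfolding \<open>a = _\<close> lookup_single_mult_add R'l by (simp add: add.commute)
    next
      case False
      with ex[of a] have "a \<notin> Poly_Mapping.keys R" by (metis add.commute rangeI)
      then show ?thesis using False by (simp add: lookup_single_mult_notin in_keys_iff)
    qed
  qed
  define R0 where "R0 = subpoly (\<lambda>a. Poly_Mapping.lookup a v = 0) R'"
  have 1: "poly_eval x R = x v ^ k * poly_eval x R'" for x
    by (subst R) (simp add: poly_eval_mult poly_eval_single mono_eval_single)
  have 2: "R0 \<noteq> 0"
  proof -
    have "Poly_Mapping.lookup R0 (a0 - ?s) \<noteq> 0"
      using a0 ex[OF a0(1)] by (simp add: R0_def lookup_subpoly R'l in_keys_iff lookup_minus)
    then show ?thesis by auto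
  qed
  have 3: "indets R0 \<subseteq> indets R - {v}"
  proof
    fix i assume "i \<in> indets R0"
    then obtain a where a: "Poly_Mapping.lookup a v = 0" "a + ?s \<in> Poly_Mapping.keys R"
      "Poly_Mapping.lookup a i \<noteq> 0"
      by (auto simp: indets_def R0_def keys_subpoly in_keys_iff R'l)
    then have "i \<noteq> v" by auto
    moreover have "i \<in> Poly_Mapping.keys (a + ?s)" using a by (simp add: in_keys_iff lookup_add)
    ultimately show "i \<in> indets R - {v}" using a by (auto simp: indets_def)
  qed
  have 4: "poly_eval x R' = poly_eval x R0" if "x v = 0" for x
  proof -
    have "poly_eval x (subpoly (\<lambda>a. Poly_Mapping.lookup a v \<noteq> 0) R') = 0"
      unfolding poly_eval_def
    proof (rule sum.neutral, rule ballI)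
      fix a assume "a \<in> Poly_Mapping.keys (subpoly (\<lambda>a. Poly_Mapping.lookup a v \<noteq> 0) R')"
      then have "Poly_Mapping.lookup a v \<noteq> 0" by (simp add: keys_subpoly)
      then have "mono_eval x a = 0" unfolding mono_eval_def
        using that by (intro prod_zero) (auto intro!: bexI[of _ v] simp: in_keys_iff)
      then show "Poly_Mapping.lookup (subpoly (\<lambda>a. Poly_Mapping.lookup a v \<noteq> 0) R') a * mono_eval x a = 0" by simp
    qed
    then show ?thesis
      by (subst subpoly_split[of R' "\<lambda>a. Poly_Mapping.lookup a v = 0"]) (simp add: poly_eval_add R0_def)
  qed
  from that 1 2 3 4 show ?thesis by blast
qed

section \<open>Polynomial functions of one complex parameter\<close>

definition polyfun :: "(complex \<Rightarrow> complex) \<Rightarrow> bool" where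
  "polyfun h \<longleftrightarrow> (\<exists>p. \<forall>s. h s = poly p s)"

lemma polyfun_const: "polyfun (\<lambda>_. c)"
  unfolding polyfun_def by (rule exI[of _ "[:c:]"]) simp

lemma polyfun_id: "polyfun (\<lambda>s. s)"
  unfolding polyfun_def by (rule exI[of _ "[:0, 1:]"]) simp

lemma polyfun_add: "polyfun f \<Longrightarrow> polyfun g \<Longrightarrow> polyfun (\<lambda>s. f s + g s)"
  unfolding polyfun_def by (metis poly_add)

lemma polyfun_mult: "polyfun f \<Longrightarrow> polyfun g \<Longrightarrow> polyfun (\<lambda>s. f s * g s)"
  unfolding polyfun_def by (metis poly_mult)

lemma polyfun_power: "polyfun f \<Longrightarrow> polyfun (\<lambda>s. f s ^ k)"
  unfolding polyfun_def by (metis poly_power)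

lemma polyfun_sum: "(\<And>a. a \<in> A \<Longrightarrow> polyfun (f a)) \<Longrightarrow> polyfun (\<lambda>s. \<Sum>a\<in>A. f a s)"
  by (induction A rule: infinite_finite_induct) (auto intro: polyfun_const polyfun_add)

lemma polyfun_prod: "(\<And>a. a \<in> A \<Longrightarrow> polyfun (f a)) \<Longrightarrow> polyfun (\<lambda>s. \<Prod>a\<in>A. f a s)"
  by (induction A rule: infinite_finite_induct) (auto intro: polyfun_const polyfun_mult)

lemma polyfun_poly_eval: "(\<And>i. polyfun (\<lambda>s. x s i)) \<Longrightarrow> polyfun (\<lambda>s. poly_eval (x s) F)"
  unfolding poly_eval_def mono_eval_def
  by (intro polyfun_sum polyfun_mult polyfun_const polyfun_prod polyfun_power)

lemma polyfun_finite_zeros: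
  assumes "polyfun h" "h s \<noteq> 0"
  shows "finite {s. h s = 0}"
proof -
  obtain p where p: "\<forall>s. h s = poly p s" using assms by (auto simp: polyfun_def)
  then have "p \<noteq> 0" using assms by auto
  then show ?thesis using p poly_roots_finite by auto
qed

text \<open>Finitely many bad parameters cannot exhaust the complex numbers. Two open conditions,
  each satisfied somewhere on a curve, are thus satisfied at a common point, even away from a finite
  set.\<close>

lemma polyfun_common_nonzero:
  assumes "polyfun f" "polyfun g" "f s \<noteq> 0" "g t \<noteq> 0" and "finite A"
  obtains u where "f u \<noteq> 0" "g u \<noteq> 0" "u \<notin> A"
proof -
  have "finite ({s. f s = 0} \<union> {s. g s = 0} \<union> A)"
    using assms polyfun_finite_zeros by blast
  then obtain u where "u \<notin> {s. f s = 0} \<union> {s. g s = 0} \<union> A"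
    using infinite_UNIV_char_0[where 'a=complex] by (metis ex_new_if_finite)
  then show ?thesis using that by auto
qed

lemma nonzero_poly_eval:
  fixes R :: "'v cpoly"
  assumes "R \<noteq> 0"
  shows "\<exists>x. poly_eval x R \<noteq> 0"
proof -
  have "\<forall>R :: 'v cpoly. R \<noteq> 0 \<longrightarrow> indets R \<subseteq> V \<longrightarrow> (\<exists>x. poly_eval x R \<noteq> 0)" if "finite V" for V
    using that
  proof (induction V)
    case empty
    show ?case
    proof (intro allI impI)
      fix R :: "'v cpoly" assume R: "R \<noteq> 0" "indets R \<subseteq> {}"
      then have "Poly_Mapping.keys R \<subseteq> {0}" by (auto simp: indets_def)
      moreover have "Poly_Mapping.keys R \<noteq> {}" using R by simp
      ultimately have k: "Poly_Mapping.keys R = {0}" using subset_singletonD by metis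
      then have "Poly_Mapping.lookup R 0 \<noteq> 0" using in_keys_iff[of 0 R] by simp
      with k have "poly_eval (\<lambda>_. 0) R \<noteq> 0" by (simp add: poly_eval_def)
      then show "\<exists>x. poly_eval x R \<noteq> 0" by blast
    qed
  next
    case (insert v V)
    show ?case
    proof (intro allI impI)
      fix R :: "'v cpoly" assume R: "R \<noteq> 0" "indets R \<subseteq> insert v V"
      obtain k R' R0 where *: "\<And>x. poly_eval x R = x v ^ k * poly_eval x R'"
        "R0 \<noteq> 0" "indets R0 \<subseteq> indets R - {v}" "\<And>x. x v = 0 \<Longrightarrow> poly_eval x R' = poly_eval x R0"
        using split_variable[OF R(1), of v] by blast
      with insert.IH R(2) obtain x where x: "poly_eval x R0 \<noteq> 0" by blast
      \<comment> \<open>\<open>R0\<close> does not contain \<open>v\<close>, so the point may be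
        moved to \<open>v = 0\<close>, where \<open>R'\<close> agrees with
        \<open>R0\<close>.\<close>
      have "poly_eval (x(v := 0)) R0 = poly_eval x R0"
        using *(3) by (intro poly_eval_cong) (auto simp: indets_def)
      with x *(4)[of "x(v := 0)"] have "poly_eval (x(v := 0)) R' \<noteq> 0" by simp
      moreover have "polyfun (\<lambda>s. poly_eval (x(v := s)) R')"
      proof (rule polyfun_poly_eval)
        show "polyfun (\<lambda>s. (x(v := s)) i)" for i
          by (cases "i = v") (auto intro: polyfun_const polyfun_id)
      qed
      \<comment> \<open>The parameter must also avoid 0, because \<open>R\<close> carries the factor
        \<open>x v ^ k\<close>.\<close>
      ultimately obtain u where "poly_eval (x(v := u)) R' \<noteq> 0" "u \<noteq> 0"
        using polyfun_common_nonzero[of "\<lambda>s. poly_eval (x(v := s)) R'" "\<lambda>s. s" 0 1 "{}"]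
          polyfun_id by auto
      then have "poly_eval (x(v := u)) R \<noteq> 0" by (simp add: *(1))
      then show "\<exists>x. poly_eval x R \<noteq> 0" by blast
    qed
  qed
  then show ?thesis using assms finite_indets by blast
qed

section \<open>Algebraic independence on irreducible closed sets\<close>

text \<open>Stated for families, so that two equal members already count as a dependence, as they do
  for columns of a matrix.\<close>

lemma family_dependent:
  fixes w :: "'a \<Rightarrow> 'v cpoly"
  assumes "finite S" "finite B" "card B < card S" "\<And>a. a \<in> S \<Longrightarrow> w a \<in> cv.span B"
  shows "\<exists>c. (\<exists>a\<in>S. c a \<noteq> 0) \<and> (\<Sum>a\<in>S. cscale (c a) (w a)) = 0"
proof (cases "inj_on w S")
  case True
  have "cv.dependent (w ` S)"
  proof (rule ccontr)
    assume "\<not> cv.dependent (w ` S)"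
    then have "card (w ` S) \<le> card B"
      using cv.independent_span_bound[OF assms(2)] assms(4) by (simp add: image_subset_iff)
    then show False using assms(3) True by (simp add: card_image)
  qed
  then obtain u where u: "\<exists>v\<in>w ` S. u v \<noteq> 0" "(\<Sum>v\<in>w ` S. cscale (u v) v) = 0"
    using assms(1) by (auto simp: cv.dependent_finite)
  then show ?thesis
    by (intro exI[of _ "u \<circ> w"]) (auto simp: sum.reindex[OF True] o_def)
next
  case False
  then obtain a b where ab: "a \<in> S" "b \<in> S" "a \<noteq> b" "w a = w b" by (auto simp: inj_on_def)
  define c :: "'a \<Rightarrow> complex" where "c = (\<lambda>x. if x = a then 1 else if x = b then -1 else 0)"
  have "(\<Sum>x\<in>S. cscale (c x) (w x)) = (\<Sum>x\<in>{a, b}. cscale (c x) (w x))"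
    using ab assms(1) by (intro sum.mono_neutral_right) (auto simp: c_def)
  also have "\<dots> = 0" using ab by (simp add: c_def cv.scale_minus_left)
  finally have "(\<Sum>x\<in>S. cscale (c x) (w x)) = 0" .
  moreover have "c a \<noteq> 0" by (simp add: c_def)
  ultimately show ?thesis using ab by blast
qed

lemma polys_le_mult: "p \<in> polys_le j \<Longrightarrow> q \<in> polys_le k \<Longrightarrow> p * q \<in> polys_le (j + k)"
proof -
  assume pq: "p \<in> polys_le j" "q \<in> polys_le k"
  have "mono_degree a \<le> j + k" if a: "a \<in> Poly_Mapping.keys (p * q)" for a
  proof -
    obtain b c where "a = b + c" "b \<in> Poly_Mapping.keys p" "c \<in> Poly_Mapping.keys q"
      using a keys_mult[of p q] by blast
    with pq show ?thesis by (simp add: polys_le_def mono_degree_add add_mono)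
  qed
  then show ?thesis by (simp add: polys_le_def)
qed

lemma polys_le_one: "1 \<in> polys_le k"
  by (simp add: polys_le_def)

lemma polys_le_power: "p \<in> polys_le j \<Longrightarrow> p ^ k \<in> polys_le (k * j)"
  by (induction k) (auto simp: polys_le_one intro: polys_le_mult)

lemma polys_le_prod:
  "(\<And>i. i \<in> A \<Longrightarrow> p i \<in> polys_le (g i)) \<Longrightarrow> prod p A \<in> polys_le (sum g A)"
  by (induction A rule: infinite_finite_induct) (auto simp: polys_le_one intro: polys_le_mult)

lemma polys_le_mono: "p \<in> polys_le j \<Longrightarrow> j \<le> k \<Longrightarrow> p \<in> polys_le k"
  by (auto simp: polys_le_def)

text \<open>A substitute for "the dimension of \<open>X\<close> is at least \<open>t\<close>": some
  \<open>t\<close> polynomial functions of the coefficients satisfy no nontrivial polynomial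
  relation on \<open>X\<close>. It is applied to \<open>X = \<Union>Z\<close>, the affine cone over
  \<open>Z\<close> without its vertex.\<close>

definition alg_indep :: "'v cpoly set \<Rightarrow> nat \<Rightarrow> bool" where
  "alg_indep X t \<longleftrightarrow> (\<exists>y :: nat \<Rightarrow> 'v monomial cpoly. \<forall>R. indets R \<subseteq> {..<t} \<longrightarrow>
     (\<forall>f\<in>X. poly_eval (\<lambda>i. poly_eval (Poly_Mapping.lookup f) (y i)) R = 0) \<longrightarrow> R = 0)"

lemma alg_indepD:
  fixes X :: "'v cpoly set"
  assumes "alg_indep X t"
  shows "\<exists>y :: nat \<Rightarrow> 'v monomial cpoly. \<forall>R. indets R \<subseteq> {..<t} \<longrightarrow>
    (\<forall>f\<in>X. poly_eval (\<lambda>i. poly_eval (Poly_Mapping.lookup f) (y i)) R = 0) \<longrightarrow> R = 0"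
  using assms by (simp only: alg_indep_def)

lemma alg_indepI:
  fixes y :: "nat \<Rightarrow> 'v monomial cpoly"
  assumes "\<And>R. indets R \<subseteq> {..<t} \<Longrightarrow>
      (\<And>f. f \<in> X \<Longrightarrow> poly_eval (\<lambda>i. poly_eval (Poly_Mapping.lookup f) (y i)) R = 0) \<Longrightarrow> R = 0"
  shows "alg_indep X t"
  unfolding alg_indep_def by (intro exI[of _ y] allI impI assms) simp_all

text \<open>Counting: the monomials with exponents at most \<open>K\<close> in \<open>t\<close> functions of degree at most
  \<open>D\<close> lie in a space of dimension at most \<open>(t * K * D + 1) ^ V\<close>, which is smaller than
  \<open>(K + 1) ^ t\<close> when \<open>V < t\<close> and \<open>K\<close> is large.\<close>

lemma alg_indep_le:
  fixes X :: "'n::finite cpoly set"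
  assumes X: "X \<subseteq> polys_le m" and "alg_indep X t"
  shows "t \<le> card {a :: 'n monomial. mono_degree a \<le> m}"
proof (rule ccontr)
  define A where "A = {a :: 'n monomial. mono_degree a \<le> m}"
  define V where "V = card A"
  assume "\<not> ?thesis"
  then have Vt: "V < t" by (simp add: V_def A_def)
  have fA: "finite A" by (simp add: A_def finite_monomials_le)
  obtain y :: "nat \<Rightarrow> 'n monomial cpoly" where "\<forall>R. indets R \<subseteq> {..<t} \<longrightarrow>
    (\<forall>f\<in>X. poly_eval (\<lambda>i. poly_eval (Poly_Mapping.lookup f) (y i)) R = 0) \<longrightarrow> R = 0"
    using alg_indepD[OF assms(2)] by (elim exE)
  then have y: "R = 0" if "indets R \<subseteq> {..<t}"
    "\<And>f. f \<in> X \<Longrightarrow> poly_eval (\<lambda>i. poly_eval (Poly_Mapping.lookup f) (y i)) R = 0" for R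
    using that by auto
  \<comment> \<open>A crude common degree bound for all the functions \<open>y i\<close>.\<close>
  define D where "D = (\<Sum>i<t. \<Sum>b\<in>Poly_Mapping.keys (y i). mono_degree b)"
  have yD: "y i \<in> polys_le D" if "i < t" for i
  proof -
    have "mono_degree b \<le> D" if b: "b \<in> Poly_Mapping.keys (y i)" for b
    proof -
      have "mono_degree b \<le> (\<Sum>b\<in>Poly_Mapping.keys (y i). mono_degree b)"
        using b by (intro member_le_sum) auto
      also have "\<dots> \<le> D" unfolding D_def using \<open>i < t\<close> by (intro member_le_sum) auto
      finally show ?thesis .
    qed
    then show ?thesis by (simp add: polys_le_def)
  qed
  \<comment> \<open>Chosen so that \<open>((K + 1) * (t * D + 1)) ^ V\<close> equals
    \<open>(K + 1) ^ V * K\<close>, which is just below \<open>(K + 1) ^ Suc V\<close>.\<close>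
  define K where "K = (t * D + 1) ^ V"
  define S where "S = {a :: nat monomial. Poly_Mapping.keys a \<subseteq> {..<t} \<and> (\<forall>i. Poly_Mapping.lookup a i \<le> K)}"
  define B where "B = {b :: 'n monomial monomial. Poly_Mapping.keys b \<subseteq> A \<and> (\<forall>i. Poly_Mapping.lookup b i \<le> t * (K * D))}"
  have fS: "finite S" and cS: "card S = (K + 1) ^ t"
    using finite_bounded_monomials[of "{..<t}" K] by (simp_all add: S_def)
  have fB: "finite B" and cB: "card B = (t * (K * D) + 1) ^ V"
    using finite_bounded_monomials[OF fA, of "t * (K * D)"] by (simp_all add: B_def V_def)
  have "t * (K * D) + 1 \<le> (K + 1) * (t * D + 1)" by (simp add: algebra_simps)
  then have "card B \<le> ((K + 1) * (t * D + 1)) ^ V" unfolding cB by (rule power_mono) simp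
  also have "\<dots> = (K + 1) ^ V * K" by (simp only: power_mult_distrib K_def[symmetric])
  also have "\<dots> < (K + 1) ^ V * (K + 1)" by simp
  also have "\<dots> = (K + 1) ^ Suc V" by simp
  also have "\<dots> \<le> (K + 1) ^ t" using Vt by (intro power_increasing) auto
  finally have card: "card B < card S" by (simp add: cS)
  define z where "z = (\<lambda>a. \<Prod>i\<in>Poly_Mapping.keys a. y i ^ Poly_Mapping.lookup a i)"
  \<comment> \<open>The \<open>y i\<close> may involve coordinates of degree above \<open>m\<close>.
    These vanish on \<open>X\<close>, so the monomials containing them are dropped; what is left
    lies in a space of finite dimension.\<close>
  define w where "w = (\<lambda>a. subpoly (\<lambda>b. Poly_Mapping.keys b \<subseteq> A) (z a))"
  have ev: "poly_eval (Poly_Mapping.lookup f) (w a) =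
      mono_eval (\<lambda>i. poly_eval (Poly_Mapping.lookup f) (y i)) a" if f: "f \<in> X" for f a
  proof -
    have "poly_eval (Poly_Mapping.lookup f) (subpoly (\<lambda>b. \<not> Poly_Mapping.keys b \<subseteq> A) (z a)) = 0"
      unfolding poly_eval_def
    proof (rule sum.neutral, rule ballI)
      fix b assume "b \<in> Poly_Mapping.keys (subpoly (\<lambda>b. \<not> Poly_Mapping.keys b \<subseteq> A) (z a))"
      then obtain i where i: "i \<in> Poly_Mapping.keys b" "i \<notin> A" by (auto simp: keys_subpoly)
      then have "Poly_Mapping.lookup f i = 0" using f X by (auto simp: A_def polys_le_lookup)
      then have "mono_eval (Poly_Mapping.lookup f) b = 0" unfolding mono_eval_def
        using i by (intro prod_zero) (auto intro!: bexI[of _ i] simp: in_keys_iff)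
      then show "Poly_Mapping.lookup (subpoly (\<lambda>b. \<not> Poly_Mapping.keys b \<subseteq> A) (z a)) b *
        mono_eval (Poly_Mapping.lookup f) b = 0" by simp
    qed
    note rest = this
    have "z a = w a + subpoly (\<lambda>b. \<not> Poly_Mapping.keys b \<subseteq> A) (z a)"
      unfolding w_def by (rule subpoly_split)
    from arg_cong[OF this, of "poly_eval (Poly_Mapping.lookup f)"]
    have "poly_eval (Poly_Mapping.lookup f) (w a) = poly_eval (Poly_Mapping.lookup f) (z a)"
      unfolding poly_eval_add rest by simp
    then show ?thesis by (simp add: z_def poly_eval_prod poly_eval_power mono_eval_def)
  qed
  have "w a \<in> cv.span ((\<lambda>b. Poly_Mapping.single b 1) ` B)" if a: "a \<in> S" for a
  proof -
    have "z a \<in> polys_le (\<Sum>i\<in>Poly_Mapping.keys a. Poly_Mapping.lookup a i * D)"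
      unfolding z_def using a yD by (intro polys_le_prod polys_le_power) (auto simp: S_def)
    moreover have "(\<Sum>i\<in>Poly_Mapping.keys a. Poly_Mapping.lookup a i * D) \<le> (\<Sum>i\<in>Poly_Mapping.keys a. K * D)"
      using a by (intro sum_mono) (simp add: S_def)
    moreover have "\<dots> \<le> (\<Sum>i<t. K * D)"
      using a by (intro sum_mono2) (auto simp: S_def)
    ultimately have "z a \<in> polys_le (t * (K * D))" by (auto intro: polys_le_mono)
    note zle = this
    have "Poly_Mapping.keys (w a) \<subseteq> B"
    proof
      fix b assume "b \<in> Poly_Mapping.keys (w a)"
      then have b: "Poly_Mapping.keys b \<subseteq> A" "b \<in> Poly_Mapping.keys (z a)"
        by (simp_all add: w_def keys_subpoly)
      then have "mono_degree b \<le> t * (K * D)" using zle by (simp add: polys_le_def)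
      then show "b \<in> B" using b(1) by (auto simp: B_def intro: order_trans[OF lookup_le_mono_degree])
    qed
    then have "w a = (\<Sum>b\<in>B. Poly_Mapping.single b (Poly_Mapping.lookup (w a) b))"
      by (intro single_expansion fB)
    also have "\<dots> = (\<Sum>b\<in>B. cscale (Poly_Mapping.lookup (w a) b) (Poly_Mapping.single b 1))"
      by (simp add: cscale_single)
    also have "\<dots> \<in> cv.span ((\<lambda>b. Poly_Mapping.single b 1) ` B)"
      by (intro cv.span_sum cv.span_scale cv.span_base) auto
    finally show ?thesis .
  qed
  moreover have "card ((\<lambda>b. Poly_Mapping.single b (1::complex)) ` B) < card S"
    using card_image_le[OF fB] card le_less_trans by blast
  ultimately obtain c where c: "\<exists>a\<in>S. c a \<noteq> 0" "(\<Sum>a\<in>S. cscale (c a) (w a)) = 0"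
    using family_dependent[of S "(\<lambda>b. Poly_Mapping.single b 1) ` B" w] fS fB by blast
  \<comment> \<open>The coefficients of the linear dependence are those of an algebraic relation
    among the \<open>y i\<close>.\<close>
  define R where "R = (\<Sum>a\<in>S. Poly_Mapping.single a (c a))"
  have lR: "Poly_Mapping.lookup R a = (if a \<in> S then c a else 0)" for a
    using fS by (auto simp: R_def lookup_sum lookup_single when_def sum.delta')
  have "indets R \<subseteq> {..<t}"
  proof
    fix i assume "i \<in> indets R"
    then obtain a where a: "a \<in> Poly_Mapping.keys R" "i \<in> Poly_Mapping.keys a" by (auto simp: indets_def)
    then have "a \<in> S" using lR[of a] by (auto simp: in_keys_iff split: if_splits)
    then show "i \<in> {..<t}" using a by (auto simp: S_def)
  qed
  moreover have "poly_eval (\<lambda>i. poly_eval (Poly_Mapping.lookup f) (y i)) R = 0" if f: "f \<in> X" for f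
  proof -
    have "poly_eval (\<lambda>i. poly_eval (Poly_Mapping.lookup f) (y i)) R =
        poly_eval (Poly_Mapping.lookup f) (\<Sum>a\<in>S. cscale (c a) (w a))"
      by (simp add: R_def poly_eval_sum poly_eval_single poly_eval_cscale ev[OF f])
    then show ?thesis by (simp add: c)
  qed
  ultimately have "R = 0" by (rule y)
  from c(1) obtain a where "a \<in> S" "c a \<noteq> 0" by blast
  with lR[of a] \<open>R = 0\<close> show False by simp
qed

section \<open>Points and closed sets of projective space\<close>

lemma proj_class_self:
  assumes "f \<in> polys_le m" "f \<noteq> 0"
  shows "f \<in> proj_class m f" "proj_class m f \<in> proj_points m"
proof -
  have "(f, f) \<in> scaling_rel m"
    using assms unfolding scaling_rel_def by (auto intro!: exI[of _ 1])
  then show "f \<in> proj_class m f" by (simp add: proj_class_def)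
  show "proj_class m f \<in> proj_points m"
    unfolding proj_class_def proj_points_def using assms by (intro quotientI) simp
qed

lemma proj_points_nonempty: "L \<in> proj_points m \<Longrightarrow> \<exists>f. f \<in> L"
  unfolding proj_points_def by (erule quotientE) (use proj_class_self(1) in \<open>auto simp: proj_class_def\<close>)

lemma topspace_proj_space: "topspace (proj_space m) = (proj_points m :: 'v cpoly set set)"
proof -
  have "openin (proj_space m) (proj_points m :: 'v cpoly set set)"
    unfolding openin_proj_space
  proof (intro exI conjI)
    show "{1 :: 'v monomial cpoly} \<subseteq> (\<Union>k. forms k)" using forms_one by blast
    have "L \<notin> proj_zeros m {1}" if "L \<in> proj_points m" for L :: "'v cpoly set"
      using proj_points_nonempty[OF that] by (auto simp: proj_zeros_def)
    then show "proj_points m = (proj_points m :: 'v cpoly set set) - proj_zeros m {1}" by blast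
  qed
  moreover have "U \<subseteq> proj_points m" if "openin (proj_space m) U" for U
    using that by (auto simp: openin_proj_space)
  ultimately show ?thesis by (metis openin_subset openin_topspace subset_antisym)
qed

lemma closedin_proj_space:
  "closedin (proj_space m) Z \<longleftrightarrow> (\<exists>S. S \<subseteq> (\<Union>k. forms k) \<and> Z = proj_zeros m S)"
proof -
  have "proj_zeros m S \<subseteq> proj_points m" for S :: "'a monomial cpoly set" by (auto simp: proj_zeros_def)
  then show ?thesis
    unfolding closedin_def topspace_proj_space openin_proj_space
    by (metis Diff_Diff_Int Diff_subset inf.absorb_iff2)
qed

lemma proj_pointsE:
  assumes "L \<in> proj_points m" "f \<in> L"
  shows "f \<in> polys_le m" "f \<noteq> 0" "L = proj_class m f" "\<And>g. g \<in> L \<longleftrightarrow> (\<exists>c. c \<noteq> 0 \<and> g = cscale c f)"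
proof -
  from assms obtain h where h: "h \<in> polys_le m" "h \<noteq> 0" "L = scaling_rel m `` {h}"
    by (auto simp: proj_points_def quotient_def)
  then obtain c where c: "c \<noteq> 0" "f = cscale c h" "f \<in> polys_le m" "f \<noteq> 0"
    using assms(2) by (auto simp: scaling_rel_def)
  have sc: "cscale b p \<in> polys_le m - {0}" if "p \<in> polys_le m - {0}" "b \<noteq> 0" for p :: "'a cpoly" and b
    using that by (auto simp: polys_le_lookup cscale_lookup)
  have *: "(h, g) \<in> scaling_rel m \<longleftrightarrow> (\<exists>c. c \<noteq> 0 \<and> g = cscale c h)" for g
    using h sc[of h] by (auto simp: scaling_rel_def)
  have **: "(f, g) \<in> scaling_rel m \<longleftrightarrow> (\<exists>c. c \<noteq> 0 \<and> g = cscale c f)" for g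
    using c sc[of f] by (auto simp: scaling_rel_def)
  have eq: "(\<exists>b. b \<noteq> 0 \<and> g = cscale b h) \<longleftrightarrow> (\<exists>b. b \<noteq> 0 \<and> g = cscale b f)" for g
  proof
    assume "\<exists>b. b \<noteq> 0 \<and> g = cscale b h"
    then obtain b where "b \<noteq> 0" "g = cscale b h" by blast
    then show "\<exists>b. b \<noteq> 0 \<and> g = cscale b f" using c by (intro exI[of _ "b / c"]) simp
  next
    assume "\<exists>b. b \<noteq> 0 \<and> g = cscale b f"
    then obtain b where "b \<noteq> 0" "g = cscale b f" by blast
    then show "\<exists>b. b \<noteq> 0 \<and> g = cscale b h" using c by (intro exI[of _ "b * c"]) simp
  qed
  show "f \<in> polys_le m" "f \<noteq> 0" by (rule c)+
  show "L = proj_class m f" using h(3) by (auto simp: proj_class_def * ** eq)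
  show "g \<in> L \<longleftrightarrow> (\<exists>c. c \<noteq> 0 \<and> g = cscale c f)" for g
    using h(3) by (auto simp: * eq)
qed

lemma proj_zeros_iff:
  assumes "S \<subseteq> (\<Union>k. forms k)" "L \<in> proj_points m" "f \<in> L"
  shows "L \<in> proj_zeros m S \<longleftrightarrow> (\<forall>F\<in>S. poly_eval (Poly_Mapping.lookup f) F = 0)"
proof
  assume *: "\<forall>F\<in>S. poly_eval (Poly_Mapping.lookup f) F = 0"
  have "poly_eval (Poly_Mapping.lookup g) F = 0" if "g \<in> L" "F \<in> S" for g F
  proof -
    from that assms obtain k where "F \<in> forms k" by blast
    from proj_class_vanish[OF assms(2) this assms(3) that(1)] show ?thesis using * that by blast
  qed
  then show "L \<in> proj_zeros m S" using assms(2) by (simp add: proj_zeros_def)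
qed (use assms in \<open>auto simp: proj_zeros_def\<close>)

lemma closedin_proj_subset:
  assumes "closedin (proj_space m) Z"
  shows "Z \<subseteq> proj_points m" "\<Union>Z \<subseteq> polys_le m"
proof -
  show *: "Z \<subseteq> proj_points m" using closedin_subset[OF assms] by (simp add: topspace_proj_space)
  show "\<Union>Z \<subseteq> polys_le m"
  proof
    fix f assume "f \<in> \<Union>Z"
    then obtain L where "L \<in> proj_points m" "f \<in> L" using * by auto
    then show "f \<in> polys_le m" by (rule proj_pointsE(1))
  qed
qed

text \<open>Closed sets are cut out by forms, but \<open>F\<close> is arbitrary. A class contains
  all nonzero multiples of its members, so vanishing of \<open>F\<close> on the whole class forces
  each homogeneous component of \<open>F\<close> to vanish there.\<close>

lemma closedin_vanishing:
  assumes Z: "closedin (proj_space m) Z"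
  shows "closedin (proj_space m) {L \<in> Z. \<forall>f\<in>L. poly_eval (Poly_Mapping.lookup f) F = 0}"
proof -
  define H where "H = (\<lambda>k. subpoly (\<lambda>a. mono_degree a = k) F)"
  \<comment> \<open>The inserted 0 keeps the maximum defined when \<open>F = 0\<close>.\<close>
  define M where "M = Max (insert 0 (mono_degree ` Poly_Mapping.keys F))"
  have M: "mono_degree a \<le> M" if "a \<in> Poly_Mapping.keys F" for a
    unfolding M_def using that by (intro Max_ge) auto
  have F: "F = (\<Sum>k\<le>M. H k)"
  proof (rule poly_mapping_eqI)
    fix a
    show "Poly_Mapping.lookup F a = Poly_Mapping.lookup (\<Sum>k\<le>M. H k) a"
      using M[of a] by (auto simp: H_def lookup_sum lookup_subpoly in_keys_iff)
  qed
  have Hf: "H k \<in> forms k" for k by (simp add: H_def subpoly_forms)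
  have *: "(\<forall>f\<in>L. poly_eval (Poly_Mapping.lookup f) F = 0) \<longleftrightarrow>
      (\<forall>f\<in>L. \<forall>G\<in>H ` {..M}. poly_eval (Poly_Mapping.lookup f) G = 0)" if L: "L \<in> proj_points m" for L
  proof
    assume r: "\<forall>f\<in>L. \<forall>G\<in>H ` {..M}. poly_eval (Poly_Mapping.lookup f) G = 0"
    then show "\<forall>f\<in>L. poly_eval (Poly_Mapping.lookup f) F = 0"
      by (subst F) (auto simp: poly_eval_sum)
  next
    assume l: "\<forall>f\<in>L. poly_eval (Poly_Mapping.lookup f) F = 0"
    show "\<forall>f\<in>L. \<forall>G\<in>H ` {..M}. poly_eval (Poly_Mapping.lookup f) G = 0"
    proof (intro ballI)
      fix f G assume f: "f \<in> L" and "G \<in> H ` {..M}"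
      then obtain k where k: "k \<le> M" "G = H k" by auto
      \<comment> \<open>The value of \<open>F\<close> at \<open>cscale c f\<close> as a polynomial
        in \<open>c\<close>. Its coefficients are the values of the components at \<open>f\<close>,
        and it has every nonzero \<open>c\<close> as a root.\<close>
      define q where "q = (\<Sum>j\<le>M. monom (poly_eval (Poly_Mapping.lookup f) (H j)) j)"
      have "poly q c = 0" if "c \<noteq> 0" for c
      proof -
        have "cscale c f \<in> L" using proj_pointsE(4)[OF L f] that by blast
        then have "0 = poly_eval (Poly_Mapping.lookup (cscale c f)) F" using l by simp
        also have "\<dots> = (\<Sum>j\<le>M. c ^ j * poly_eval (Poly_Mapping.lookup f) (H j))"
          by (subst F) (simp add: poly_eval_sum cscale_lookup[abs_def] poly_eval_homogeneous[OF Hf])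
        also have "\<dots> = poly q c" by (simp add: q_def poly_sum poly_monom mult.commute)
        finally show ?thesis by simp
      qed
      then have "UNIV - {0} \<subseteq> {c. poly q c = 0}" by blast
      then have "q = 0"
        using poly_roots_finite[of q] infinite_UNIV_char_0[where 'a=complex]
        by (metis finite_Diff2 finite.emptyI finite.insertI finite_subset)
      moreover have "coeff q k = poly_eval (Poly_Mapping.lookup f) (H k)"
        using k by (simp add: q_def coeff_sum)
      ultimately show "poly_eval (Poly_Mapping.lookup f) G = 0" using k by simp
    qed
  qed
  from closedin_proj_subset(1)[OF Z] have "{L \<in> Z. \<forall>f\<in>L. poly_eval (Poly_Mapping.lookup f) F = 0} = Z \<inter> proj_zeros m (H ` {..M})"
    using * by (auto simp: proj_zeros_def)
  moreover have "closedin (proj_space m) (proj_zeros m (H ` {..M}))"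
    unfolding closedin_proj_space using Hf by blast
  ultimately show ?thesis using Z by (simp add: closedin_Int)
qed

lemma polyfun_poly_eval_cscale: "polyfun (\<lambda>s. poly_eval (Poly_Mapping.lookup (cscale s f)) F)"
  by (rule polyfun_poly_eval) (simp add: cscale_lookup polyfun_mult polyfun_id polyfun_const)

text \<open>Splitting \<open>Z\<close> into the closed loci of \<open>F\<close> and of
  \<open>G\<close> leaves, by irreducibility, only one of them: the vanishing ideal of the cone over
  \<open>Z\<close> is prime, also with respect to inhomogeneous polynomials.\<close>

lemma irreducible_prime:
  assumes Z: "irreducible_closedin (proj_space m) Z"
    and FG: "\<And>f. f \<in> \<Union>Z \<Longrightarrow> poly_eval (Poly_Mapping.lookup f) F * poly_eval (Poly_Mapping.lookup f) G = 0"
  shows "(\<forall>f\<in>\<Union>Z. poly_eval (Poly_Mapping.lookup f) F = 0) \<or>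
    (\<forall>f\<in>\<Union>Z. poly_eval (Poly_Mapping.lookup f) G = 0)"
proof -
  let ?A = "\<lambda>F. {L \<in> Z. \<forall>f\<in>L. poly_eval (Poly_Mapping.lookup f) F = 0}"
  have cl: "closedin (proj_space m) Z" using Z by (simp add: irreducible_closedin_def)
  note sub = closedin_proj_subset(1)[OF cl]
  have "L \<in> ?A F \<union> ?A G" if L: "L \<in> Z" for L
  proof (rule ccontr)
    assume "L \<notin> ?A F \<union> ?A G"
    then obtain f g where fg: "f \<in> L" "poly_eval (Poly_Mapping.lookup f) F \<noteq> 0"
      "g \<in> L" "poly_eval (Poly_Mapping.lookup g) G \<noteq> 0" using L by blast
    have Lp: "L \<in> proj_points m" using L sub by blast
    \<comment> \<open>The two points of nonvanishing lie on one line through the origin; a suitable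
      nonzero multiple of \<open>f\<close> serves for both polynomials.\<close>
    obtain c where c: "g = cscale c f" using proj_pointsE(4)[OF Lp fg(1)] fg(3) by blast
    obtain u where "poly_eval (Poly_Mapping.lookup (cscale u f)) F \<noteq> 0"
      "poly_eval (Poly_Mapping.lookup (cscale u f)) G \<noteq> 0" "u \<notin> {0}"
      using polyfun_common_nonzero[OF polyfun_poly_eval_cscale[of f F]
          polyfun_poly_eval_cscale[of f G], of 1 c "{0}"] fg c by auto
    moreover from this have "cscale u f \<in> L" using proj_pointsE(4)[OF Lp fg(1)] by blast
    ultimately show False using FG[of "cscale u f"] L by auto
  qed
  then have "Z = ?A F \<union> ?A G" by blast
  then have "Z = ?A F \<or> Z = ?A G"
    using Z closedin_vanishing[OF cl] unfolding irreducible_closedin_def by blast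
  then show ?thesis by blast
qed

text \<open>Adjoin a form \<open>F\<close> that vanishes on \<open>Z\<close> but not on all of
  \<open>Z'\<close>. In a relation involving \<open>F\<close>, the largest power of \<open>F\<close>
  can be cancelled on \<open>Z'\<close> by primality; restricting to \<open>Z\<close>, where
  \<open>F = 0\<close>, leaves a nontrivial relation among the old functions.\<close>

lemma alg_indep_psubset:
  assumes Z: "closedin (proj_space m) Z" and Z': "irreducible_closedin (proj_space m) Z'"
    and ZZ': "Z \<subset> Z'" and t: "alg_indep (\<Union>Z) t"
  shows "alg_indep (\<Union>Z') (Suc t)"
proof -
  obtain S where S: "S \<subseteq> (\<Union>k. forms k)" "Z = proj_zeros m S" using Z by (auto simp: closedin_proj_space)
  have sub: "Z' \<subseteq> proj_points m"
    using Z' by (intro closedin_proj_subset) (simp add: irreducible_closedin_def)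
  obtain L where L: "L \<in> Z'" "L \<notin> Z" using ZZ' by blast
  then obtain f0 F where F: "F \<in> S" "f0 \<in> L" "poly_eval (Poly_Mapping.lookup f0) F \<noteq> 0"
    using S(2) sub by (auto simp: proj_zeros_def)
  have FZ: "poly_eval (Poly_Mapping.lookup f) F = 0" if "f \<in> \<Union>Z" for f
    using that F(1) S(2) by (auto simp: proj_zeros_def)
  obtain y where "\<forall>R. indets R \<subseteq> {..<t} \<longrightarrow>
    (\<forall>f\<in>\<Union>Z. poly_eval (\<lambda>i. poly_eval (Poly_Mapping.lookup f) (y i)) R = 0) \<longrightarrow> R = 0"
    using alg_indepD[OF t] by (elim exE)
  then have y: "R = 0" if "indets R \<subseteq> {..<t}"
    "\<And>f. f \<in> \<Union>Z \<Longrightarrow> poly_eval (\<lambda>i. poly_eval (Poly_Mapping.lookup f) (y i)) R = 0" for R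
    using that by auto
  define y' where "y' = y(t := F)"
  have "R = 0" if R: "indets R \<subseteq> {..<Suc t}"
    and Rz: "\<And>f. f \<in> \<Union>Z' \<Longrightarrow> poly_eval (\<lambda>i. poly_eval (Poly_Mapping.lookup f) (y' i)) R = 0" for R
  proof (rule ccontr)
    assume "R \<noteq> 0"
    then obtain k R' R0 where *: "\<And>x. poly_eval x R = x t ^ k * poly_eval x R'"
      "R0 \<noteq> 0" "indets R0 \<subseteq> indets R - {t}" "\<And>x. x t = 0 \<Longrightarrow> poly_eval x R' = poly_eval x R0"
      using split_variable[of R t] by blast
    obtain H where H: "\<And>x. poly_eval x H = poly_eval (\<lambda>i. poly_eval x (y' i)) R'"
      using poly_eval_compose[of y' R'] by blast
    have "poly_eval (Poly_Mapping.lookup f) F * poly_eval (Poly_Mapping.lookup f) H = 0"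
      if "f \<in> \<Union>Z'" for f
      using Rz[OF that] by (auto simp: *(1) H y'_def)
    then have "\<forall>f\<in>\<Union>Z'. poly_eval (Poly_Mapping.lookup f) H = 0"
      using irreducible_prime[OF Z', of F H] F L by blast
    have i0: "indets R0 \<subseteq> {..<t}" using *(3) R by (auto simp: lessThan_Suc)
    have "poly_eval (\<lambda>i. poly_eval (Poly_Mapping.lookup f) (y i)) R0 = 0" if f: "f \<in> \<Union>Z" for f
    proof -
      have "poly_eval (\<lambda>i. poly_eval (Poly_Mapping.lookup f) (y i)) R0 =
          poly_eval (\<lambda>i. poly_eval (Poly_Mapping.lookup f) (y' i)) R0"
        using i0 by (intro poly_eval_cong) (auto simp: y'_def indets_def)
      also have "\<dots> = poly_eval (Poly_Mapping.lookup f) H"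
        unfolding H using FZ[OF f] by (intro *(4)[symmetric]) (simp add: y'_def)
      also have "\<dots> = 0" using \<open>\<forall>f\<in>\<Union>Z'. _\<close> f ZZ' by blast
      finally show ?thesis .
    qed
    then have "R0 = 0" by (rule y[OF i0])
    with *(2) show False by simp
  qed
  then show ?thesis by (rule alg_indepI)
qed

section \<open>Codimension in projective space\<close>

text \<open>Both numbers count affine dimensions of cones, so their difference needs no correction
  by one for passing to projective space.\<close>

lemma irreducible_codim_le:
  fixes Z :: "'n::finite cpoly set set"
  assumes "alg_indep (\<Union>Z) t"
  shows "irreducible_codim (proj_space m) Z \<le> enat (card {a :: 'n monomial. mono_degree a \<le> m} - t)"
  unfolding irreducible_codim_def
proof (rule Sup_least, clarify)
  fix k and C :: "nat \<Rightarrow> 'n cpoly set set"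
  assume C: "\<forall>i\<le>k. irreducible_closedin (proj_space m) (C i)" "\<forall>i<k. C i \<subset> C (Suc i)" "Z = C 0"
  have "alg_indep (\<Union>(C i)) (t + i)" if "i \<le> k" for i
    using that
  proof (induction i)
    case 0
    then show ?case using assms C by simp
  next
    case (Suc i)
    have "alg_indep (\<Union>(C (Suc i))) (Suc (t + i))"
      using Suc C by (intro alg_indep_psubset[of m "C i"]) (auto simp: irreducible_closedin_def)
    then show ?case by simp
  qed
  then have "alg_indep (\<Union>(C k)) (t + k)" by simp
  moreover have "\<Union>(C k) \<subseteq> polys_le m"
    using C(1) by (intro closedin_proj_subset) (simp add: irreducible_closedin_def)
  ultimately have "t + k \<le> card {a :: 'n monomial. mono_degree a \<le> m}" by (rule alg_indep_le[rotated])
  then show "enat k \<le> enat (card {a :: 'n monomial. mono_degree a \<le> m} - t)" by simp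
qed

lemma irreducible_codim_ge:
  assumes "\<And>i. i \<le> k \<Longrightarrow> irreducible_closedin X (C i)" "\<And>i. i < k \<Longrightarrow> C i \<subset> C (Suc i)"
  shows "enat k \<le> irreducible_codim X (C 0)"
  unfolding irreducible_codim_def using assms by (intro Sup_upper) blast

text \<open>A chain starting at \<open>Y\<close> becomes one of equal length starting at a smaller
  \<open>Z\<close> when its first member is exchanged, so the infimum is attained at
  \<open>Y\<close> itself.\<close>

lemma codimension_irreducible:
  assumes Y: "irreducible_closedin X Y"
  shows "codimension X Y = irreducible_codim X Y"
proof (rule antisym)
  show "codimension X Y \<le> irreducible_codim X Y"
    unfolding codimension_def using Y by (intro INF_lower) auto
  have "irreducible_codim X Y \<le> irreducible_codim X Z"
    if Z: "irreducible_closedin X Z" "Z \<subseteq> Y" for Z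
    unfolding irreducible_codim_def[of X Y]
  proof (rule Sup_least, clarify)
    fix k C
    assume C: "\<forall>i\<le>k. irreducible_closedin X (C i)" "\<forall>i<k. C i \<subset> C (Suc i)" "Y = C 0"
    define C' where "C' = C(0 := Z)"
    have "enat k \<le> irreducible_codim X (C' 0)"
    proof (rule irreducible_codim_ge)
      show "irreducible_closedin X (C' i)" if "i \<le> k" for i using that C Z by (auto simp: C'_def)
      show "C' i \<subset> C' (Suc i)" if "i < k" for i
        using that C(2)[rule_format, of i] Z(2) C(3) by (auto simp: C'_def)
    qed
    then show "enat k \<le> irreducible_codim X Z" by (simp add: C'_def)
  qed
  then show "irreducible_codim X Y \<le> codimension X Y"
    unfolding codimension_def by (intro INF_greatest) auto
qed

text \<open>Any two points of \<open>X\<close> lie on a polynomial curve inside \<open>X\<close>, and a non-trivial polynomial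
  has only finitely many zeros on a curve.\<close>

lemma irreducible_closure:
  assumes X: "X \<subseteq> polys_le m - {0}" "X \<noteq> {}"
    and curve: "\<And>u v. u \<in> X \<Longrightarrow> v \<in> X \<Longrightarrow> \<exists>\<gamma>. \<gamma> 0 = u \<and> \<gamma> 1 = v \<and> (\<forall>s. \<gamma> s \<in> X) \<and>
      (\<forall>a. polyfun (\<lambda>s. Poly_Mapping.lookup (\<gamma> s) a))"
  shows "irreducible_closedin (proj_space m) (proj_space m closure_of (proj_class m ` X))" (is "irreducible_closedin ?P ?Z")
proof -
  have sub: "proj_class m ` X \<subseteq> topspace ?P"
    using X proj_class_self(2) by (auto simp: topspace_proj_space)
  have le: "proj_class m ` X \<subseteq> ?Z" using sub by (rule closure_of_subset)
  have "?Z = A \<or> ?Z = B" if A: "closedin ?P A" and B: "closedin ?P B" and AB: "?Z = A \<union> B" for A B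
  proof (rule ccontr)
    assume "\<not> ?thesis"
    then have "\<not> ?Z \<subseteq> A" "\<not> ?Z \<subseteq> B" using AB by blast+
    then have "\<not> proj_class m ` X \<subseteq> A" "\<not> proj_class m ` X \<subseteq> B"
      using A B closure_of_minimal by blast+
    then obtain u v where uv: "u \<in> X" "proj_class m u \<notin> A" "v \<in> X" "proj_class m v \<notin> B" by blast
    obtain S where S: "S \<subseteq> (\<Union>k. forms k)" "A = proj_zeros m S" using A by (auto simp: closedin_proj_space)
    obtain T where T: "T \<subseteq> (\<Union>k. forms k)" "B = proj_zeros m T" using B by (auto simp: closedin_proj_space)
    have iff: "proj_class m f \<in> proj_zeros m S \<longleftrightarrow> (\<forall>F\<in>S. poly_eval (Poly_Mapping.lookup f) F = 0)"
      if "f \<in> X" "S \<subseteq> (\<Union>k. forms k)" for f S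
      using X(1) that proj_class_self[of f m] by (intro proj_zeros_iff) auto
    obtain F where F: "F \<in> S" "poly_eval (Poly_Mapping.lookup u) F \<noteq> 0"
      using uv S iff by blast
    obtain G where G: "G \<in> T" "poly_eval (Poly_Mapping.lookup v) G \<noteq> 0"
      using uv T iff by blast
    obtain \<gamma> where \<gamma>: "\<gamma> 0 = u" "\<gamma> 1 = v" "\<And>s. \<gamma> s \<in> X"
      "\<And>a. polyfun (\<lambda>s. Poly_Mapping.lookup (\<gamma> s) a)" using curve[OF uv(1,3)] by blast
    have pf: "polyfun (\<lambda>s. poly_eval (Poly_Mapping.lookup (\<gamma> s)) H)" for H
      by (intro polyfun_poly_eval \<gamma>)
    obtain s where "poly_eval (Poly_Mapping.lookup (\<gamma> s)) F \<noteq> 0"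
      "poly_eval (Poly_Mapping.lookup (\<gamma> s)) G \<noteq> 0"
      using polyfun_common_nonzero[OF pf[of F] pf[of G], of 0 1 "{}"] F G \<gamma> by auto
    then have "proj_class m (\<gamma> s) \<notin> A" "proj_class m (\<gamma> s) \<notin> B"
      using iff[OF \<gamma>(3)] S T F G by blast+
    then show False using le \<gamma>(3) AB by blast
  qed
  moreover have "?Z \<noteq> {}" using le X(2) by blast
  ultimately show ?thesis by (auto simp: irreducible_closedin_def)
qed

lemma closure_vanishing:
  assumes X: "X \<subseteq> polys_le m - {0}" and F: "F \<in> forms k"
    and 0: "\<And>f. f \<in> X \<Longrightarrow> poly_eval (Poly_Mapping.lookup f) F = 0"
  shows "proj_space m closure_of (proj_class m ` X) \<subseteq> proj_zeros m {F}"
proof (rule closure_of_minimal)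
  show "closedin (proj_space m) (proj_zeros m {F})" 
    unfolding closedin_proj_space using F by (intro exI[of _ "{F}"]) auto
  show "proj_class m ` X \<subseteq> proj_zeros m {F}"
  proof clarify
    fix f assume "f \<in> X"
    then show "proj_class m f \<in> proj_zeros m {F}"
      using proj_zeros_iff[of "{F}" "proj_class m f" m f] proj_class_self[of f m] X F 0 by auto
  qed
qed

section \<open>Taylor polynomials of rational functions\<close>

definition pdv :: "'v \<Rightarrow> 'v cpoly \<Rightarrow> 'v cpoly" where
  "pdv i p = Poly_Mapping.mapp (\<lambda>a c. of_nat (Poly_Mapping.lookup a i + 1) * c)
     (Poly_Mapping.map_key (\<lambda>a. a + Poly_Mapping.single i 1) p)"

lemma lookup_pdv: "Poly_Mapping.lookup (pdv i p) a =
   of_nat (Poly_Mapping.lookup a i + 1) * Poly_Mapping.lookup p (a + Poly_Mapping.single i 1)"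
proof -
  have inj: "inj (\<lambda>a. a + Poly_Mapping.single i (1::nat))" by (auto intro: injI)
  have mk: "Poly_Mapping.lookup (Poly_Mapping.map_key (\<lambda>a. a + Poly_Mapping.single i 1) p) b =
      Poly_Mapping.lookup p (b + Poly_Mapping.single i 1)" for b
    unfolding map_key.rep_eq[OF inj] by simp
  show ?thesis
    by (cases "Poly_Mapping.lookup p (a + Poly_Mapping.single i 1) = 0")
       (simp_all add: pdv_def lookup_mapp in_keys_iff mk del: One_nat_def)
qed

lemma pdv_add: "pdv i (p + q) = pdv i p + pdv i q"
  by (rule poly_mapping_eqI) (simp add: lookup_pdv lookup_add algebra_simps)

lemma pdv_single:
  "pdv i (Poly_Mapping.single a c) =
     Poly_Mapping.single (a - Poly_Mapping.single i 1) (of_nat (Poly_Mapping.lookup a i) * c)"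
proof (rule poly_mapping_eqI)
  fix b
  let ?e = "Poly_Mapping.single i (1::nat)"
  show "Poly_Mapping.lookup (pdv i (Poly_Mapping.single a c)) b =
    Poly_Mapping.lookup (Poly_Mapping.single (a - ?e) (of_nat (Poly_Mapping.lookup a i) * c)) b"
  proof (cases "a = b + ?e")
    case True
    then show ?thesis by (simp add: lookup_pdv lookup_add)
  next
    case False
    have "Poly_Mapping.lookup a i = 0" if "a - ?e = b"
    proof (rule ccontr)
      assume *: "Poly_Mapping.lookup a i \<noteq> 0"
      have "a = b + ?e"
      proof (rule poly_mapping_eqI)
        fix j
        show "Poly_Mapping.lookup a j = Poly_Mapping.lookup (b + ?e) j"
          using * by (cases "j = i") (simp_all add: that[symmetric] lookup_add lookup_minus lookup_single)
      qed
      with False show False by simp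
    qed
    then show ?thesis using False by (auto simp: lookup_pdv lookup_single when_def)
  qed
qed

lemma mono_eval_update:
  "mono_eval (x(i := t)) a =
     t ^ Poly_Mapping.lookup a i * (\<Prod>j\<in>Poly_Mapping.keys a - {i}. x j ^ Poly_Mapping.lookup a j)"
proof -
  have "mono_eval (x(i := t)) a = (\<Prod>j\<in>insert i (Poly_Mapping.keys a). (x(i := t)) j ^ Poly_Mapping.lookup a j)"
    by (rule mono_eval_superset) auto
  also have "\<dots> = t ^ Poly_Mapping.lookup a i * (\<Prod>j\<in>insert i (Poly_Mapping.keys a) - {i}. (x(i := t)) j ^ Poly_Mapping.lookup a j)"
    by (subst prod.remove[of _ i]) auto
  also have "(\<Prod>j\<in>insert i (Poly_Mapping.keys a) - {i}. (x(i := t)) j ^ Poly_Mapping.lookup a j)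
      = (\<Prod>j\<in>Poly_Mapping.keys a - {i}. x j ^ Poly_Mapping.lookup a j)"
    by (rule prod.cong) auto
  finally show ?thesis .
qed

lemma poly_eval_has_derivative:
  "((\<lambda>t. poly_eval (x(i := t)) p) has_field_derivative poly_eval (x(i := t)) (pdv i p)) (at t)"
proof (induction p rule: cpoly_induct)
  case (single a c)
  let ?m = "\<Prod>j\<in>Poly_Mapping.keys a - {i}. x j ^ Poly_Mapping.lookup a j"
  let ?k = "Poly_Mapping.lookup a i"
  let ?b = "a - Poly_Mapping.single i (1::nat)"
  have "(\<Prod>j\<in>Poly_Mapping.keys ?b - {i}. x j ^ Poly_Mapping.lookup ?b j) = ?m"
    by (rule prod.cong) (auto simp: in_keys_iff lookup_minus lookup_single)
  then have b: "mono_eval (x(i := t)) ?b = t ^ (?k - 1) * ?m"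
    by (simp add: mono_eval_update lookup_minus)
  have "((\<lambda>t. c * (t ^ ?k * ?m)) has_field_derivative of_nat ?k * c * (t ^ (?k - 1) * ?m)) (at t)"
    by (auto intro!: derivative_eq_intros)
  then show ?case by (simp only: pdv_single poly_eval_single b) (simp only: mono_eval_update)
next
  case (add p q)
  then show ?case by (simp add: pdv_add poly_eval_add DERIV_add)
qed

lemma poly_eval_at_0: "poly_eval (\<lambda>_. 0) p = Poly_Mapping.lookup p 0"
proof -
  have z: "mono_eval (\<lambda>_. 0) a = (if a = 0 then 1 else 0)" for a :: "'a monomial"
  proof (cases "a = 0")
    case False
    then obtain i where "i \<in> Poly_Mapping.keys a" by (metis keys_eq_empty ex_in_conv)
    then have "mono_eval (\<lambda>_. 0) a = 0" unfolding mono_eval_def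
      by (intro prod_zero) (auto intro!: bexI[of _ i] simp: in_keys_iff)
    then show ?thesis using False by simp
  qed simp
  show ?thesis by (simp add: poly_eval_def z if_distrib in_keys_iff cong: if_cong)
qed

section \<open>Order of vanishing at the origin\<close>

definition ord_ge :: "nat \<Rightarrow> 'v cpoly \<Rightarrow> bool" where
  "ord_ge k p \<longleftrightarrow> (\<forall>a. mono_degree a < k \<longrightarrow> Poly_Mapping.lookup p a = 0)"

lemma ord_ge_diff: "ord_ge k p \<Longrightarrow> ord_ge k q \<Longrightarrow> ord_ge k (p - q)"
  by (simp add: ord_ge_def lookup_minus)

lemma ord_ge_mono: "ord_ge k p \<Longrightarrow> j \<le> k \<Longrightarrow> ord_ge j p"
  by (simp add: ord_ge_def)

lemma ord_ge_mult:
  assumes "ord_ge j p" "ord_ge k q"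
  shows "ord_ge (j + k) (p * q)"
  unfolding ord_ge_def
proof (intro allI impI, rule ccontr)
  fix a assume a: "mono_degree a < j + k" "Poly_Mapping.lookup (p * q) a \<noteq> 0"
  then have "a \<in> Poly_Mapping.keys (p * q)" by (simp add: in_keys_iff)
  then obtain b c where bc: "a = b + c" "b \<in> Poly_Mapping.keys p" "c \<in> Poly_Mapping.keys q"
    using keys_mult[of p q] by blast
  then have "j \<le> mono_degree b" "k \<le> mono_degree c"
    using assms by (auto simp: ord_ge_def in_keys_iff not_less[symmetric])
  with a bc show False by (simp add: mono_degree_add)
qed

lemma ord_ge_0: "ord_ge 0 p"
  by (simp add: ord_ge_def)

lemma ord_ge_mult_right: "ord_ge k p \<Longrightarrow> ord_ge k (p * q)"
  using ord_ge_mult[OF _ ord_ge_0[of q], of k p] by simp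

lemma ord_ge_power: "ord_ge 1 p \<Longrightarrow> ord_ge k (p ^ k)"
proof (induction k)
  case (Suc k)
  then show ?case using ord_ge_mult[of 1 p k "p ^ k"] by simp
qed (simp add: ord_ge_0)

lemma ord_ge_pdv: "ord_ge k p \<Longrightarrow> ord_ge (k - 1) (pdv i p)"
  by (auto simp: ord_ge_def lookup_pdv mono_degree_add)

text \<open>The shape T - R / Q^(j+1) is stable under differentiation. The formula for
  \<open>F\<close> is assumed only where \<open>Q\<close> is nonzero, which suffices because that
  set is open along each coordinate line.\<close>

lemma partial_deriv_quotient:
  assumes F: "\<And>x. poly_eval x Q \<noteq> 0 \<Longrightarrow> F x = poly_eval x T - poly_eval x R / poly_eval x Q ^ Suc j"
    and Q: "poly_eval x Q \<noteq> 0"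
  shows "partial_deriv i F x = poly_eval x (pdv i T) -
    poly_eval x (pdv i R * Q - of_nat (Suc j) * (R * pdv i Q)) / poly_eval x Q ^ Suc (Suc j)"
proof -
  let ?S = "{t. poly_eval (x(i := t)) Q \<noteq> 0}"
  have cont: "continuous_on UNIV (\<lambda>t. poly_eval (x(i := t)) Q)"
    by (intro continuous_at_imp_continuous_on ballI DERIV_isCont[OF poly_eval_has_derivative])
  then have op: "open ?S" by (intro open_Collect_neq continuous_on_const)
  let ?t = "x i"
  have "((\<lambda>t. poly_eval (x(i := t)) T - poly_eval (x(i := t)) R / poly_eval (x(i := t)) Q ^ Suc j)
     has_field_derivative (poly_eval (x(i := ?t)) (pdv i T) -
       (poly_eval (x(i := ?t)) (pdv i R) * poly_eval (x(i := ?t)) Q ^ Suc j -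
        poly_eval (x(i := ?t)) R * (of_nat (Suc j) * (poly_eval (x(i := ?t)) (pdv i Q) * poly_eval (x(i := ?t)) Q ^ (Suc j - Suc 0))))
        / (poly_eval (x(i := ?t)) Q ^ Suc j * poly_eval (x(i := ?t)) Q ^ Suc j))) (at ?t)"
    using Q by (intro DERIV_diff DERIV_divide DERIV_power poly_eval_has_derivative) simp
  note D = this[unfolded fun_upd_triv diff_Suc_Suc diff_zero]
  have "(F \<circ> (\<lambda>t. x(i := t)) has_field_derivative (poly_eval x (pdv i T) -
       (poly_eval x (pdv i R) * poly_eval x Q ^ Suc j -
        poly_eval x R * (of_nat (Suc j) * (poly_eval x (pdv i Q) * poly_eval x Q ^ j)))
        / (poly_eval x Q ^ Suc j * poly_eval x Q ^ Suc j))) (at ?t)"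
    by (rule has_field_derivative_transform_within_open[OF D op]) (use Q F in simp_all)
  moreover have "(a * q ^ Suc j - r * (n * (b * q ^ j))) / (q ^ Suc j * q ^ Suc j) =
     (a * q - n * (r * b)) / q ^ Suc (Suc j)" if "q \<noteq> 0" for a q r n b :: complex
    using that by (simp add: divide_simps) (simp add: algebra_simps)
  ultimately have "(F \<circ> (\<lambda>t. x(i := t)) has_field_derivative (poly_eval x (pdv i T) -
       (poly_eval x (pdv i R) * poly_eval x Q - of_nat (Suc j) * (poly_eval x R * poly_eval x (pdv i Q)))
        / poly_eval x Q ^ Suc (Suc j))) (at ?t)"
    using Q by simp
  then have "partial_deriv i F x = poly_eval x (pdv i T) -
       (poly_eval x (pdv i R) * poly_eval x Q - of_nat (Suc j) * (poly_eval x R * poly_eval x (pdv i Q)))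
        / poly_eval x Q ^ Suc (Suc j)"
    unfolding partial_deriv_def o_def by (rule DERIV_imp_deriv)
  moreover have "poly_eval x (p - q) = poly_eval x p - poly_eval x q" for p q
    using poly_eval_add[of x "p - q" q] by simp
  moreover have "poly_eval x (of_nat n) = of_nat n" for n
    by (induction n) (simp_all add: poly_eval_add)
  ultimately show ?thesis by (simp only: poly_eval_mult)
qed

text \<open>One differentiation lowers the order of the remainder numerator by at most one. Starting
  from order \<open>Suc m\<close>, at least one order of vanishing is left after up to
  \<open>m\<close> derivatives, so the remainder contributes nothing at the origin.\<close>

lemma foldr_partial_deriv:
  assumes F: "\<And>x. poly_eval x Q \<noteq> 0 \<Longrightarrow> F x = poly_eval x T - poly_eval x R / poly_eval x Q"
    and R: "ord_ge (Suc m) R"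
  shows "\<exists>R'. ord_ge (Suc m - length vs) R' \<and> (\<forall>x. poly_eval x Q \<noteq> 0 \<longrightarrow>
     foldr partial_deriv vs F x = poly_eval x (foldr pdv vs T) - poly_eval x R' / poly_eval x Q ^ Suc (length vs))"
proof (induction vs)
  case Nil
  then show ?case using F R by auto
next
  case (Cons v vs)
  then obtain R' where R': "ord_ge (Suc m - length vs) R'"
    "\<And>x. poly_eval x Q \<noteq> 0 \<Longrightarrow> foldr partial_deriv vs F x =
       poly_eval x (foldr pdv vs T) - poly_eval x R' / poly_eval x Q ^ Suc (length vs)" by blast
  let ?R = "pdv v R' * Q - of_nat (Suc (length vs)) * (R' * pdv v Q)"
  have a: "ord_ge (Suc m - length (v # vs)) (pdv v R')" using ord_ge_pdv[OF R'(1), of v] by simp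
  have "ord_ge (Suc m - length (v # vs)) R'" using R'(1) by (rule ord_ge_mono) simp
  then have "ord_ge (Suc m - length (v # vs)) (R' * (pdv v Q * of_nat (Suc (length vs))))" by (rule ord_ge_mult_right)
  then have "ord_ge (Suc m - length (v # vs)) (of_nat (Suc (length vs)) * (R' * pdv v Q))"
    by (simp only: mult_ac)
  then have "ord_ge (Suc m - length (v # vs)) ?R" by (rule ord_ge_diff[OF ord_ge_mult_right[OF a]])
  moreover have "foldr partial_deriv (v # vs) F x =
     poly_eval x (foldr pdv (v # vs) T) - poly_eval x ?R / poly_eval x Q ^ Suc (length (v # vs))"
    if "poly_eval x Q \<noteq> 0" for x
    using partial_deriv_quotient[OF R'(2) that, of v] by simp
  ultimately show ?case by blast
qed

lemma mono_fact_add_single: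
  "mono_fact (b + Poly_Mapping.single v 1) = (Poly_Mapping.lookup b v + 1) * mono_fact b"
proof -
  have sup: "mono_fact a = (\<Prod>i\<in>A. fact (Poly_Mapping.lookup a i))"
    if "finite A" "Poly_Mapping.keys a \<subseteq> A" for A and a :: "'a monomial"
    unfolding mono_fact_def using that by (intro prod.mono_neutral_left) (auto simp: in_keys_iff)
  let ?A = "insert v (Poly_Mapping.keys b)"
  have "Poly_Mapping.keys (b + Poly_Mapping.single v 1) \<subseteq> ?A"
    using keys_add[of b "Poly_Mapping.single v 1"] by auto
  then have "mono_fact (b + Poly_Mapping.single v 1) =
     fact (Poly_Mapping.lookup b v + 1) * (\<Prod>i\<in>?A - {v}. fact (Poly_Mapping.lookup b i))"
    by (subst sup[of ?A], simp, simp, subst prod.remove[of _ v])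
       (auto simp: lookup_add lookup_single when_def intro!: prod.cong split: if_splits)
  also have "\<dots> = (Poly_Mapping.lookup b v + 1) * (\<Prod>i\<in>?A. fact (Poly_Mapping.lookup b i))"
    by (subst prod.remove[of ?A v]) (auto simp: algebra_simps)
  also have "(\<Prod>i\<in>?A. fact (Poly_Mapping.lookup b i)) = mono_fact b"
    by (rule sup[symmetric]) auto
  finally show ?thesis .
qed

text \<open>The factorials telescope. The shift \<open>b\<close> carries the induction; at
  \<open>b = 0\<close> the iterated derivative at the origin becomes a! times the coefficient of
  x^a.\<close>

lemma lookup_foldr_pdv:
  "Poly_Mapping.lookup (foldr pdv vs T) b * of_nat (mono_fact b) =
     of_nat (mono_fact (b + (\<Sum>v\<leftarrow>vs. Poly_Mapping.single v 1))) *
       Poly_Mapping.lookup T (b + (\<Sum>v\<leftarrow>vs. Poly_Mapping.single v 1))"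
proof (induction vs arbitrary: b)
  case (Cons v vs)
  have "Poly_Mapping.lookup (foldr pdv (v # vs) T) b * of_nat (mono_fact b) =
     Poly_Mapping.lookup (foldr pdv vs T) (b + Poly_Mapping.single v 1) *
       of_nat (mono_fact (b + Poly_Mapping.single v 1))"
    by (simp only: foldr.simps o_apply lookup_pdv mono_fact_add_single of_nat_mult mult_ac)
  then show ?case by (simp add: Cons.IH add.assoc)
qed simp

lemma mono_fact_nonzero: "mono_fact a \<noteq> 0"
  by (simp add: mono_fact_def)

text \<open>Write P/Q = T - (Q T - P)/Q; the last term has order greater than \<open>m\<close>. This
  replaces the analytic definition by a congruence of polynomials.\<close>

lemma is_taylor_polyI:
  assumes T: "T \<in> polys_le m" and Q: "Poly_Mapping.lookup Q 0 = 1"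
    and R: "ord_ge (Suc m) (Q * T - P)"
  shows "is_taylor_poly m (\<lambda>x. poly_eval x P / poly_eval x Q) T"
  unfolding is_taylor_poly_def Let_def
proof (intro conjI T allI impI)
  fix vs :: "'a list" assume vs: "length vs \<le> m"
  let ?a = "\<Sum>v\<leftarrow>vs. Poly_Mapping.single v (1::nat)"
  let ?F = "\<lambda>x. poly_eval x P / poly_eval x Q"
  have "?F x = poly_eval x T - poly_eval x (Q * T - P) / poly_eval x Q" if "poly_eval x Q \<noteq> 0" for x
  proof -
    have "poly_eval x (Q * T) = poly_eval x (Q * T - P) + poly_eval x P"
      by (simp flip: poly_eval_add)
    then have "poly_eval x (Q * T - P) = poly_eval x Q * poly_eval x T - poly_eval x P"
      by (simp add: poly_eval_mult)
    then show ?thesis using that by (simp add: diff_divide_distrib)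
  qed
  from foldr_partial_deriv[of Q ?F T "Q * T - P" m vs, OF this R]
  obtain R' where R': "ord_ge (Suc m - length vs) R'"
    "\<And>x. poly_eval x Q \<noteq> 0 \<Longrightarrow> foldr partial_deriv vs ?F x =
     poly_eval x (foldr pdv vs T) - poly_eval x R' / poly_eval x Q ^ Suc (length vs)" by blast
  have "Poly_Mapping.lookup R' 0 = 0" using R'(1) vs by (simp add: ord_ge_def)
  then have "foldr partial_deriv vs ?F (\<lambda>_. 0) = Poly_Mapping.lookup (foldr pdv vs T) 0"
    using R'(2)[of "\<lambda>_. 0"] Q by (simp add: poly_eval_at_0)
  also have "\<dots> = of_nat (mono_fact ?a) * Poly_Mapping.lookup T ?a"
    using lookup_foldr_pdv[of vs T 0] by (simp add: mono_fact_def)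
  finally show "Poly_Mapping.lookup T ?a = foldr partial_deriv vs ?F (\<lambda>_. 0) / of_nat (mono_fact ?a)"
    using mono_fact_nonzero[of ?a] by simp
qed

section \<open>Uniqueness and existence of Taylor polynomials\<close>

lemma monomial_list: "\<exists>vs. length vs = mono_degree a \<and> (\<Sum>v\<leftarrow>vs. Poly_Mapping.single v 1) = a"
proof (induction "mono_degree a" arbitrary: a)
  case 0
  then show ?case by (intro exI[of _ "[]"]) simp
next
  case (Suc k)
  then have "a \<noteq> 0" by auto
  then obtain i where i: "i \<in> Poly_Mapping.keys a" by (metis keys_eq_empty ex_in_conv)
  let ?e = "Poly_Mapping.single i (1::nat)"
  have a: "a = ?e + (a - ?e)"
  proof (rule poly_mapping_eqI)
    fix j
    show "Poly_Mapping.lookup a j = Poly_Mapping.lookup (?e + (a - ?e)) j"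
      using i by (cases "j = i") (simp_all add: lookup_add lookup_minus lookup_single in_keys_iff)
  qed
  have "mono_degree a = 1 + mono_degree (a - ?e)" by (subst a) (simp add: mono_degree_add)
  then have "k = mono_degree (a - ?e)" using Suc(2) by simp
  from Suc(1)[OF this] obtain vs where vs: "length vs = mono_degree (a - ?e)"
    "(\<Sum>v\<leftarrow>vs. Poly_Mapping.single v 1) = a - ?e" by blast
  show ?case
    by (rule exI[of _ "i # vs"]) (use vs a Suc(2) \<open>k = _\<close> in simp)
qed

lemma is_taylor_poly_unique:
  fixes T :: "'v cpoly"
  assumes "is_taylor_poly m F T" "is_taylor_poly m F T'"
  shows "T = T'"
proof (rule poly_mapping_eqI)
  fix a :: "'v monomial"
  obtain vs where vs: "length vs = mono_degree a" "(\<Sum>v\<leftarrow>vs. Poly_Mapping.single v 1) = a"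
    using monomial_list by blast
  show "Poly_Mapping.lookup T a = Poly_Mapping.lookup T' a"
  proof (cases "mono_degree a \<le> m")
    case True
    then show ?thesis using assms vs unfolding is_taylor_poly_def Let_def by metis
  next
    case False
    then show ?thesis using assms by (simp add: is_taylor_poly_def polys_le_lookup)
  qed
qed

lemma lookup_mult_0: "Poly_Mapping.lookup (p * q) 0 = Poly_Mapping.lookup p 0 * Poly_Mapping.lookup (q :: 'v cpoly) 0"
  by (simp flip: poly_eval_at_0 add: poly_eval_mult)

text \<open>As \<open>1 - Q\<close> has no constant term, the geometric series in it, cut off after
  the power \<open>m\<close>, inverts \<open>Q\<close> up to terms of order
  \<open>Suc m\<close>.\<close>

lemma taylor_quotient_exists:
  assumes Q: "Poly_Mapping.lookup Q 0 = 1"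
  obtains T where "T \<in> polys_le m" "ord_ge (Suc m) (Q * T - P)"
proof -
  define S where "S = P * (\<Sum>k<Suc m. (1 - Q) ^ k)"
  define T where "T = subpoly (\<lambda>a. mono_degree a \<le> m) S"
  have "Q * S - P = - (P * (1 - Q * (\<Sum>k<Suc m. (1 - Q) ^ k)))"
    by (simp add: S_def algebra_simps)
  also have "1 - Q * (\<Sum>k<Suc m. (1 - Q) ^ k) = (1 - Q) ^ Suc m"
  proof -
    have "Q * (\<Sum>k<Suc m. (1 - Q) ^ k) = 1 - (1 - Q) ^ Suc m"
      unfolding one_diff_power_eq[of "1 - Q" "Suc m"] by simp
    then show ?thesis by (simp only: diff_diff_eq2 add_diff_cancel_left' add.commute)
  qed
  finally have 1: "Q * S - P = (1 - Q) ^ Suc m * (- P)" by (simp add: algebra_simps)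
  have "ord_ge 1 (1 - Q)" using Q by (simp add: ord_ge_def lookup_minus)
  then have 2: "ord_ge (Suc m) (Q * S - P)" unfolding 1 by (intro ord_ge_mult_right ord_ge_power)
  have "ord_ge (Suc m) (S - T)"
    by (simp add: ord_ge_def T_def lookup_minus lookup_subpoly)
  then have "ord_ge (Suc m) ((S - T) * Q)" by (rule ord_ge_mult_right)
  then have "ord_ge (Suc m) ((Q * S - P) - (S - T) * Q)" using 2 by (rule ord_ge_diff[rotated])
  also have "(Q * S - P) - (S - T) * Q = Q * T - P" by (simp add: algebra_simps)
  finally show ?thesis by (intro that[of T]) (simp_all add: T_def polys_le_lookup lookup_subpoly)
qed

text \<open>Truncating just one degree above \<open>d\<close> leaves a single condition: for any
  admissible \<open>Q\<close>, the part of \<open>Q * f\<close> up to degree \<open>d\<close> serves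
  as numerator, so only degree \<open>d + 1\<close> is constrained.\<close>

lemma rational_taylor_polys_iff:
  "f \<in> rational_taylor_polys d e (d + 1) \<longleftrightarrow> f \<in> polys_le (d + 1) \<and> Poly_Mapping.lookup f 0 = 1 \<and>
     (\<exists>Q \<in> polys_le e. Poly_Mapping.lookup Q 0 = 1 \<and> subpoly (\<lambda>a. mono_degree a = d + 1) (Q * f) = 0)"
  (is "?L \<longleftrightarrow> ?R")
proof
  assume ?L
  then obtain P Q where PQ: "P \<in> polys_le d" "Q \<in> polys_le e" "Poly_Mapping.lookup P 0 = 1"
    "Poly_Mapping.lookup Q 0 = 1"
    and t: "is_taylor_poly (d + 1) (\<lambda>x. poly_eval x P / poly_eval x Q) f"
    by (auto simp: rational_taylor_polys_def poly_eval_at_0)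
  \<comment> \<open>The analytic hypothesis is exploited through uniqueness alone: the algebraically
    built \<open>T\<close> is also a Taylor polynomial of P/Q and hence equals
    \<open>f\<close>.\<close>
  obtain T where T: "T \<in> polys_le (d + 1)" "ord_ge (Suc (d + 1)) (Q * T - P)"
    using taylor_quotient_exists[OF PQ(4)] by blast
  have "f = T" using t is_taylor_polyI[OF T(1) PQ(4) T(2)] by (rule is_taylor_poly_unique)
  have *: "Poly_Mapping.lookup (Q * f) a = Poly_Mapping.lookup P a" if "mono_degree a \<le> d + 1" for a
    using T(2) that by (simp add: ord_ge_def lookup_minus \<open>f = T\<close>)
  have "Poly_Mapping.lookup f 0 = 1" using *[of 0] PQ by (simp add: lookup_mult_0)
  moreover have "subpoly (\<lambda>a. mono_degree a = d + 1) (Q * f) = 0"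
    using PQ(1) * by (intro poly_mapping_eqI) (simp add: lookup_subpoly polys_le_lookup)
  ultimately show ?R using T(1) \<open>f = T\<close> PQ by blast
next
  assume ?R
  then obtain Q where f: "f \<in> polys_le (d + 1)" "Poly_Mapping.lookup f 0 = 1" and
    Q: "Q \<in> polys_le e" "Poly_Mapping.lookup Q 0 = 1" "subpoly (\<lambda>a. mono_degree a = d + 1) (Q * f) = 0"
    by blast
  define P where "P = subpoly (\<lambda>a. mono_degree a \<le> d) (Q * f)"
  have "P \<in> polys_le d" by (simp add: P_def polys_le_lookup lookup_subpoly)
  moreover have "Poly_Mapping.lookup P 0 = 1" using f Q by (simp add: P_def lookup_subpoly lookup_mult_0)
  moreover have "ord_ge (Suc (d + 1)) (Q * f - P)"
    unfolding ord_ge_def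
  proof (intro allI impI)
    fix a :: "'a monomial" assume "mono_degree a < Suc (d + 1)"
    then consider "mono_degree a \<le> d" | "mono_degree a = d + 1" by linarith
    then show "Poly_Mapping.lookup (Q * f - P) a = 0"
    proof cases
      case 2
      then show ?thesis
        using arg_cong[OF Q(3), of "\<lambda>p. Poly_Mapping.lookup p a"]
        by (simp add: P_def lookup_minus lookup_subpoly)
    qed (simp add: P_def lookup_minus lookup_subpoly)
  qed
  then have "is_taylor_poly (d + 1) (\<lambda>x. poly_eval x P / poly_eval x Q) f"
    by (rule is_taylor_polyI[OF f(1) Q(2)])
  ultimately show ?L using Q unfolding rational_taylor_polys_def mem_Collect_eq poly_eval_at_0 by blast
qed

section \<open>Finite-dimensional linear algebra\<close>

lemma finite_basis_exists:
  assumes "V \<subseteq> cv.span F" "finite F"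
  obtains B where "B \<subseteq> V" "finite B" "cv.independent B" "V \<subseteq> cv.span B" "card B = cv.dim V"
proof -
  obtain B where B: "B \<subseteq> V" "cv.independent B" "V \<subseteq> cv.span B" "card B = cv.dim V"
    using cv.basis_exists[of V] by blast
  have "B \<subseteq> cv.span F" using B(1) assms(1) by (rule subset_trans)
  then have "finite B" using cv.independent_span_bound[OF assms(2) B(2)] by blast
  with B show ?thesis using that by blast
qed

definition lin_indep :: "'a set \<Rightarrow> ('a \<Rightarrow> 'v cpoly) \<Rightarrow> bool" where
  "lin_indep S w \<longleftrightarrow> (\<forall>u. (\<Sum>j\<in>S. cscale (u j) (w j)) = 0 \<longrightarrow> (\<forall>j\<in>S. u j = 0))"

lemma lin_indepD: "lin_indep S w \<Longrightarrow> (\<Sum>j\<in>S. cscale (u j) (w j)) = 0 \<Longrightarrow> j \<in> S \<Longrightarrow> u j = 0"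
  by (simp add: lin_indep_def)

lemma lin_indep_of_independent:
  assumes "finite S" "inj_on w S" "cv.independent (w ` S)"
  shows "lin_indep S w"
  unfolding lin_indep_def
proof (intro allI impI ballI)
  fix u j assume u: "(\<Sum>j\<in>S. cscale (u j) (w j)) = 0" and j: "j \<in> S"
  define v where "v = (\<lambda>x. u (the_inv_into S w x))"
  have "(\<Sum>x\<in>w ` S. cscale (v x) x) = (\<Sum>j\<in>S. cscale (u j) (w j))"
    by (simp add: sum.reindex[OF assms(2)] v_def the_inv_into_f_f[OF assms(2)])
  then have "v (w j) = 0"
    using cv.independentD[OF assms(3), of "w ` S" v "w j"] assms(1) u j by simp
  then show "u j = 0" using j by (simp add: v_def the_inv_into_f_f[OF assms(2)])
qed

lemma lin_indep_card_le:
  assumes "finite S" "lin_indep S w" "w ` S \<subseteq> V" "V \<subseteq> cv.span F" "finite F"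
  shows "card S \<le> cv.dim V"
proof (rule ccontr)
  assume n: "\<not> ?thesis"
  obtain B where B: "B \<subseteq> V" "finite B" "cv.independent B" "V \<subseteq> cv.span B" "card B = cv.dim V"
    using finite_basis_exists[OF assms(4,5)] .
  have "w a \<in> cv.span B" if "a \<in> S" for a using that assms(3) B(4) by blast
  then obtain c where "\<exists>a\<in>S. c a \<noteq> 0" "(\<Sum>a\<in>S. cscale (c a) (w a)) = 0"
    using family_dependent[OF assms(1) B(2), of w] n B(5) by auto
  then show False using assms(2) by (auto simp: lin_indep_def)
qed

text \<open>Appending \<open>v\<close> gives \<open>n + 1\<close> vectors in dimension at most
  \<open>n\<close>. In the resulting relation \<open>v\<close> has a nonzero coefficient, since the
  others are independent.\<close>

lemma lin_indep_expansion:
  fixes w :: "nat \<Rightarrow> 'v cpoly"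
  assumes "lin_indep {..<n} w" "w ` {..<n} \<subseteq> V" "V \<subseteq> cv.span F" "finite F" "cv.dim V \<le> n" "v \<in> V"
  shows "\<exists>u. v = (\<Sum>j<n. cscale (u j) (w j))"
proof -
  obtain B where B: "B \<subseteq> V" "finite B" "cv.independent B" "V \<subseteq> cv.span B" "card B = cv.dim V"
    using finite_basis_exists[OF assms(3,4)] .
  define w' where "w' = w(n := v)"
  have "w' a \<in> cv.span B" if "a \<in> {..<Suc n}" for a
  proof -
    have "w' a \<in> V" using that assms(2,6) by (cases "a = n") (auto simp: w'_def)
    then show ?thesis using B(4) by blast
  qed
  then obtain c where c: "\<exists>a\<in>{..<Suc n}. c a \<noteq> 0" "(\<Sum>a<Suc n. cscale (c a) (w' a)) = 0"
    using family_dependent[OF finite_lessThan B(2), of "Suc n" w'] B(5) assms(5) by auto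
  have s: "(\<Sum>j<n. cscale (c j) (w j)) + cscale (c n) v = 0"
    using c(2) by (simp add: w'_def)
  have "c n \<noteq> 0"
  proof
    assume 0: "c n = 0"
    then have "(\<Sum>j<n. cscale (c j) (w j)) = 0" using s by simp
    then have "\<forall>j<n. c j = 0" using lin_indepD[OF assms(1), of c] by auto
    then show False using c(1) 0 by (auto simp: less_Suc_eq)
  qed
  have "v = cscale (inverse (c n)) (cscale (c n) v)" using \<open>c n \<noteq> 0\<close> by simp
  also have "cscale (c n) v = - (\<Sum>j<n. cscale (c j) (w j))"
    using s by (simp add: add_eq_0_iff)
  also have "cscale (inverse (c n)) \<dots> = (\<Sum>j<n. cscale (- inverse (c n) * c j) (w j))"
    by (simp add: cv.scale_sum_right sum_negf cv.scale_minus_left cv.scale_minus_right)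
  finally show ?thesis by (intro exI[of _ "\<lambda>j. - inverse (c n) * c j"])
qed

lemma lin_indep_subset: "lin_indep S w \<Longrightarrow> finite S \<Longrightarrow> T \<subseteq> S \<Longrightarrow> lin_indep T w"
  unfolding lin_indep_def
proof (intro allI impI ballI)
  fix u j assume *: "\<forall>u. (\<Sum>j\<in>S. cscale (u j) (w j)) = 0 \<longrightarrow> (\<forall>j\<in>S. u j = 0)"
    and "finite S" "T \<subseteq> S" "(\<Sum>j\<in>T. cscale (u j) (w j)) = 0" "j \<in> T"
  then have "(\<Sum>j\<in>S. cscale (if j \<in> T then u j else 0) (w j)) = 0"
    by (subst sum.mono_neutral_right[of S T]) auto
  with *[rule_format, of "\<lambda>j. if j \<in> T then u j else 0"]
  have "(if j \<in> T then u j else 0) = 0" using subsetD[OF \<open>T \<subseteq> S\<close> \<open>j \<in> T\<close>] by blast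
  then show "u j = 0" using \<open>j \<in> T\<close> by simp
qed

text \<open>Adding a basis of \<open>W\<close> to \<open>B\<close> yields a basis of
  \<open>V\<close>: uniqueness of the coefficients gives independence modulo \<open>W\<close>, their
  existence gives spanning.\<close>

lemma quotient_basis_card:
  assumes V: "cv.subspace V" "V \<subseteq> cv.span F" "finite F" and W: "cv.subspace W" "W \<subseteq> V"
    and B: "quotient_basis V W B"
  shows "card B = cv.dim V - cv.dim W"
proof -
  obtain C where C: "C \<subseteq> W" "finite C" "cv.independent C" "W \<subseteq> cv.span C" "card C = cv.dim W"
    using finite_basis_exists[OF order_trans[OF W(2) V(2)] V(3)] .
  have BV: "finite B" "B \<subseteq> V" using B by (auto simp: quotient_basis_def)
  have ex: "\<exists>!c. c \<in> B \<rightarrow>\<^sub>E UNIV \<and> v - (\<Sum>b\<in>B. cscale (c b) b) \<in> W" if "v \<in> V" for v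
    using B that by (simp add: quotient_basis_def)
  have un: "c1 = c2" if "v \<in> V" "c1 \<in> B \<rightarrow>\<^sub>E UNIV" "v - (\<Sum>b\<in>B. cscale (c1 b) b) \<in> W"
    "c2 \<in> B \<rightarrow>\<^sub>E UNIV" "v - (\<Sum>b\<in>B. cscale (c2 b) b) \<in> W" for v c1 c2
    by (rule trans[OF the1_equality[OF ex[OF that(1)], OF conjI[OF that(2,3)], symmetric]
          the1_equality[OF ex[OF that(1)], OF conjI[OF that(4,5)]]])
  have uniq: "\<forall>b\<in>B. c b = 0" if c: "(\<Sum>b\<in>B. cscale (c b) b) \<in> W" for c
  proof -
    \<comment> \<open>Uniqueness is applied to the zero vector, which also has zero coefficients;
      restriction makes both coefficient functions extensional on \<open>B\<close>.\<close>
    have r: "restrict c B = restrict (\<lambda>_. 0) B"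
    proof (rule un)
      show "0 \<in> V" using V(1) by (rule cv.subspace_0)
      show "0 - (\<Sum>b\<in>B. cscale (restrict c B b) b) \<in> W"
        using cv.subspace_neg[OF W(1) c] by simp
      show "0 - (\<Sum>b\<in>B. cscale (restrict (\<lambda>_. 0) B b) b) \<in> W"
        using cv.subspace_0[OF W(1)] by simp
    qed auto
    show ?thesis
    proof
      fix b assume "b \<in> B"
      then show "c b = 0" using fun_cong[OF r, of b] by simp
    qed
  qed
  have disj: "B \<inter> C = {}"
  proof (rule ccontr)
    assume "B \<inter> C \<noteq> {}"
    then obtain b where b: "b \<in> B" "b \<in> C" by blast
    have "(\<Sum>x\<in>B. cscale (if x = b then 1 else 0) x) = (\<Sum>x\<in>B. if x = b then b else 0)"
      by (rule sum.cong) auto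
    also have "\<dots> = b" using BV b by simp
    finally have "(\<Sum>x\<in>B. cscale (if x = b then 1 else 0) x) \<in> W" using b C(1) by auto
    from uniq[OF this] b show False by auto
  qed
  have spanC: "cv.span C = W"
    using C(1,4) W(1) cv.span_minimal by (metis subset_antisym)
  have sumC: "(\<Sum>x\<in>C. cscale (u x) x) \<in> W" for u
    unfolding spanC[symmetric] by (intro cv.span_sum cv.span_scale cv.span_base)
  have ind: "cv.independent (B \<union> C)"
  proof (rule cv.independent_if_scalars_zero)
    fix u x assume u: "(\<Sum>x\<in>B \<union> C. cscale (u x) x) = 0" and x: "x \<in> B \<union> C"
    have s: "(\<Sum>x\<in>B. cscale (u x) x) + (\<Sum>x\<in>C. cscale (u x) x) = 0"
      using u sum.union_disjoint[OF BV(1) C(2) disj, of "\<lambda>x. cscale (u x) x"] by simp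
    then have "(\<Sum>x\<in>B. cscale (u x) x) = - (\<Sum>x\<in>C. cscale (u x) x)" by (simp add: add_eq_0_iff2)
    then have "(\<Sum>x\<in>B. cscale (u x) x) \<in> W" using cv.subspace_neg[OF W(1) sumC] by simp
    note uB = uniq[OF this]
    then have "(\<Sum>x\<in>C. cscale (u x) x) = 0" using s by simp
    then have "\<forall>x\<in>C. u x = 0" using cv.independentD[OF C(3) C(2) subset_refl] by blast
    with uB x show "u x = 0" by blast
  qed (use BV C in simp)
  have "V \<subseteq> cv.span (B \<union> C)"
  proof
    fix v assume v: "v \<in> V"
    from ex1_implies_ex[OF ex[OF v]] obtain c where "v - (\<Sum>b\<in>B. cscale (c b) b) \<in> W" by blast
    then have "v - (\<Sum>b\<in>B. cscale (c b) b) \<in> cv.span (B \<union> C)"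
      using spanC cv.span_mono[of C "B \<union> C"] by auto
    moreover have "(\<Sum>b\<in>B. cscale (c b) b) \<in> cv.span (B \<union> C)"
      by (intro cv.span_sum cv.span_scale cv.span_base) simp
    ultimately have "v - (\<Sum>b\<in>B. cscale (c b) b) + (\<Sum>b\<in>B. cscale (c b) b) \<in> cv.span (B \<union> C)"
      by (rule cv.span_add)
    then show "v \<in> cv.span (B \<union> C)" by simp
  qed
  then have "card (B \<union> C) = cv.dim V"
    using ind BV C(1) W(2) by (intro cv.basis_card_eq_dim) auto
  then show ?thesis using card_Un_disjoint[OF BV(1) C(2) disj] C(5) by simp
qed

text \<open>The vectors added when a basis of \<open>W\<close> is extended to one of
  \<open>V\<close> represent a basis of the quotient. This guarantees that the choice in
  \<open>quotient_dim\<close> picks an actual basis.\<close>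

lemma quotient_basis_exists:
  assumes V: "cv.subspace V" "V \<subseteq> cv.span F" "finite F" and W: "cv.subspace W" "W \<subseteq> V"
  shows "\<exists>B. quotient_basis V W B"
proof -
  obtain C where C: "C \<subseteq> W" "finite C" "cv.independent C" "W \<subseteq> cv.span C" "card C = cv.dim W"
    using finite_basis_exists[OF order_trans[OF W(2) V(2)] V(3)] .
  obtain E where E: "C \<subseteq> E" "E \<subseteq> V" "cv.independent E" "V \<subseteq> cv.span E"
    using cv.maximal_independent_subset_extend[OF order_trans[OF C(1) W(2)] C(3)] .
  have fE: "finite E"
    using cv.independent_span_bound[OF V(3) E(3)] E(2) V(2) by (meson subset_trans)
  define B where "B = E - C"
  have fB: "finite B" using fE by (simp add: B_def)
  have sp: "(\<Sum>x\<in>E. g x) = (\<Sum>x\<in>B. g x) + (\<Sum>x\<in>C. g x)" for g :: "'a cpoly \<Rightarrow> 'a cpoly"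
    unfolding B_def using sum.subset_diff[OF E(1) fE] by auto
  have spanC: "cv.span C = W"
    using C(1,4) W(1) cv.span_minimal by (metis subset_antisym)
  have uniq: "\<forall>b\<in>B. c b = 0" if c: "(\<Sum>b\<in>B. cscale (c b) b) \<in> W" for c
  proof -
    obtain u where u: "(\<Sum>b\<in>B. cscale (c b) b) = (\<Sum>x\<in>C. cscale (u x) x)"
      using c spanC cv.span_finite[OF C(2)] by auto
    define z where "z = (\<lambda>x. if x \<in> C then - u x else c x)"
    have "(\<Sum>x\<in>B. cscale (z x) x) = (\<Sum>b\<in>B. cscale (c b) b)"
      by (rule sum.cong) (auto simp: z_def B_def)
    moreover have "(\<Sum>x\<in>C. cscale (z x) x) = - (\<Sum>x\<in>C. cscale (u x) x)"
      unfolding sum_negf[symmetric] by (rule sum.cong) (auto simp: z_def cv.scale_minus_left)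
    ultimately have "(\<Sum>x\<in>E. cscale (z x) x) = 0" unfolding sp using u by simp
    then have "\<forall>x\<in>E. z x = 0" using cv.independentD[OF E(3) fE subset_refl] by blast
    then show ?thesis by (auto simp: B_def z_def)
  qed
  have "\<exists>!c. c \<in> B \<rightarrow>\<^sub>E UNIV \<and> v - (\<Sum>b\<in>B. cscale (c b) b) \<in> W" if v: "v \<in> V" for v
  proof -
    have "v \<in> cv.span E" using E(4) v by blast
    then obtain u where u: "v = (\<Sum>x\<in>E. cscale (u x) x)" using cv.span_finite[OF fE] by auto
    show ?thesis
    proof (rule ex1I[of _ "restrict u B"])
      have "v - (\<Sum>b\<in>B. cscale (restrict u B b) b) = (\<Sum>x\<in>C. cscale (u x) x)"
        unfolding u sp by simp
      also have "\<dots> \<in> W" unfolding spanC[symmetric] by (intro cv.span_sum cv.span_scale cv.span_base)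
      finally show "restrict u B \<in> B \<rightarrow>\<^sub>E UNIV \<and> v - (\<Sum>b\<in>B. cscale (restrict u B b) b) \<in> W" by simp
      then have r: "v - (\<Sum>b\<in>B. cscale (restrict u B b) b) \<in> W" by blast
      fix c assume c: "c \<in> B \<rightarrow>\<^sub>E UNIV \<and> v - (\<Sum>b\<in>B. cscale (c b) b) \<in> W"
      have "(v - (\<Sum>b\<in>B. cscale (restrict u B b) b)) - (v - (\<Sum>b\<in>B. cscale (c b) b)) \<in> W"
        using cv.subspace_diff[OF W(1) r] c by blast
      also have "(v - (\<Sum>b\<in>B. cscale (restrict u B b) b)) - (v - (\<Sum>b\<in>B. cscale (c b) b)) =
          (\<Sum>b\<in>B. cscale (c b - restrict u B b) b)"
        by (simp add: cv.scale_left_diff_distrib sum_subtractf)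
      finally have "\<forall>b\<in>B. c b - restrict u B b = 0" by (rule uniq)
      then show "c = restrict u B" using c by (intro extensionalityI[of _ B]) (auto simp: PiE_def)
    qed
  qed
  then have "quotient_basis V W B" using fB E(2) by (auto simp: quotient_basis_def B_def)
  then show ?thesis by blast
qed

lemma quotient_dim_eq:
  assumes "cv.subspace V" "V \<subseteq> cv.span F" "finite F" "cv.subspace W" "W \<subseteq> V"
  shows "quotient_dim V W = cv.dim V - cv.dim W"
  unfolding quotient_dim_def
  using quotient_basis_card[OF assms someI_ex[OF quotient_basis_exists[OF assms]]] .

section \<open>Dimension of the spaces of forms\<close>

lemma subspace_forms: "cv.subspace (forms k)"
  by (rule cv.subspaceI) (auto simp: forms_lookup lookup_add cscale_lookup)

lemma forms_span_monomials:
  "forms k \<subseteq> cv.span ((\<lambda>a. Poly_Mapping.single a 1) ` {a :: 'n::finite monomial. mono_degree a = k})"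
proof
  fix p :: "'n cpoly" assume "p \<in> forms k"
  then have "p = (\<Sum>a\<in>{a. mono_degree a = k}. Poly_Mapping.single a (Poly_Mapping.lookup p a))"
    by (intro single_expansion finite_monomials_eq) (auto simp: forms_def)
  also have "\<dots> = (\<Sum>a\<in>{a. mono_degree a = k}. cscale (Poly_Mapping.lookup p a) (Poly_Mapping.single a 1))"
    by (simp add: cscale_single)
  also have "\<dots> \<in> cv.span ((\<lambda>a. Poly_Mapping.single a 1) ` {a. mono_degree a = k})"
    by (intro cv.span_sum cv.span_scale cv.span_base) auto
  finally show "p \<in> cv.span ((\<lambda>a. Poly_Mapping.single a 1) ` {a. mono_degree a = k})" .
qed

lemma dim_forms: "cv.dim (forms k :: 'n::finite cpoly set) = card {a :: 'n monomial. mono_degree a = k}"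
proof -
  let ?A = "{a :: 'n monomial. mono_degree a = k}"
  let ?s = "\<lambda>a :: 'n monomial. Poly_Mapping.single a (1::complex)"
  have inj: "inj_on ?s ?A"
    by (rule inj_onI) (metis keys_single one_neq_zero singleton_inject)
  have "cv.independent (?s ` ?A)"
  proof (rule cv.independent_if_scalars_zero)
    fix u x assume u: "(\<Sum>x\<in>?s ` ?A. cscale (u x) x) = 0" and "x \<in> ?s ` ?A"
    then obtain a where a: "a \<in> ?A" "x = ?s a" by auto
    have "0 = Poly_Mapping.lookup (\<Sum>b\<in>?A. cscale (u (?s b)) (?s b)) a"
      using u by (simp add: sum.reindex[OF inj])
    also have "\<dots> = u x" using a
      by (simp add: finite_monomials_eq lookup_sum cscale_lookup lookup_single when_def if_distrib sum.delta' cong: if_cong)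
    finally show "u x = 0" by simp
  qed (simp add: finite_monomials_eq)
  then have "card (?s ` ?A) = cv.dim (forms k :: 'n cpoly set)"
    by (intro cv.basis_card_eq_dim forms_span_monomials) (auto simp: forms_def)
  then show ?thesis by (simp add: card_image[OF inj])
qed

section \<open>Determinants as homogeneous polynomials\<close>

definition cdet :: "nat \<Rightarrow> (nat \<Rightarrow> 'v monomial) \<Rightarrow> (nat \<Rightarrow> 'v cpoly) \<Rightarrow> complex" where
  "cdet N en w = det (mat N N (\<lambda>(i, j). Poly_Mapping.lookup (w j) (en i)))"

text \<open>The rows list all monomials of degree \<open>k\<close>, so no coefficient of a form is
  lost, and kernel vectors of the matrix are exactly linear relations among the
  \<open>w j\<close>.\<close>

lemma cdet_nonzero_iff:
  fixes w :: "nat \<Rightarrow> 'v cpoly"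
  assumes en: "bij_betw en {..<N} {a. mono_degree a = k}" and w: "\<And>j. j < N \<Longrightarrow> w j \<in> forms k"
  shows "cdet N en w \<noteq> 0 \<longleftrightarrow> lin_indep {..<N} w"
proof -
  let ?M = "mat N N (\<lambda>(i, j). Poly_Mapping.lookup (w j) (en i))"
  have M: "?M \<in> carrier_mat N N" by simp
  have all: "(\<forall>a. mono_degree a = k \<longrightarrow> P a) \<longleftrightarrow> (\<forall>i<N. P (en i))" for P
  proof -
    have "(\<forall>a\<in>{a. mono_degree a = k}. P a) \<longleftrightarrow> (\<forall>a\<in>en ` {..<N}. P a)"
      using en by (simp add: bij_betw_def)
    moreover have "(\<forall>a\<in>en ` {..<N}. P a) \<longleftrightarrow> (\<forall>i<N. P (en i))" by auto
    ultimately show ?thesis by simp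
  qed
  have eq: "?M *\<^sub>v v = 0\<^sub>v N \<longleftrightarrow> (\<Sum>j<N. cscale (vec_index v j) (w j)) = 0" if v: "v \<in> carrier_vec N" for v
  proof -
    have "?M *\<^sub>v v = 0\<^sub>v N \<longleftrightarrow> (\<forall>i<N. (\<Sum>j<N. vec_index v j * Poly_Mapping.lookup (w j) (en i)) = 0)"
      using v by (auto simp: vec_eq_iff scalar_prod_def mult.commute atLeast0LessThan)
    also have "\<dots> \<longleftrightarrow> (\<forall>i<N. Poly_Mapping.lookup (\<Sum>j<N. cscale (vec_index v j) (w j)) (en i) = 0)"
      by (simp add: lookup_sum cscale_lookup)
    also have "\<dots> \<longleftrightarrow> (\<forall>a. mono_degree a = k \<longrightarrow> Poly_Mapping.lookup (\<Sum>j<N. cscale (vec_index v j) (w j)) a = 0)"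
      by (rule all[symmetric])
    also have "\<dots> \<longleftrightarrow> (\<Sum>j<N. cscale (vec_index v j) (w j)) = 0"
    proof
      assume *: "\<forall>a. mono_degree a = k \<longrightarrow> Poly_Mapping.lookup (\<Sum>j<N. cscale (vec_index v j) (w j)) a = 0"
      have "(\<Sum>j<N. cscale (vec_index v j) (w j)) \<in> forms k"
        using w by (intro cv.subspace_sum[OF subspace_forms] cv.subspace_scale[OF subspace_forms]) auto
      with * show "(\<Sum>j<N. cscale (vec_index v j) (w j)) = 0"
        by (intro poly_mapping_eqI) (auto simp: forms_lookup)
    qed simp
    finally show ?thesis .
  qed
  have "cdet N en w = 0 \<longleftrightarrow> (\<exists>v. v \<in> carrier_vec N \<and> v \<noteq> 0\<^sub>v N \<and> (\<Sum>j<N. cscale (vec_index v j) (w j)) = 0)"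
    unfolding cdet_def det_0_iff_vec_prod_zero[OF M] using eq by blast
  also have "\<dots> \<longleftrightarrow> \<not> lin_indep {..<N} w"
  proof
    assume "\<exists>v. v \<in> carrier_vec N \<and> v \<noteq> 0\<^sub>v N \<and> (\<Sum>j<N. cscale (vec_index v j) (w j)) = 0"
    then obtain v where v: "v \<in> carrier_vec N" "v \<noteq> 0\<^sub>v N" "(\<Sum>j<N. cscale (vec_index v j) (w j)) = 0" by blast
    then obtain j where "j < N" "vec_index v j \<noteq> 0" by (auto simp: vec_eq_iff)
    then show "\<not> lin_indep {..<N} w" using lin_indepD[of "{..<N}" w "\<lambda>j. vec_index v j" j] v(3) by auto
  next
    assume "\<not> lin_indep {..<N} w"
    then obtain u j where u: "(\<Sum>j<N. cscale (u j) (w j)) = 0" "j < N" "u j \<noteq> 0"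
      by (auto simp: lin_indep_def)
    have "(\<Sum>j<N. cscale (vec_index (vec N u) j) (w j)) = (\<Sum>j<N. cscale (u j) (w j))"
      by (rule sum.cong) auto
    moreover have "vec N u \<noteq> 0\<^sub>v N" using u by (auto simp: vec_eq_iff)
    ultimately show "\<exists>v. v \<in> carrier_vec N \<and> v \<noteq> 0\<^sub>v N \<and> (\<Sum>j<N. cscale (vec_index v j) (w j)) = 0"
      using u by (intro exI[of _ "vec N u"]) auto
  qed
  finally show ?thesis by blast
qed

lemma forms_sum: "(\<And>a. a \<in> A \<Longrightarrow> f a \<in> forms k) \<Longrightarrow> sum f A \<in> forms k"
  by (rule cv.subspace_sum[OF subspace_forms])

lemma forms_prod: "(\<And>a. a \<in> A \<Longrightarrow> f a \<in> forms (g a)) \<Longrightarrow> prod f A \<in> forms (sum g A)"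
  by (induction A rule: infinite_finite_induct) (auto simp: forms_one intro: forms_mult)

text \<open>Each product in the Leibniz expansion uses every column once, so homogeneous columns of
  possibly different degrees still give a homogeneous determinant. Homogeneity is what makes its
  zero locus closed in projective space.\<close>

lemma det_polynomial:
  fixes M :: "nat \<Rightarrow> nat \<Rightarrow> 'v cpoly"
  assumes M: "\<And>i j. i < N \<Longrightarrow> j < N \<Longrightarrow> M i j \<in> forms (m j)"
  obtains F where "F \<in> forms (\<Sum>j<N. m j)"
    "\<And>x. poly_eval x F = det (mat N N (\<lambda>(i, j). poly_eval x (M i j)))"
proof -
  define F where "F = (\<Sum>p\<in>{p. p permutes {0..<N}}. cscale (signof p) (\<Prod>i=0..<N. M i (p i)))"
  have "F \<in> forms (\<Sum>j<N. m j)"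
    unfolding F_def
  proof (intro forms_sum cv.subspace_scale[OF subspace_forms])
    fix p assume "p \<in> {p. p permutes {0..<N}}"
    then have p: "p permutes {0..<N}" by simp
    have "(\<Prod>i=0..<N. M i (p i)) \<in> forms (\<Sum>i=0..<N. m (p i))"
      using permutes_in_image[OF p] by (intro forms_prod M) auto
    also have "(\<Sum>i=0..<N. m (p i)) = (\<Sum>j<N. m j)"
      using sum.permute[OF p, of m] by (simp add: o_def atLeast0LessThan)
    finally show "(\<Prod>i=0..<N. M i (p i)) \<in> forms (\<Sum>j<N. m j)" .
  qed
  moreover have "poly_eval x F = det (mat N N (\<lambda>(i, j). poly_eval x (M i j)))" for x
  proof -
    have "det (mat N N (\<lambda>(i, j). poly_eval x (M i j))) =
        (\<Sum>p\<in>{p. p permutes {0..<N}}. signof p * (\<Prod>i=0..<N. poly_eval x (M i (p i))))"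
      by (subst det_def'[of _ N])
         (auto intro!: sum.cong prod.cong arg_cong2[of _ _ _ _ "(*)"] simp: permutes_in_image)
    then show ?thesis by (simp add: F_def poly_eval_sum poly_eval_cscale poly_eval_prod)
  qed
  ultimately show ?thesis by (rule that)
qed

section \<open>The multiplication map and the ideal in degree \<open>d + 1\<close>\<close>

text \<open>The columns of the linear map sending \<open>q\<close> to the degree \<open>k\<close>
  part of \<open>q * f\<close>, in the monomial basis for \<open>q\<close>.\<close>

definition mult_col :: "nat \<Rightarrow> 'v cpoly \<Rightarrow> 'v monomial \<Rightarrow> 'v cpoly" where
  "mult_col k f b = subpoly (\<lambda>a. mono_degree a = k) (Poly_Mapping.single b 1 * f)"

text \<open>The monomials that can occur in \<open>1 - Q\<close> for a denominator \<open>Q\<close>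
  of degree at most \<open>e\<close> with constant term 1.\<close>

definition shifts :: "nat \<Rightarrow> 'v monomial set" where
  "shifts e = {b. 1 \<le> mono_degree b \<and> mono_degree b \<le> e}"

definition mult_image :: "nat \<Rightarrow> nat \<Rightarrow> 'v cpoly \<Rightarrow> 'v cpoly set" where
  "mult_image e k f = cv.span (mult_col k f ` shifts e)"

lemma finite_shifts: "finite (shifts e :: 'n::finite monomial set)"
  by (rule finite_subset[OF _ finite_monomials_le[of e]]) (auto simp: shifts_def)

lemma lookup_mult_col: "Poly_Mapping.lookup (mult_col k f b) a =
  (if mono_degree a = k \<and> a \<in> range ((+) b) then Poly_Mapping.lookup f (a - b) else 0)"
proof (cases "a \<in> range ((+) b)")
  case True
  then obtain c where "a = b + c" by auto
  then show ?thesis by (simp add: mult_col_def lookup_subpoly lookup_single_mult_add)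
next
  case False
  then show ?thesis by (simp add: mult_col_def lookup_subpoly lookup_single_mult_notin)
qed

lemma mono_degree_diff: "a \<in> range ((+) b) \<Longrightarrow> mono_degree (a - b) = mono_degree a - mono_degree b"
  by (auto simp: mono_degree_add)

lemma mult_col_cong:
  assumes "b \<in> shifts e" "\<And>a. k - e \<le> mono_degree a \<Longrightarrow> mono_degree a < k \<Longrightarrow>
    Poly_Mapping.lookup f a = Poly_Mapping.lookup g a"
  shows "mult_col k f b = mult_col k g b"
proof (rule poly_mapping_eqI)
  fix a
  have "Poly_Mapping.lookup f (a - b) = Poly_Mapping.lookup g (a - b)"
    if a: "mono_degree a = k" "a \<in> range ((+) b)"
  proof (rule assms(2))
    have "mono_degree b \<le> k" using a by (auto simp: mono_degree_add)
    then show "k - e \<le> mono_degree (a - b)" "mono_degree (a - b) < k"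
      using assms(1) a by (auto simp: mono_degree_diff shifts_def)
  qed
  then show "Poly_Mapping.lookup (mult_col k f b) a = Poly_Mapping.lookup (mult_col k g b) a"
    by (simp add: lookup_mult_col)
qed

lemma mult_col_forms: "mult_col k f b \<in> forms k"
  by (simp add: mult_col_def subpoly_forms)

lemma mult_col_cscale: "mult_col k (cscale c f) b = cscale c (mult_col k f b)"
  by (rule poly_mapping_eqI) (simp add: lookup_mult_col cscale_lookup)

lemma subpoly_mult_expansion:
  assumes "finite A" "Poly_Mapping.keys q \<subseteq> A"
  shows "subpoly (\<lambda>a. mono_degree a = k) (q * f) = (\<Sum>b\<in>A. cscale (Poly_Mapping.lookup q b) (mult_col k f b))"
proof -
  have "subpoly (\<lambda>a. mono_degree a = k) (q * f) =
     subpoly (\<lambda>a. mono_degree a = k) ((\<Sum>b\<in>A. Poly_Mapping.single b (Poly_Mapping.lookup q b)) * f)"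
    using single_expansion[OF assms] by simp
  also have "(\<Sum>b\<in>A. Poly_Mapping.single b (Poly_Mapping.lookup q b)) =
      (\<Sum>b\<in>A. cscale (Poly_Mapping.lookup q b) (Poly_Mapping.single b 1))"
    by (simp add: cscale_single)
  finally show ?thesis
    by (simp add: sum_distrib_right subpoly_sum cscale_mult_left subpoly_cscale mult_col_def)
qed

lemma mult_image_iff:
  "v \<in> mult_image e k f \<longleftrightarrow>
     (\<exists>q. Poly_Mapping.keys q \<subseteq> shifts e \<and> v = subpoly (\<lambda>a. mono_degree a = k) (q * f))"
proof
  let ?X = "{v. \<exists>q. Poly_Mapping.keys q \<subseteq> shifts e \<and> v = subpoly (\<lambda>a. mono_degree a = k) (q * f)}"
  have "cv.subspace ?X"
  proof (rule cv.subspaceI)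
    have "subpoly (\<lambda>a. mono_degree a = k) (0 * f) = 0"
      by (rule poly_mapping_eqI) (simp add: lookup_subpoly)
    then show "0 \<in> ?X" by (intro CollectI exI[of _ 0]) simp
  next
    fix x y assume "x \<in> ?X" "y \<in> ?X"
    then obtain p q where "Poly_Mapping.keys p \<subseteq> shifts e" "x = subpoly (\<lambda>a. mono_degree a = k) (p * f)"
      "Poly_Mapping.keys q \<subseteq> shifts e" "y = subpoly (\<lambda>a. mono_degree a = k) (q * f)" by blast
    then show "x + y \<in> ?X"
      using keys_add[of p q]
      by (intro CollectI exI[of _ "p + q"]) (auto simp: distrib_right subpoly_add)
  next
    fix c x assume "x \<in> ?X"
    then obtain p where "Poly_Mapping.keys p \<subseteq> shifts e" "x = subpoly (\<lambda>a. mono_degree a = k) (p * f)"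
      by blast
    then show "cscale c x \<in> ?X"
      by (intro CollectI exI[of _ "cscale c p"])
         (auto simp: cscale_mult_left subpoly_cscale in_keys_iff cscale_lookup)
  qed
  moreover have "mult_col k f ` shifts e \<subseteq> ?X"
  proof clarify
    fix b :: "'a monomial" assume "b \<in> shifts e"
    then show "\<exists>q. Poly_Mapping.keys q \<subseteq> shifts e \<and> mult_col k f b = subpoly (\<lambda>a. mono_degree a = k) (q * f)"
      by (intro exI[of _ "Poly_Mapping.single b 1"]) (simp add: mult_col_def)
  qed
  ultimately have "mult_image e k f \<subseteq> ?X" unfolding mult_image_def by (intro cv.span_minimal)
  then show "v \<in> mult_image e k f \<Longrightarrow>
     \<exists>q. Poly_Mapping.keys q \<subseteq> shifts e \<and> v = subpoly (\<lambda>a. mono_degree a = k) (q * f)" by auto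
next
  assume "\<exists>q. Poly_Mapping.keys q \<subseteq> shifts e \<and> v = subpoly (\<lambda>a. mono_degree a = k) (q * f)"
  then obtain q where q: "Poly_Mapping.keys q \<subseteq> shifts e" "v = subpoly (\<lambda>a. mono_degree a = k) (q * f)"
    by blast
  have "v = (\<Sum>b\<in>Poly_Mapping.keys q. cscale (Poly_Mapping.lookup q b) (mult_col k f b))"
    unfolding q(2) by (rule subpoly_mult_expansion) auto
  also have "\<dots> \<in> mult_image e k f"
    unfolding mult_image_def using q(1) by (intro cv.span_sum cv.span_scale cv.span_base) auto
  finally show "v \<in> mult_image e k f" .
qed

lemma mult_image_subset_forms: "mult_image e k f \<subseteq> forms k"
  unfolding mult_image_def by (rule cv.span_minimal[OF _ subspace_forms]) (auto intro: mult_col_forms)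

lemma subspace_mult_image: "cv.subspace (mult_image e k f)"
  unfolding mult_image_def by (rule cv.subspace_span)

lemma subpoly_single_mult_form:
  assumes "p \<in> forms i"
  shows "subpoly (\<lambda>a. mono_degree a = k) (Poly_Mapping.single b c * p) =
     (if mono_degree b + i = k then Poly_Mapping.single b c * p else 0)"
proof -
  have "Poly_Mapping.single b c \<in> forms (mono_degree b)" by (auto simp: forms_lookup lookup_single when_def)
  then have "Poly_Mapping.single b c * p \<in> forms (mono_degree b + i)" using assms by (rule forms_mult)
  then show ?thesis
    by (intro poly_mapping_eqI) (auto simp: lookup_subpoly forms_lookup)
qed

text \<open>Projecting to degree \<open>d + 1\<close> selects from the sum the one entry whose
  degree is complementary to that of \<open>b\<close>; the bounds in \<open>shifts\<close> say
  precisely that this entry belongs to the tuple.\<close>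

lemma mult_col_form_tuple:
  assumes T: "T \<in> form_tuples {d + 1 - e..d}" and b: "b \<in> shifts e" and e: "e \<le> d + 1"
  shows "mult_col (d + 1) (\<Sum>i=d + 1 - e..d. T i) b = Poly_Mapping.single b 1 * T (d + 1 - mono_degree b)"
proof -
  have Ti: "T i \<in> forms i" if "i \<in> {d + 1 - e..d}" for i
    using T that by (auto simp: form_tuples_def dest: spec[of _ i])
  have "mult_col (d + 1) (\<Sum>i=d + 1 - e..d. T i) b =
     (\<Sum>i=d + 1 - e..d. subpoly (\<lambda>a. mono_degree a = d + 1) (Poly_Mapping.single b 1 * T i))"
    by (simp add: mult_col_def sum_distrib_left subpoly_sum)
  also have "\<dots> = (\<Sum>i=d + 1 - e..d. if i = d + 1 - mono_degree b then Poly_Mapping.single b 1 * T i else 0)"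
  proof (rule sum.cong[OF refl])
    fix i assume i: "i \<in> {d + 1 - e..d}"
    have "mono_degree b + i = d + 1 \<longleftrightarrow> i = d + 1 - mono_degree b"
      using i b e by (auto simp: shifts_def)
    then show "subpoly (\<lambda>a. mono_degree a = d + 1) (Poly_Mapping.single b 1 * T i) =
        (if i = d + 1 - mono_degree b then Poly_Mapping.single b 1 * T i else 0)"
      by (simp add: subpoly_single_mult_form[OF Ti[OF i]])
  qed
  also have "\<dots> = Poly_Mapping.single b 1 * T (d + 1 - mono_degree b)"
    using b by (auto simp: sum.delta shifts_def)
  finally show ?thesis .
qed

text \<open>A multiple \<open>q * T i\<close> reaches degree \<open>d + 1\<close> only through the
  part of \<open>q\<close> of degree \<open>d + 1 - i\<close>, which runs through 1 to
  \<open>e\<close>. These are the multipliers in the Taylor condition, so both problems share one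
  image.\<close>

lemma ideal_gen_forms:
  assumes T: "T \<in> form_tuples {d + 1 - e..d}" and e: "e \<le> d + 1"
  shows "ideal_gen (T ` {d + 1 - e..d}) \<inter> forms (d + 1) = mult_image e (d + 1) (\<Sum>i=d + 1 - e..d. T i)"
    (is "?I \<inter> _ = ?M")
proof -
  \<comment> \<open>\<open>id.span\<close> is the span over the polynomial ring, which defines the
    ideal; \<open>cv.span\<close> is the span over the complex numbers.\<close>
  interpret id: Modules.module "(*) :: 'a cpoly \<Rightarrow> 'a cpoly \<Rightarrow> 'a cpoly"
    by unfold_locales (simp_all add: algebra_simps)
  let ?J = "{d + 1 - e..d}"
  have I: "?I = id.span (T ` ?J)" by (simp add: ideal_gen_def)
  have Ti: "T i \<in> forms i" if "i \<in> ?J" for i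
    using T that by (auto simp: form_tuples_def dest: spec[of _ i])
  have "cscale c x \<in> id.span (T ` ?J)" if "x \<in> id.span (T ` ?J)" for c x
    unfolding cscale_def using that by (rule id.span_scale)
  then have sI: "cv.subspace (?I \<inter> forms (d + 1))"
    unfolding I
    by (intro cv.subspaceI)
       (auto intro: id.span_add id.span_zero simp: forms_lookup lookup_add cscale_lookup)
  have "mult_col (d + 1) (\<Sum>i\<in>?J. T i) b \<in> ?I" if b: "b \<in> shifts e" for b
  proof -
    have "d + 1 - mono_degree b \<in> ?J" using b e by (auto simp: shifts_def)
    then show ?thesis unfolding mult_col_form_tuple[OF T b e] I by (intro id.span_scale id.span_base) simp
  qed
  then have ge: "?M \<subseteq> ?I \<inter> forms (d + 1)"
    unfolding mult_image_def using sI mult_col_forms by (intro cv.span_minimal) auto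
  have part: "subpoly (\<lambda>a. mono_degree a = d + 1) (q * T i) \<in> ?M" if i: "i \<in> ?J" for q i
  proof (induction q rule: cpoly_induct)
    case (single b c)
    show ?case
    proof (cases "mono_degree b + i = d + 1")
      case True
      then have b: "b \<in> shifts e" using i e by (auto simp: shifts_def)
      have "i = d + 1 - mono_degree b" using True by simp
      then have "Poly_Mapping.single b c * T i = cscale c (mult_col (d + 1) (\<Sum>i\<in>?J. T i) b)"
        unfolding mult_col_form_tuple[OF T b e] by (simp add: cscale_mult_left[symmetric] cscale_single)
      also have "\<dots> \<in> ?M" unfolding mult_image_def using b by (intro cv.span_scale cv.span_base) simp
      finally show ?thesis using True by (simp add: subpoly_single_mult_form[OF Ti[OF i]])
    next
      case False
      then show ?thesis
        using cv.subspace_0[OF subspace_mult_image] by (simp add: subpoly_single_mult_form[OF Ti[OF i]])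
    qed
  next
    case (add p q)
    then show ?case
      using cv.subspace_add[OF subspace_mult_image] by (simp add: distrib_right subpoly_add)
  qed
  \<comment> \<open>Intermediate elements of the ideal need not be homogeneous, so the induction
    follows their degree \<open>d + 1\<close> components.\<close>
  have top: "subpoly (\<lambda>a. mono_degree a = d + 1) p \<in> ?M" if "p \<in> ?I" for p
    using that unfolding I
  proof (induction rule: id.span_induct_alt)
    case base
    have "subpoly (\<lambda>a. mono_degree a = d + 1) 0 = (0 :: 'a cpoly)"
      by (rule poly_mapping_eqI) (simp add: lookup_subpoly)
    then show ?case using cv.subspace_0[OF subspace_mult_image] by simp
  next
    case (step c x y)
    then obtain i where "i \<in> ?J" "x = T i" by blast
    with part step(2) show ?case
      unfolding subpoly_add by (intro cv.subspace_add[OF subspace_mult_image]) auto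
  qed
  have "?I \<inter> forms (d + 1) \<subseteq> ?M"
  proof
    fix p assume p: "p \<in> ?I \<inter> forms (d + 1)"
    then have "subpoly (\<lambda>a. mono_degree a = d + 1) p = p"
      by (intro subpoly_id) (auto simp: forms_def)
    then show "p \<in> ?M" using top[of p] p by simp
  qed
  then show ?thesis using ge by (rule subset_antisym)
qed

lemma hilbert_function_eq:
  fixes T :: "nat \<Rightarrow> 'n::finite cpoly"
  assumes "T \<in> form_tuples {d + 1 - e..d}" "e \<le> d + 1"
  shows "hilbert_function (ideal_gen (T ` {d + 1 - e..d})) (d + 1) =
    card {a :: 'n monomial. mono_degree a = d + 1} - cv.dim (mult_image e (d + 1) (\<Sum>i=d + 1 - e..d. T i))"
  unfolding hilbert_function_def ideal_gen_forms[OF assms]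
  by (subst quotient_dim_eq[OF subspace_forms forms_span_monomials _ subspace_mult_image mult_image_subset_forms])
     (simp_all add: finite_monomials_eq dim_forms)

section \<open>A generic basis\<close>

text \<open>The members below \<open>r\<close> depend linearly on \<open>f\<close>, the later ones
  are constant, so the determinant of this family is homogeneous in the coefficients of
  \<open>f\<close>.\<close>

definition gfam :: "nat \<Rightarrow> nat \<Rightarrow> (nat \<Rightarrow> 'v monomial) \<Rightarrow> (nat \<Rightarrow> 'v monomial) \<Rightarrow> 'v cpoly \<Rightarrow> nat \<Rightarrow> 'v cpoly" where
  "gfam k r bs gs f j = (if j < r then mult_col k f (bs j) else Poly_Mapping.single (gs (j - r)) 1)"

lemma polyfun_gfam:
  assumes "\<And>a. polyfun (\<lambda>s. Poly_Mapping.lookup (f s) a)"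
  shows "polyfun (\<lambda>s. Poly_Mapping.lookup (gfam k r bs gs (f s) j) a)"
proof (cases "j < r \<and> mono_degree a = k \<and> a \<in> range ((+) (bs j))")
  case True
  then show ?thesis by (simp add: gfam_def lookup_mult_col assms)
next
  case False
  then have "\<exists>c. \<forall>s. Poly_Mapping.lookup (gfam k r bs gs (f s) j) a = c"
    by (cases "j < r") (auto simp: gfam_def lookup_mult_col)
  then show ?thesis using polyfun_const by auto
qed

lemma polyfun_cdet:
  assumes "\<And>i j. polyfun (\<lambda>s. Poly_Mapping.lookup (w s j) (en i))"
  shows "polyfun (\<lambda>s. cdet N en (w s))"
proof -
  have "cdet N en (w s) = (\<Sum>p\<in>{p. p permutes {0..<N}}.
      signof p * (\<Prod>i=0..<N. Poly_Mapping.lookup (w s (p i)) (en i)))" for s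
    unfolding cdet_def
    by (subst det_def'[of _ N])
       (auto intro!: sum.cong prod.cong arg_cong2[of _ _ _ _ "(*)"] simp: permutes_in_image)
  then show ?thesis
    by (simp only:) (intro polyfun_sum polyfun_mult polyfun_const polyfun_prod assms)
qed

text \<open>The monomials \<open>gs\<close> complement the columns \<open>mult_col (d + 1) f1 (bs j)\<close>, which span an image of
  maximal dimension \<open>r\<close>, to a basis of the forms of degree \<open>d + 1\<close>; \<open>en\<close> enumerates the rows of
  the resulting square matrix.\<close>

locale generic_rank =
  fixes d e r N :: nat and bs gs en :: "nat \<Rightarrow> 'n::finite monomial" and f1 :: "'n cpoly"
  assumes e: "e \<le> d + 1"
    and N: "N = card {a :: 'n monomial. mono_degree a = d + 1}"
    and r_le: "r \<le> N"
    and bs: "\<And>j. j < r \<Longrightarrow> bs j \<in> shifts e"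
    and gs: "\<And>j. j < N - r \<Longrightarrow> mono_degree (gs j) = d + 1"
    and en: "bij_betw en {..<N} {a. mono_degree a = d + 1}"
    and rank_le: "\<And>f :: 'n cpoly. cv.dim (mult_image e (d + 1) f) \<le> r"
    and f1_0: "Poly_Mapping.lookup f1 0 = 1"
    and f1: "lin_indep {..<N} (gfam (d + 1) r bs gs f1)"

text \<open>A polynomial \<open>fs\<close> of maximal rank supplies the columns and the
  complementary monomials, but its constant term may be 0. It is corrected by adding a constant that
  keeps the determinant nonzero, followed by a rescaling.\<close>

lemma generic_rank_exists:
  assumes "e \<le> d + 1"
  shows "\<exists>r N (bs :: nat \<Rightarrow> 'n::finite monomial) gs en f1. generic_rank d e r N bs gs en f1"
proof -
  define k where "k = d + 1"
  define A where "A = {a :: 'n monomial. mono_degree a = k}"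
  define N where "N = card A"
  have fA: "finite A" by (simp add: A_def finite_monomials_eq)
  let ?s = "\<lambda>a :: 'n monomial. Poly_Mapping.single a (1::complex)"
  have sA: "forms k \<subseteq> cv.span (?s ` A)" unfolding A_def by (rule forms_span_monomials)
  have le: "cv.dim (mult_image e k f) \<le> N" for f :: "'n cpoly"
    using cv.dim_le_card[OF subset_trans[OF mult_image_subset_forms sA], of e f] card_image_le[OF fA, of ?s] fA
    by (simp add: N_def)
  \<comment> \<open>The generic rank is realised as a maximum, which exists because all ranks are at
    most \<open>N\<close>.\<close>
  obtain fs :: "'n cpoly" where fs: "\<And>f :: 'n cpoly. cv.dim (mult_image e k f) \<le> cv.dim (mult_image e k fs)"
    using ex_has_greatest_nat[of "\<lambda>_. True" undefined "\<lambda>f :: 'n cpoly. cv.dim (mult_image e k f)" "Suc N"] le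
    by (auto simp: less_Suc_eq_le)
  define r where "r = cv.dim (mult_image e k fs)"
  obtain B0 where B0: "B0 \<subseteq> mult_col k fs ` shifts e" "cv.independent B0" "mult_col k fs ` shifts e \<subseteq> cv.span B0"
    using cv.maximal_independent_subset[of "mult_col k fs ` shifts e"] .
  have fB0: "finite B0" using B0(1) finite_shifts finite_subset by blast
  have B0f: "B0 \<subseteq> forms k" using B0(1) mult_col_forms by blast
  have "card B0 = r"
    unfolding r_def
  proof (rule cv.basis_card_eq_dim[OF _ _ B0(2)])
    show "B0 \<subseteq> mult_image e k fs"
      unfolding mult_image_def using B0(1) cv.span_superset by (rule subset_trans)
    show "mult_image e k fs \<subseteq> cv.span B0"
      unfolding mult_image_def by (rule cv.span_minimal[OF B0(3) cv.subspace_span])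
  qed
  obtain B1 where B1: "B0 \<subseteq> B1" "B1 \<subseteq> B0 \<union> ?s ` A" "cv.independent B1" "B0 \<union> ?s ` A \<subseteq> cv.span B1"
    using cv.maximal_independent_subset_extend[of B0 "B0 \<union> ?s ` A"] B0(2) by blast
  have fB1: "finite B1" using B1(2) fB0 fA finite_subset by blast
  have "card B1 = cv.dim (forms k :: 'n cpoly set)"
  proof (rule cv.basis_card_eq_dim[OF _ _ B1(3)])
    have "?s ` A \<subseteq> forms k" by (auto simp: A_def forms_def)
    then show "B1 \<subseteq> forms k" using B1(2) B0f by blast
    have "cv.span (?s ` A) \<subseteq> cv.span B1" using B1(4) by (intro cv.span_minimal cv.subspace_span) auto
    then show "forms k \<subseteq> cv.span B1" using sA by (rule subset_trans[rotated])
  qed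
  then have cB1: "card B1 = N" by (simp add: dim_forms N_def A_def)
  have rN: "r \<le> N" using card_mono[OF fB1 B1(1)] \<open>card B0 = r\<close> cB1 by simp
  have cd: "card (B1 - B0) = N - r" using card_Diff_subset[OF fB0 B1(1)] \<open>card B0 = r\<close> cB1 by simp
  obtain h0 where h0: "bij_betw h0 {0..<r} B0"
    using ex_bij_betw_nat_finite[OF fB0] \<open>card B0 = r\<close> by auto
  have "finite (B1 - B0)" using fB1 by simp
  then obtain h1 where h1: "bij_betw h1 {0..<N - r} (B1 - B0)"
    using ex_bij_betw_nat_finite cd by metis
  obtain en where en: "bij_betw en {..<N} A"
    using ex_bij_betw_nat_finite[OF fA] by (auto simp: N_def atLeast0LessThan)
  have "\<exists>b. b \<in> shifts e \<and> h0 j = mult_col k fs b" if "j < r" for j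
  proof -
    have "h0 j \<in> B0" using bij_betwE[OF h0] that by simp
    then have "h0 j \<in> mult_col k fs ` shifts e" by (rule subsetD[OF B0(1)])
    then show ?thesis by auto
  qed
  note ex_bs = someI_ex[OF this]
  define bs where "bs = (\<lambda>j. SOME b. b \<in> shifts e \<and> h0 j = mult_col k fs b)"
  have bs: "\<forall>j. j < r \<longrightarrow> bs j \<in> shifts e \<and> h0 j = mult_col k fs (bs j)"
    unfolding bs_def using ex_bs by simp
  have "\<exists>a. a \<in> A \<and> h1 j = ?s a" if "j < N - r" for j
  proof -
    have "h1 j \<in> B1 - B0" using bij_betwE[OF h1] that by simp
    then have "h1 j \<in> ?s ` A" using B1(2) by auto
    then show ?thesis by auto
  qed
  note ex_gs = someI_ex[OF this]
  define gs where "gs = (\<lambda>j. SOME a. a \<in> A \<and> h1 j = ?s a)"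
  have gs: "\<forall>j. j < N - r \<longrightarrow> gs j \<in> A \<and> h1 j = ?s (gs j)"
    unfolding gs_def using ex_gs by simp
  let ?w = "gfam k r bs gs"
  have w: "?w fs j = (if j < r then h0 j else h1 (j - r))" if "j < N" for j
    using that bs gs rN by (simp add: gfam_def)
  have inj: "inj_on (?w fs) {..<N}"
  proof (rule inj_onI)
    fix i j assume ij: "i \<in> {..<N}" "j \<in> {..<N}" "?w fs i = ?w fs j"
    have m0: "h0 i \<in> B0" if "i < r" for i using bij_betwE[OF h0] that by simp
    have m1: "h1 (i - r) \<in> B1 - B0" if "\<not> i < r" "i < N" for i using bij_betwE[OF h1] that by simp
    show "i = j"
    proof (cases "i < r"; cases "j < r")
      assume "i < r" "j < r"
      then show ?thesis using ij w bij_betw_imp_inj_on[OF h0] by (simp add: inj_on_def)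
    next
      assume "i < r" "\<not> j < r"
      then show ?thesis using ij w[of i] w[of j] m0[of i] m1[of j] by simp
    next
      assume "\<not> i < r" "j < r"
      then show ?thesis using ij w[of i] w[of j] m0[of j] m1[of i] by simp
    next
      assume n: "\<not> i < r" "\<not> j < r"
      then have "h1 (i - r) = h1 (j - r)" using ij w[of i] w[of j] by simp
      then have "i - r = j - r"
        using inj_onD[OF bij_betw_imp_inj_on[OF h1]] n ij by simp
      then show ?thesis using n by simp
    qed
  qed
  have "?w fs ` {..<N} \<subseteq> B1"
    using w bij_betwE[OF h0] bij_betwE[OF h1] B1(1) by auto
  then have li: "lin_indep {..<N} (?w fs)"
    using lin_indep_of_independent[OF _ inj] cv.independent_mono[OF B1(3)] by simp
  have wf: "?w f j \<in> forms k" if "j < N" for f j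
  proof (cases "j < r")
    case True
    then show ?thesis using mult_col_forms[of k f "bs j"] by (simp add: gfam_def)
  next
    case False
    with that gs have "gs (j - r) \<in> A" by simp
    then show ?thesis using False by (simp add: gfam_def forms_def A_def)
  qed
  have iff: "cdet N en (?w f) \<noteq> 0 \<longleftrightarrow> lin_indep {..<N} (?w f)" for f
    by (rule cdet_nonzero_iff[OF en[unfolded A_def] wf])
  \<comment> \<open>Both the determinant and the constant term are polynomial in \<open>s\<close>,
    and each is nonzero for some \<open>s\<close>; hence both are nonzero for a common one.\<close>
  let ?f = "\<lambda>s. fs + cscale s 1"
  have pf: "polyfun (\<lambda>s. Poly_Mapping.lookup (?f s) a)" for a
    by (simp add: lookup_add cscale_lookup) (intro polyfun_add polyfun_mult polyfun_const polyfun_id)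
  have "polyfun (\<lambda>s. cdet N en (?w (?f s)))"
    by (intro polyfun_cdet polyfun_gfam pf)
  moreover have "cdet N en (?w (?f 0)) \<noteq> 0" using li iff by simp
  moreover have "Poly_Mapping.lookup (?f (1 - Poly_Mapping.lookup fs 0)) 0 \<noteq> 0"
    by (simp add: lookup_add cscale_lookup)
  ultimately obtain s where s: "cdet N en (?w (?f s)) \<noteq> 0" "Poly_Mapping.lookup (?f s) 0 \<noteq> 0"
    using polyfun_common_nonzero[OF _ pf[of 0], of "\<lambda>s. cdet N en (?w (?f s))" 0 "1 - Poly_Mapping.lookup fs 0" "{}"]
    by auto
  define c where "c = inverse (Poly_Mapping.lookup (?f s) 0)"
  define f1 where "f1 = cscale c (?f s)"
  have c: "c \<noteq> 0" using s(2) by (simp add: c_def)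
  have "lin_indep {..<N} (?w f1)"
    unfolding lin_indep_def
  proof (intro allI impI)
    fix u assume u: "(\<Sum>j<N. cscale (u j) (?w f1 j)) = 0"
    \<comment> \<open>Scaling the polynomial by \<open>c\<close> scales the first \<open>r\<close>
      columns but not the fixed monomials, so a relation is transported by adjusting only its first
      \<open>r\<close> coefficients.\<close>
    define u' where "u' = (\<lambda>j. if j < r then u j * c else u j)"
    have "cscale (u j) (?w f1 j) = cscale (u' j) (?w (?f s) j)" for j
      by (simp add: u'_def f1_def gfam_def mult_col_cscale)
    then have 0: "(\<Sum>j<N. cscale (u' j) (?w (?f s) j)) = 0" using u by simp
    have "\<forall>j\<in>{..<N}. u' j = 0" using lin_indepD[OF iff[THEN iffD1, OF s(1)] 0] by simp
    then show "\<forall>j\<in>{..<N}. u j = 0" using c by (auto simp: u'_def split: if_splits)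
  qed
  moreover have "Poly_Mapping.lookup f1 0 = 1"
    using s(2) by (simp add: f1_def c_def cscale_lookup)
  ultimately have "generic_rank d e r N bs gs en f1"
    using assms rN bs gs en fs
    by unfold_locales (auto simp: N_def A_def k_def r_def)
  then show ?thesis by blast
qed

lemma sum_lessThan_add: "(\<Sum>i<m + n. g i) = (\<Sum>i<m. g i) + (\<Sum>i<n. g (m + i))"
  for g :: "nat \<Rightarrow> 'a::comm_monoid_add"
  by (induction n) (simp_all add: add.assoc)

context generic_rank
begin

abbreviation top :: "'n cpoly \<Rightarrow> 'n cpoly" where
  "top \<equiv> subpoly (\<lambda>a. mono_degree a = d + 1)"

abbreviation low :: "'n cpoly \<Rightarrow> 'n cpoly" where
  "low \<equiv> subpoly (\<lambda>a. mono_degree a \<le> d)"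

abbreviation w :: "'n cpoly \<Rightarrow> nat \<Rightarrow> 'n cpoly" where
  "w \<equiv> gfam (d + 1) r bs gs"

lemma w_forms: "j < N \<Longrightarrow> w f j \<in> forms (d + 1)"
proof (cases "j < r")
  case True
  then show ?thesis using mult_col_forms[of "d + 1" f "bs j"] by (simp add: gfam_def)
next
  case False
  assume "j < N"
  with False gs[of "j - r"] have "mono_degree (gs (j - r)) = d + 1" by simp
  then show ?thesis using False by (simp add: gfam_def forms_def)
qed

lemma cdet_w_nonzero: "cdet N en (w f) \<noteq> 0 \<longleftrightarrow> lin_indep {..<N} (w f)"
  by (rule cdet_nonzero_iff[OF en w_forms])

lemma en_degree: "i < N \<Longrightarrow> mono_degree (en i) = d + 1"
  using bij_betwE[OF en] by simp

lemma w_cong: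
  assumes "\<And>a. d + 1 - e \<le> mono_degree a \<Longrightarrow> mono_degree a \<le> d \<Longrightarrow>
    Poly_Mapping.lookup f a = Poly_Mapping.lookup g a"
  shows "w f = w g"
proof
  fix j
  show "w f j = w g j"
    using mult_col_cong[OF bs, of j "d + 1" f g] assms by (auto simp: gfam_def)
qed

text \<open>A multiplier without constant term never brings the degree \<open>d + 1\<close> part of
  \<open>f\<close> into degree \<open>d + 1\<close> of the product, so that part may be edited
  freely.\<close>

lemma top_mult_cong:
  assumes "Poly_Mapping.keys q \<subseteq> shifts e"
    and "\<And>a. mono_degree a \<le> d \<Longrightarrow> Poly_Mapping.lookup f a = Poly_Mapping.lookup g a"
  shows "top (q * f) = top (q * g)"
  unfolding subpoly_mult_expansion[OF finite_shifts assms(1)]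
  using assms(2) by (intro sum.cong refl arg_cong2[of _ _ _ _ cscale] mult_col_cong) auto

text \<open>The matrix of \<open>w f\<close> with the coefficients of \<open>f\<close> as
  indeterminates, one for each monomial. Columns from \<open>r\<close> on do not involve
  \<open>f\<close> and are read off at \<open>f = 0\<close>.\<close>

definition entry :: "nat \<Rightarrow> nat \<Rightarrow> 'n monomial cpoly" where
  "entry i j = (if j < r then
     (if en i \<in> range ((+) (bs j)) then Poly_Mapping.single (Poly_Mapping.single (en i - bs j) 1) 1 else 0)
     else Poly_Mapping.single 0 (Poly_Mapping.lookup (w 0 j) (en i)))"

lemma entry_forms: "entry i j \<in> forms (if j < r then 1 else 0)"
  by (auto simp: entry_def forms_def)

lemma entry_eval: "i < N \<Longrightarrow> poly_eval (Poly_Mapping.lookup f) (entry i j) = Poly_Mapping.lookup (w f j) (en i)"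
  by (auto simp: entry_def gfam_def lookup_mult_col en_degree poly_eval_single mono_eval_single)

text \<open>The numerator family of Cramer's rule: when \<open>w f\<close> is a basis, the
  determinant of this family measures the coefficient of the monomial \<open>gs l\<close> in the
  expansion of \<open>top f\<close>.\<close>

definition replaced :: "nat \<Rightarrow> 'n cpoly \<Rightarrow> nat \<Rightarrow> 'n cpoly" where
  "replaced l f = (w f)(r + l := top f)"

lemma det_product_form:
  "\<exists>m. \<exists>F \<in> forms m. \<forall>f. poly_eval (Poly_Mapping.lookup f) F = cdet N en (w f) * cdet N en (replaced l f)"
proof -
  obtain F where F: "F \<in> forms (\<Sum>j<N. if j < r then 1 else 0)"
    "\<And>x. poly_eval x F = det (mat N N (\<lambda>(i, j). poly_eval x (entry i j)))"
    using det_polynomial[of N entry "\<lambda>j. if j < r then 1 else 0", OF entry_forms] by blast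
  let ?e = "\<lambda>i j. if j = r + l then Poly_Mapping.single (Poly_Mapping.single (en i) 1) 1 else entry i j"
  let ?m = "\<lambda>j. if j = r + l then 1 else if j < r then 1 else 0"
  have "?e i j \<in> forms (?m j)" for i j
    using entry_forms[of i j] by (auto simp: forms_def)
  then obtain G where G: "G \<in> forms (\<Sum>j<N. ?m j)"
    "\<And>x. poly_eval x G = det (mat N N (\<lambda>(i, j). poly_eval x (?e i j)))"
    using det_polynomial[of N ?e ?m] by blast
  have "poly_eval (Poly_Mapping.lookup f) F = cdet N en (w f)" for f
    unfolding F(2) cdet_def by (intro arg_cong[of _ _ det] eq_matI) (auto simp: entry_eval)
  moreover have "poly_eval (Poly_Mapping.lookup f) G = cdet N en (replaced l f)" for f
    unfolding G(2) cdet_def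
    by (intro arg_cong[of _ _ det] eq_matI)
       (auto simp: entry_eval replaced_def lookup_subpoly en_degree poly_eval_single mono_eval_single)
  ultimately have "poly_eval (Poly_Mapping.lookup f) (F * G) = cdet N en (w f) * cdet N en (replaced l f)" for f
    by (simp only: poly_eval_mult)
  then show ?thesis
    using forms_mult[OF F(1) G(1)] by blast
qed

text \<open>For \<open>l = 0\<close> these are the Taylor polynomials; each step adds one direction from the
  complement of the generic image.\<close>

definition X :: "nat \<Rightarrow> 'n cpoly set" where
  "X l = {f \<in> polys_le (d + 1). Poly_Mapping.lookup f 0 = 1 \<and>
     (\<exists>q s. Poly_Mapping.keys q \<subseteq> shifts e \<and>
        top f = top (q * f) + (\<Sum>j<l. cscale (s j) (Poly_Mapping.single (gs j) 1)))}"

lemma XI: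
  assumes "f \<in> polys_le (d + 1)" "Poly_Mapping.lookup f 0 = 1" "Poly_Mapping.keys q \<subseteq> shifts e"
    "top f = top (q * f) + (\<Sum>j<l. cscale (s j) (Poly_Mapping.single (gs j) 1))"
  shows "f \<in> X l"
  unfolding X_def using assms by blast

lemma XE:
  assumes "f \<in> X l"
  obtains q s where "f \<in> polys_le (d + 1)" "Poly_Mapping.lookup f 0 = 1" "Poly_Mapping.keys q \<subseteq> shifts e"
    "top f = top (q * f) + (\<Sum>j<l. cscale (s j) (Poly_Mapping.single (gs j) 1))"
  using assms unfolding X_def by blast

text \<open>The substitution \<open>q = 1 - Q\<close> turns \<open>top (Q * f) = 0\<close> into
  \<open>top f = top (q * f)\<close>.\<close>

lemma X_0: "X 0 = rational_taylor_polys d e (d + 1)"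
proof (intro Set.set_eqI iffI)
  fix f assume "f \<in> X 0"
  then obtain q where f: "f \<in> polys_le (d + 1)" "Poly_Mapping.lookup f 0 = 1"
    and q: "Poly_Mapping.keys q \<subseteq> shifts e" "top f = top (q * f)"
    by (auto elim!: XE)
  have q0: "Poly_Mapping.lookup q a = 0" if "a \<notin> shifts e" for a
    using q(1) that by (auto simp: in_keys_iff)
  have "1 - q \<in> polys_le e"
    using q0 by (auto simp: polys_le_lookup lookup_minus lookup_one shifts_def when_def)
  moreover have "Poly_Mapping.lookup (1 - q) 0 = 1"
    using q0[of 0] by (simp add: lookup_minus shifts_def)
  moreover have "top ((1 - q) * f) = 0"
  proof -
    have "top (q * f) + top ((1 - q) * f) = top f"
      unfolding subpoly_add[symmetric] by (simp add: algebra_simps)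
    then show ?thesis using q(2) by simp
  qed
  ultimately show "f \<in> rational_taylor_polys d e (d + 1)"
    using f unfolding rational_taylor_polys_iff by blast
next
  fix f :: "'n cpoly" assume "f \<in> rational_taylor_polys d e (d + 1)"
  then obtain Q where f: "f \<in> polys_le (d + 1)" "Poly_Mapping.lookup f 0 = 1"
    and Q: "Q \<in> polys_le e" "Poly_Mapping.lookup Q 0 = 1" "top (Q * f) = 0"
    unfolding rational_taylor_polys_iff by blast
  have "Poly_Mapping.keys (1 - Q) \<subseteq> shifts e"
  proof
    fix a assume a: "a \<in> Poly_Mapping.keys (1 - Q)"
    have "a \<noteq> 0" using a Q(2) by (auto simp: in_keys_iff lookup_minus)
    then have "Poly_Mapping.lookup Q a \<noteq> 0"
      using a by (simp add: in_keys_iff lookup_minus lookup_one)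
    then have "mono_degree a \<le> e" using Q(1) unfolding polys_le_lookup by (meson not_le)
    moreover have "1 \<le> mono_degree a" using \<open>a \<noteq> 0\<close> mono_degree_eq_0[of a] by linarith
    ultimately show "a \<in> shifts e" by (simp add: shifts_def)
  qed
  moreover have "top f = top ((1 - Q) * f) + (\<Sum>j<0. cscale 0 (Poly_Mapping.single (gs j) 1))"
  proof -
    have "top (Q * f) + top ((1 - Q) * f) = top f"
      unfolding subpoly_add[symmetric] by (simp add: algebra_simps)
    then show ?thesis using Q(3) by simp
  qed
  ultimately show "f \<in> X 0" using f by (intro XI)
qed

lemma X_sub: "X l \<subseteq> polys_le (d + 1) - {0}"
  by (auto elim!: XE)

lemma X_mono: "X l \<subseteq> X (Suc l)"
proof
  fix f assume "f \<in> X l"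
  then obtain q s where *: "f \<in> polys_le (d + 1)" "Poly_Mapping.lookup f 0 = 1" "Poly_Mapping.keys q \<subseteq> shifts e"
    "top f = top (q * f) + (\<Sum>j<l. cscale (s j) (Poly_Mapping.single (gs j) 1))"
    by (rule XE)
  have "(\<Sum>j<Suc l. cscale ((s(l := 0)) j) (Poly_Mapping.single (gs j) 1)) =
      (\<Sum>j<l. cscale (s j) (Poly_Mapping.single (gs j) 1))"
    by simp
  with * show "f \<in> X (Suc l)" by (intro XI[where q = q and s = "s(l := 0)"]) simp_all
qed

lemma low_f1: "low f1 \<in> X l"
proof (rule XI)
  show "low f1 \<in> polys_le (d + 1)" by (simp add: polys_le_lookup lookup_subpoly)
  show "Poly_Mapping.lookup (low f1) 0 = 1" using f1_0 by (simp add: lookup_subpoly)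
  show "Poly_Mapping.keys 0 \<subseteq> shifts e" by simp
  show "top (low f1) = top (0 * low f1) + (\<Sum>j<l. cscale ((\<lambda>_. 0) j) (Poly_Mapping.single (gs j) 1))"
    by (rule poly_mapping_eqI) (simp add: lookup_subpoly)
qed

text \<open>A segment between two points need not stay in the set. Instead the lower parts, the
  multipliers and the extra coefficients are interpolated linearly, and the top part is defined by
  the required equation, which makes it quadratic at most in the parameter.\<close>

lemma X_curve:
  assumes l: "l \<le> N - r" and f: "f \<in> X l" and f': "f' \<in> X l"
  shows "\<exists>\<gamma>. \<gamma> 0 = f \<and> \<gamma> 1 = f' \<and> (\<forall>s. \<gamma> s \<in> X l) \<and> (\<forall>a. polyfun (\<lambda>s. Poly_Mapping.lookup (\<gamma> s) a))"
proof -
  obtain q c where f_props: "f \<in> polys_le (d + 1)" "Poly_Mapping.lookup f 0 = 1" "Poly_Mapping.keys q \<subseteq> shifts e"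
    "top f = top (q * f) + (\<Sum>j<l. cscale (c j) (Poly_Mapping.single (gs j) 1))"
    using f by (rule XE)
  obtain q' c' where f'_props: "f' \<in> polys_le (d + 1)" "Poly_Mapping.lookup f' 0 = 1" "Poly_Mapping.keys q' \<subseteq> shifts e"
    "top f' = top (q' * f') + (\<Sum>j<l. cscale (c' j) (Poly_Mapping.single (gs j) 1))"
    using f' by (rule XE)
  define qs where "qs = (\<lambda>s. cscale (1 - s) q + cscale s q')"
  define fs where "fs = (\<lambda>s. cscale (1 - s) f + cscale s f')"
  define cs where "cs = (\<lambda>s j. (1 - s) * c j + s * c' j)"
  define S where "S = (\<lambda>s. \<Sum>j<l. cscale (cs s j) (Poly_Mapping.single (gs j) 1))"
  define \<gamma> where
    "\<gamma> = (\<lambda>s. low (fs s) + (top (qs s * fs s) + S s))"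
  have split: "p = low p + top p" if "p \<in> polys_le (d + 1)" for p
    using that by (intro poly_mapping_eqI) (auto simp: lookup_add lookup_subpoly polys_le_lookup)
  have S: "S s \<in> forms (d + 1)" for s
    unfolding S_def using gs l by (intro forms_sum cv.subspace_scale[OF subspace_forms]) (auto simp: forms_def)
  have lowg: "Poly_Mapping.lookup (\<gamma> s) a = Poly_Mapping.lookup (fs s) a" if "mono_degree a \<le> d" for s a
    using that S[of s] by (auto simp: \<gamma>_def lookup_add lookup_subpoly forms_lookup)
  have "\<gamma> s \<in> X l" for s
  proof (rule XI)
    show "\<gamma> s \<in> polys_le (d + 1)"
      using S[of s] by (auto simp: \<gamma>_def polys_le_lookup lookup_add lookup_subpoly forms_lookup)
    show "Poly_Mapping.lookup (\<gamma> s) 0 = 1"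
      using lowg[of 0 s] f_props f'_props by (simp add: fs_def lookup_add cscale_lookup)
    show k: "Poly_Mapping.keys (qs s) \<subseteq> shifts e"
    proof
      fix a assume "a \<in> Poly_Mapping.keys (qs s)"
      then have "Poly_Mapping.lookup q a \<noteq> 0 \<or> Poly_Mapping.lookup q' a \<noteq> 0"
        by (auto simp: in_keys_iff qs_def lookup_add cscale_lookup)
      then show "a \<in> shifts e" using f_props(3) f'_props(3) by (auto simp: in_keys_iff)
    qed
    have "top (\<gamma> s) = top (qs s * fs s) + S s"
      using S[of s] by (intro poly_mapping_eqI) (auto simp: \<gamma>_def lookup_add lookup_subpoly forms_lookup)
    \<comment> \<open>The curve and \<open>fs s\<close> differ only in top degree, which a
      multiplier without constant term does not see.\<close>
    also have "top (qs s * fs s) = top (qs s * \<gamma> s)"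
      using k by (rule top_mult_cong) (simp add: lowg)
    finally show "top (\<gamma> s) = top (qs s * \<gamma> s) + (\<Sum>j<l. cscale (cs s j) (Poly_Mapping.single (gs j) 1))"
      by (simp add: S_def)
  qed
  moreover have "polyfun (\<lambda>s. Poly_Mapping.lookup (\<gamma> s) a)" for a
  proof -
    have c1: "polyfun (\<lambda>s. 1 - s)"
      using polyfun_add[OF polyfun_const[of 1] polyfun_mult[OF polyfun_const[of "-1"] polyfun_id]] by simp
    note intros = polyfun_add polyfun_mult polyfun_const polyfun_id polyfun_sum c1
    have 1: "polyfun (\<lambda>s. Poly_Mapping.lookup (fs s) a)"
      by (simp add: fs_def lookup_add cscale_lookup) (intro intros)
    have 2: "polyfun (\<lambda>s. Poly_Mapping.lookup (qs s * fs s) a)"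
      by (simp add: fs_def qs_def distrib_left distrib_right cscale_mult_left cscale_mult_right
          lookup_add cscale_lookup) (intro intros)
    have 3: "polyfun (\<lambda>s. Poly_Mapping.lookup (S s) a)"
      by (simp add: S_def cs_def lookup_sum cscale_lookup) (intro intros)
    have if_pf: "polyfun (\<lambda>s. if P then g s else 0)" if "polyfun g" for P g
      using that by (cases P) (simp_all add: polyfun_const)
    show ?thesis
      unfolding \<gamma>_def lookup_add lookup_subpoly by (intro polyfun_add if_pf 1 2 3)
  qed
  moreover have "\<gamma> 0 = f"
    using f_props(4) split[OF f_props(1)] by (simp add: \<gamma>_def fs_def qs_def S_def cs_def)
  moreover have "\<gamma> 1 = f'"
    using f'_props(4) split[OF f'_props(1)] by (simp add: \<gamma>_def fs_def qs_def S_def cs_def)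
  ultimately show ?thesis by blast
qed

section \<open>The chain of irreducible closed sets\<close>

definition C :: "nat \<Rightarrow> 'n cpoly set set" where
  "C l = proj_space (d + 1) closure_of (proj_class (d + 1) ` X l)"

lemma C_irreducible:
  assumes "l \<le> N - r"
  shows "irreducible_closedin (proj_space (d + 1)) (C l)"
  unfolding C_def
proof (rule irreducible_closure[OF X_sub])
  show "X l \<noteq> {}" using low_f1[of l] by blast
qed (rule X_curve[OF assms])

lemma C_0: "C 0 = taylor_variety d e (d + 1)"
  by (simp add: C_def taylor_variety_def X_0)

lemma mult_image_finite_dim:
  fixes f :: "'n cpoly"
  shows "mult_image e (d + 1) f \<subseteq> cv.span ((\<lambda>a. Poly_Mapping.single a 1) ` {a. mono_degree a = d + 1})"
  using mult_image_subset_forms forms_span_monomials by (rule subset_trans)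

lemma w_image: "w f ` {..<r} \<subseteq> mult_image e (d + 1) f"
  unfolding mult_image_def using bs by (auto simp: gfam_def intro!: cv.span_base)

lemma lin_indep_r: "lin_indep {..<N} (w f) \<Longrightarrow> lin_indep {..<r} (w f)"
  by (rule lin_indep_subset) (use r_le in auto)

text \<open>The first \<open>r\<close> columns are independent, so the rank is at least
  \<open>r\<close>; maximality of \<open>r\<close> gives the other inequality.\<close>

lemma generic_dim: "lin_indep {..<N} (w f) \<Longrightarrow> cv.dim (mult_image e (d + 1) f) = r"
  using lin_indep_card_le[OF _ lin_indep_r w_image mult_image_finite_dim] rank_le[of f]
  by (simp add: finite_monomials_eq le_antisym)

text \<open>Where the first determinant is nonzero, the first \<open>r\<close> columns span the
  whole image, so \<open>top f\<close> depends on them and on the first \<open>l\<close> extra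
  monomials. At degenerate points the image may be spanned differently and nothing is claimed about
  the second factor; hence the product.\<close>

lemma X_vanishing:
  assumes f: "f \<in> X l" and l: "l < N - r"
  shows "cdet N en (w f) * cdet N en (replaced l f) = 0"
proof (cases "cdet N en (w f) = 0")
  case False
  then have li: "lin_indep {..<N} (w f)" using cdet_w_nonzero by blast
  obtain q s where q: "Poly_Mapping.keys q \<subseteq> shifts e"
    "top f = top (q * f) + (\<Sum>j<l. cscale (s j) (Poly_Mapping.single (gs j) 1))"
    using f by (rule XE)
  have "top (q * f) \<in> mult_image e (d + 1) f" using q(1) by (auto simp: mult_image_iff)
  then obtain u where u: "top (q * f) = (\<Sum>j<r. cscale (u j) (w f j))"
    using lin_indep_expansion[OF lin_indep_r[OF li] w_image mult_image_finite_dim _ rank_le]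
    by (auto simp: finite_monomials_eq)
  \<comment> \<open>The defining equation of \<open>X l\<close> rewritten as a relation among the
    replaced columns; the entry -1 at position \<open>r + l\<close> makes it nontrivial.\<close>
  define c where "c = (\<lambda>j. if j < r then u j else if j < r + l then s (j - r) else if j = r + l then -1 else 0)"
  let ?g = "\<lambda>j. cscale (c j) (replaced l f j)"
  have "(\<Sum>j<N. ?g j) = (\<Sum>j<Suc (r + l). ?g j)"
    using l by (intro sum.mono_neutral_right) (auto simp: c_def)
  also have "\<dots> = (\<Sum>j<r. ?g j) + (\<Sum>j<l. ?g (r + j)) + ?g (r + l)"
    by (simp add: sum_lessThan_add)
  also have "(\<Sum>j<r. ?g j) = top (q * f)"
    unfolding u by (rule sum.cong) (auto simp: c_def replaced_def)
  also have "(\<Sum>j<l. ?g (r + j)) = (\<Sum>j<l. cscale (s j) (Poly_Mapping.single (gs j) 1))"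
    by (rule sum.cong) (auto simp: c_def replaced_def gfam_def)
  also have "?g (r + l) = - top f" by (simp add: c_def replaced_def cv.scale_minus_left)
  finally have 0: "(\<Sum>j<N. ?g j) = 0" using q(2) by simp
  have "\<not> lin_indep {..<N} (replaced l f)"
  proof
    assume "lin_indep {..<N} (replaced l f)"
    moreover have "r + l \<in> {..<N}" using l by simp
    ultimately have "c (r + l) = 0" by (rule lin_indepD[OF _ 0])
    then show False by (simp add: c_def)
  qed
  moreover have "replaced l f j \<in> forms (d + 1)" if "j < N" for j
    using w_forms[OF that] subpoly_forms by (auto simp: replaced_def)
  ultimately show ?thesis using cdet_nonzero_iff[OF en, of "replaced l f"] by auto
qed simp

lemma C_strict:
  assumes l: "l < N - r"
  shows "C l \<subset> C (Suc l)"
proof (rule psubsetI)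
  show "C l \<subseteq> C (Suc l)"
    unfolding C_def by (intro closure_of_mono image_mono X_mono)
  obtain m F where F: "F \<in> forms m"
    "\<And>f. poly_eval (Poly_Mapping.lookup f) F = cdet N en (w f) * cdet N en (replaced l f)"
    using det_product_form[of l] by blast
  have sub: "C l \<subseteq> proj_zeros (d + 1) {F}"
    unfolding C_def using X_vanishing[OF _ l] F by (intro closure_vanishing[OF X_sub F(1)]) simp
  \<comment> \<open>The top part is exactly the monomial that \<open>replaced\<close> overwrites, so
    both determinants become the nonzero one of \<open>f1\<close>.\<close>
  define f where "f = low f1 + Poly_Mapping.single (gs l) 1"
  have gl: "mono_degree (gs l) = d + 1" using gs l by simp
  have lf: "Poly_Mapping.lookup f a = Poly_Mapping.lookup f1 a" if "mono_degree a \<le> d" for a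
    using that gl by (auto simp: f_def lookup_add lookup_subpoly lookup_single when_def)
  have tf: "top f = Poly_Mapping.single (gs l) 1"
    using gl by (intro poly_mapping_eqI) (auto simp: f_def lookup_add lookup_subpoly lookup_single when_def)
  have fX: "f \<in> X (Suc l)"
  proof (rule XI)
    show "f \<in> polys_le (d + 1)"
      using gl by (auto simp: f_def polys_le_lookup lookup_add lookup_subpoly lookup_single when_def)
    show "Poly_Mapping.lookup f 0 = 1" using lf[of 0] f1_0 by simp
    show "Poly_Mapping.keys 0 \<subseteq> shifts e" by simp
    have "(\<Sum>j<Suc l. cscale ((\<lambda>j. if j = l then 1 else 0) j) (Poly_Mapping.single (gs j) 1)) = Poly_Mapping.single (gs l) 1"
      by simp
    moreover have "top (0 * f) = 0" by (rule poly_mapping_eqI) (simp add: lookup_subpoly)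
    ultimately show "top f = top (0 * f) +
        (\<Sum>j<Suc l. cscale ((\<lambda>j. if j = l then 1 else 0) j) (Poly_Mapping.single (gs j) 1))"
      by (simp only: tf add_0)
  qed
  have wf: "w f = w f1" by (rule w_cong) (simp add: lf)
  have g: "w f1 (r + l) = Poly_Mapping.single (gs l) 1" by (simp add: gfam_def)
  have "replaced l f = w f1"
    unfolding replaced_def wf tf g[symmetric] by (rule fun_upd_triv)
  then have "poly_eval (Poly_Mapping.lookup f) F = cdet N en (w f1) * cdet N en (w f1)"
    by (simp only: F(2) wf)
  moreover have "cdet N en (w f1) \<noteq> 0" using f1 cdet_w_nonzero by blast
  ultimately have "poly_eval (Poly_Mapping.lookup f) F \<noteq> 0" by simp
  then have "proj_class (d + 1) f \<notin> proj_zeros (d + 1) {F}"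
    using proj_class_self[of f "d + 1"] fX X_sub by (auto simp: proj_zeros_def)
  moreover have "proj_class (d + 1) f \<in> C (Suc l)"
  proof -
    have "proj_class (d + 1) ` X (Suc l) \<subseteq> C (Suc l)"
      unfolding C_def
      by (rule closure_of_subset) (use X_sub proj_class_self(2) in \<open>auto simp: topspace_proj_space\<close>)
    then show ?thesis using fX by blast
  qed
  ultimately show "C l \<noteq> C (Suc l)" using sub by blast
qed

lemma codimension_ge: "enat (N - r) \<le> irreducible_codim (proj_space (d + 1)) (C 0)"
  using C_irreducible C_strict by (intro irreducible_codim_ge) auto

text \<open>Expand \<open>top g\<close> in the basis \<open>w g\<close> and discard the components
  along the monomials \<open>gs\<close>. Only coordinates in \<open>gs\<close> change, the remaining
  top part lies in the image, and that image is unaffected by the change.\<close>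

lemma prescribed_coefficients:
  assumes g: "Poly_Mapping.lookup g 0 \<noteq> 0" "cdet N en (w g) \<noteq> 0" "g \<in> polys_le (d + 1)"
  shows "\<exists>f\<in>\<Union>(C 0). \<forall>a. a \<notin> gs ` {..<N - r} \<longrightarrow> Poly_Mapping.lookup f a = Poly_Mapping.lookup g a"
proof -
  have li: "lin_indep {..<N} (w g)" using g(2) cdet_w_nonzero by blast
  have wi: "w g ` {..<N} \<subseteq> forms (d + 1)" using w_forms by auto
  have dim: "cv.dim (forms (d + 1) :: 'n cpoly set) \<le> N" by (simp add: dim_forms N)
  obtain u where u: "top g = (\<Sum>j<N. cscale (u j) (w g j))"
    using lin_indep_expansion[OF li wi forms_span_monomials _ dim subpoly_forms]
    by (auto simp: finite_monomials_eq)
  define t where "t = (\<Sum>j<r. cscale (u j) (w g j))"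
  have "t \<in> mult_image e (d + 1) g"
    unfolding t_def using w_image[of g]
    by (intro cv.subspace_sum[OF subspace_mult_image] cv.subspace_scale[OF subspace_mult_image]) auto
  then obtain q where q: "Poly_Mapping.keys q \<subseteq> shifts e" "t = top (q * g)"
    by (auto simp: mult_image_iff)
  have tf: "t \<in> forms (d + 1)" using q(2) subpoly_forms by simp
  have t: "Poly_Mapping.lookup t a = Poly_Mapping.lookup g a"
    if a: "mono_degree a = d + 1" "a \<notin> gs ` {..<N - r}" for a
  proof -
    have "top g = (\<Sum>j<r + (N - r). cscale (u j) (w g j))" using u r_le by simp
    also have "\<dots> = t + (\<Sum>j<N - r. cscale (u (r + j)) (w g (r + j)))"
      by (simp add: sum_lessThan_add t_def)
    finally have "Poly_Mapping.lookup (top g) a =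
        Poly_Mapping.lookup t a + (\<Sum>j<N - r. u (r + j) * Poly_Mapping.lookup (w g (r + j)) a)"
      by (simp add: lookup_add lookup_sum cscale_lookup)
    moreover have "(\<Sum>j<N - r. u (r + j) * Poly_Mapping.lookup (w g (r + j)) a) = 0"
      using a(2) by (intro sum.neutral) (auto simp: gfam_def lookup_single when_def)
    ultimately show ?thesis using a(1) by (simp add: lookup_subpoly)
  qed
  define f where "f = low g + t"
  have lowf: "Poly_Mapping.lookup f a = Poly_Mapping.lookup g a" if "mono_degree a \<le> d" for a
    using that tf by (simp add: f_def lookup_add lookup_subpoly forms_lookup)
  have fle: "f \<in> polys_le (d + 1)"
    using tf by (auto simp: f_def polys_le_lookup lookup_add lookup_subpoly forms_lookup)
  have f0: "Poly_Mapping.lookup f 0 \<noteq> 0" using lowf[of 0] g(1) by simp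
  have topf: "top f = top (q * f)"
  proof -
    have "top f = t"
      using tf by (intro poly_mapping_eqI) (auto simp: f_def lookup_add lookup_subpoly forms_lookup)
    also have "\<dots> = top (q * f)"
      unfolding q(2) using q(1) by (rule top_mult_cong) (simp add: lowf)
    finally show ?thesis .
  qed
  define c where "c = Poly_Mapping.lookup f 0"
  \<comment> \<open>Membership in \<open>X 0\<close> requires constant term 1, so it is checked for
    this multiple; \<open>f\<close> represents the same projective point.\<close>
  define f' where "f' = cscale (inverse c) f"
  have "c \<noteq> 0" using f0 by (simp add: c_def)
  have "f' \<in> X 0"
  proof (rule XI)
    show "f' \<in> polys_le (d + 1)" using fle by (simp add: f'_def polys_le_lookup cscale_lookup)
    show "Poly_Mapping.lookup f' 0 = 1" using \<open>c \<noteq> 0\<close> by (simp add: f'_def cscale_lookup c_def)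
    show "Poly_Mapping.keys q \<subseteq> shifts e" by (rule q)
    show "top f' = top (q * f') + (\<Sum>j<0. cscale ((\<lambda>_. 0) j) (Poly_Mapping.single (gs j) 1))"
      using topf by (simp add: f'_def subpoly_cscale cscale_mult_right)
  qed
  moreover from this have f': "f' \<in> polys_le (d + 1)" "f' \<noteq> 0" using X_sub by auto
  have "proj_class (d + 1) ` X 0 \<subseteq> C 0"
    unfolding C_def
    by (rule closure_of_subset) (use X_sub proj_class_self(2) in \<open>auto simp: topspace_proj_space\<close>)
  ultimately have "proj_class (d + 1) f' \<in> C 0" by blast
  moreover have "f \<in> proj_class (d + 1) f'"
  proof -
    have "f = cscale c f'" using \<open>c \<noteq> 0\<close> by (simp add: f'_def)
    then show ?thesis
      using proj_pointsE(4)[OF proj_class_self(2)[OF f'] proj_class_self(1)[OF f'], of f] \<open>c \<noteq> 0\<close> by blast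
  qed
  ultimately have "f \<in> \<Union>(C 0)" by blast
  moreover have "Poly_Mapping.lookup f a = Poly_Mapping.lookup g a" if a: "a \<notin> gs ` {..<N - r}" for a
  proof -
    consider "mono_degree a \<le> d" | "mono_degree a = d + 1" | "mono_degree a > d + 1" by linarith
    then show ?thesis
    proof cases
      case 1
      then show ?thesis by (rule lowf)
    next
      case 2
      then show ?thesis using t[OF 2 a] by (simp add: f_def lookup_add lookup_subpoly)
    next
      case 3
      then show ?thesis using fle g(3) by (simp add: polys_le_lookup)
    qed
  qed
  ultimately show ?thesis by (intro bexI[of _ f]) simp_all
qed

text \<open>Generic values of the coordinates outside \<open>gs\<close> are all attained on the
  cone. A relation among these coordinates therefore vanishes at every generic point, and a nonzero
  polynomial cannot do so.\<close>

lemma alg_indep_C_0: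
  "alg_indep (\<Union>(C 0)) (card ({a :: 'n monomial. mono_degree a \<le> d + 1} - gs ` {..<N - r}))"
proof -
  define A where "A = {a :: 'n monomial. mono_degree a \<le> d + 1} - gs ` {..<N - r}"
  define t where "t = card A"
  have fA: "finite A" by (simp add: A_def finite_monomials_le)
  obtain h where h: "bij_betw h {..<t} A"
    using ex_bij_betw_nat_finite[OF fA] by (auto simp: t_def atLeast0LessThan)
  have hA: "h i \<in> A" if "i < t" for i using bij_betwE[OF h] that by simp
  define fx where "fx = (\<lambda>x. \<Sum>i<t. Poly_Mapping.single (h i) (x i :: complex))"
  have fx_h: "Poly_Mapping.lookup (fx x) (h i) = x i" if "i < t" for x i
  proof -
    have "Poly_Mapping.lookup (fx x) (h i) = (\<Sum>j<t. if j = i then x j else 0)"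
      unfolding fx_def lookup_sum
      using that bij_betw_imp_inj_on[OF h]
      by (intro sum.cong) (auto simp: lookup_single when_def inj_on_def)
    then show ?thesis using that by simp
  qed
  have fx_le: "fx x \<in> polys_le (d + 1)" for x
  proof -
    have "h i \<noteq> a" if "i < t" "d + 1 < mono_degree a" for i a
      using hA[OF that(1)] that(2) by (auto simp: A_def)
    then show ?thesis
      by (auto simp: fx_def polys_le_lookup lookup_sum lookup_single when_def intro!: sum.neutral)
  qed
  have key: "poly_eval x R = 0"
    if R: "indets R \<subseteq> {..<t}" and z: "\<And>f. f \<in> \<Union>(C 0) \<Longrightarrow>
        poly_eval (\<lambda>i. poly_eval (Poly_Mapping.lookup f) (Poly_Mapping.single (Poly_Mapping.single (h i) 1) 1)) R = 0"
      and x: "Poly_Mapping.lookup (fx x) 0 \<noteq> 0" "cdet N en (w (fx x)) \<noteq> 0" for R x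
  proof -
    obtain f where f: "f \<in> \<Union>(C 0)"
      "\<forall>a. a \<notin> gs ` {..<N - r} \<longrightarrow> Poly_Mapping.lookup f a = Poly_Mapping.lookup (fx x) a"
      using prescribed_coefficients[OF x fx_le] by (elim bexE)
    have "Poly_Mapping.lookup f (h i) = x i" if "i < t" for i
      using spec[OF f(2), of "h i"] hA[OF that] fx_h[OF that] by (simp add: A_def)
    then have "poly_eval (\<lambda>i. poly_eval (Poly_Mapping.lookup f) (Poly_Mapping.single (Poly_Mapping.single (h i) 1) 1)) R = poly_eval x R"
      using R by (intro poly_eval_cong) (auto simp: poly_eval_single mono_eval_single indets_def)
    then show ?thesis using z[OF f(1)] by simp
  qed
  have "alg_indep (\<Union>(C 0)) t"
  proof (rule alg_indepI[where y = "\<lambda>i. Poly_Mapping.single (Poly_Mapping.single (h i) 1) 1"], rule ccontr)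
    fix R assume R: "indets R \<subseteq> {..<t}" and z: "\<And>f. f \<in> \<Union>(C 0) \<Longrightarrow>
        poly_eval (\<lambda>i. poly_eval (Poly_Mapping.lookup f) (Poly_Mapping.single (Poly_Mapping.single (h i) 1) 1)) R = 0"
      and "R \<noteq> 0"
    obtain x0 where x0: "poly_eval x0 R \<noteq> 0" using nonzero_poly_eval[OF \<open>R \<noteq> 0\<close>] by blast
    \<comment> \<open>A point known to be generic. All coordinates of degree up to \<open>d\<close>
      are among the chosen ones because \<open>gs\<close> has degree \<open>d + 1\<close>, so
      \<open>fx x1\<close> agrees with \<open>f1\<close> wherever the determinant looks.\<close>
    define x1 where "x1 = (\<lambda>i. Poly_Mapping.lookup f1 (h i))"
    have lowx1: "Poly_Mapping.lookup (fx x1) a = Poly_Mapping.lookup f1 a" if a: "mono_degree a \<le> d" for a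
    proof -
      have "a \<noteq> gs j" if "j < N - r" for j using gs[OF that] a by auto
      then have "a \<in> A" using a by (auto simp: A_def)
      then obtain i where "i < t" "a = h i" using h by (auto simp: bij_betw_def)
      then show ?thesis by (simp add: fx_h x1_def)
    qed
    have wx1: "w (fx x1) = w f1" by (rule w_cong) (simp add: lowx1)
    \<comment> \<open>The line joining a point with \<open>R\<close> nonzero to the generic point;
      somewhere on it both conditions hold, contradicting \<open>key\<close>.\<close>
    define xs where "xs = (\<lambda>s i. x0 i + s * (x1 i - x0 i))"
    have xs: "polyfun (\<lambda>s. xs s i)" for i
      unfolding xs_def by (intro polyfun_add polyfun_mult polyfun_const polyfun_id)
    have pf: "polyfun (\<lambda>s. Poly_Mapping.lookup (fx (xs s)) a)" for a
    proof -
      have "polyfun (\<lambda>s. \<Sum>i<t. if h i = a then xs s i else 0)"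
      proof (rule polyfun_sum)
        show "polyfun (\<lambda>s. if h i = a then xs s i else 0)" for i
          by (cases "h i = a") (simp_all add: xs polyfun_const)
      qed
      then show ?thesis by (simp add: fx_def lookup_sum lookup_single when_def)
    qed
    have "polyfun (\<lambda>s. poly_eval (xs s) R)" by (rule polyfun_poly_eval[OF xs])
    moreover have "polyfun (\<lambda>s. Poly_Mapping.lookup (fx (xs s)) 0 * cdet N en (w (fx (xs s))))"
      by (intro polyfun_mult polyfun_cdet polyfun_gfam pf)
    moreover have "poly_eval (xs 0) R \<noteq> 0" using x0 by (simp add: xs_def)
    moreover have "xs 1 = x1" by (simp add: xs_def)
    have "cdet N en (w (fx x1)) \<noteq> 0" unfolding wx1 using f1 cdet_w_nonzero by blast
    then have "Poly_Mapping.lookup (fx (xs 1)) 0 * cdet N en (w (fx (xs 1))) \<noteq> 0"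
      unfolding \<open>xs 1 = x1\<close> using lowx1[of 0] f1_0 by simp
    ultimately obtain s where s: "poly_eval (xs s) R \<noteq> 0"
      "Poly_Mapping.lookup (fx (xs s)) 0 * cdet N en (w (fx (xs s))) \<noteq> 0"
      by (rule polyfun_common_nonzero[OF _ _ _ _ finite.emptyI])
    then have "poly_eval (xs s) R = 0" by (intro key[OF R z]) auto
    with s(1) show False by simp
  qed
  then show ?thesis by (simp add: t_def A_def)
qed

lemma codimension_taylor_variety:
  "codimension (proj_space (d + 1)) (taylor_variety d e (d + 1) :: 'n cpoly set set) = enat (N - r)"
proof -
  let ?M = "{a :: 'n monomial. mono_degree a \<le> d + 1}"
  have "irreducible_codim (proj_space (d + 1)) (C 0) \<le> enat (card ?M - card (?M - gs ` {..<N - r}))"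
    by (rule irreducible_codim_le[OF alg_indep_C_0])
  also have "card ?M - card (?M - gs ` {..<N - r}) \<le> N - r"
  proof -
    have "card ?M - card (gs ` {..<N - r}) \<le> card (?M - gs ` {..<N - r})"
      by (rule diff_card_le_card_Diff) simp
    moreover have "card (gs ` {..<N - r}) \<le> N - r"
      using card_image_le[of "{..<N - r}" gs] by simp
    ultimately show ?thesis by linarith
  qed
  finally have "irreducible_codim (proj_space (d + 1)) (C 0) = enat (N - r)"
    using codimension_ge by (simp add: antisym)
  then show ?thesis
    using codimension_irreducible[OF C_irreducible[of 0]] C_0 by simp
qed

section \<open>The open set of general tuples\<close>

definition U :: "(nat \<Rightarrow> 'n cpoly) set" where
  "U = {T \<in> form_tuples {d + 1 - e..d}. cdet N en (w (\<Sum>i=d + 1 - e..d. T i)) \<noteq> 0}"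

lemma lookup_sum_tuple:
  assumes T: "T \<in> form_tuples {d + 1 - e..d}" and a: "mono_degree a \<in> {d + 1 - e..d}"
  shows "Poly_Mapping.lookup (\<Sum>i=d + 1 - e..d. T i) a = Poly_Mapping.lookup (T (mono_degree a)) a"
proof -
  have "Poly_Mapping.lookup (T i) a = 0" if "i \<in> {d + 1 - e..d}" "i \<noteq> mono_degree a" for i
    using T that by (auto simp: form_tuples_def forms_lookup dest!: spec[of _ i])
  then have "(\<Sum>i=d + 1 - e..d. Poly_Mapping.lookup (T i) a) =
      (\<Sum>i\<in>{mono_degree a}. Poly_Mapping.lookup (T i) a)"
    using a by (intro sum.mono_neutral_right) auto
  then show ?thesis by (simp add: lookup_sum)
qed

lemma openin_U: "openin (form_tuple_space {d + 1 - e..d}) U"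
proof -
  \<comment> \<open>The same matrix in tuple coordinates: the coefficient of a monomial
    \<open>a\<close> in the sum of the entries is the coordinate
    \<open>(mono_degree a, a)\<close>.\<close>
  define entry' :: "nat \<Rightarrow> nat \<Rightarrow> (nat \<times> 'n monomial) cpoly" where
    "entry' = (\<lambda>i j. if j < r then
       (if en i \<in> range ((+) (bs j)) then
          Poly_Mapping.single (Poly_Mapping.single (mono_degree (en i - bs j), en i - bs j) 1) 1 else 0)
       else Poly_Mapping.single 0 (Poly_Mapping.lookup (w 0 j) (en i)))"
  have forms: "entry' i j \<in> forms (if j < r then 1 else 0)" for i j
    by (auto simp: entry'_def forms_def)
  obtain F where F: "\<And>x. poly_eval x F = det (mat N N (\<lambda>(i, j). poly_eval x (entry' i j)))"
    using det_polynomial[of N entry' "\<lambda>j. if j < r then 1 else 0", OF forms] by blast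
  have ev: "poly_eval (tuple_coord T) (entry' i j) = Poly_Mapping.lookup (w (\<Sum>i=d + 1 - e..d. T i) j) (en i)"
    if T: "T \<in> form_tuples {d + 1 - e..d}" and i: "i < N" for T i j
  proof (cases "j < r \<and> en i \<in> range ((+) (bs j))")
    case True
    then have b: "bs j \<in> shifts e" using bs by simp
    have "mono_degree (en i - bs j) = d + 1 - mono_degree (bs j)"
      using True mono_degree_diff[of "en i" "bs j"] en_degree[OF i] by simp
    moreover have "d + 1 - mono_degree (bs j) \<in> {d + 1 - e..d}"
      using b e by (auto simp: shifts_def)
    ultimately have "mono_degree (en i - bs j) \<in> {d + 1 - e..d}" by simp
    from lookup_sum_tuple[OF T this] show ?thesis
      using True en_degree[OF i]
      by (simp add: entry'_def gfam_def lookup_mult_col poly_eval_single mono_eval_single tuple_coord_def)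
  next
    case False
    then show ?thesis
      by (auto simp: entry'_def gfam_def lookup_mult_col poly_eval_single)
  qed
  have "poly_eval (tuple_coord T) F = cdet N en (w (\<Sum>i=d + 1 - e..d. T i))"
    if "T \<in> form_tuples {d + 1 - e..d}" for T
    unfolding F cdet_def using ev[OF that] by (intro arg_cong[of _ _ det] eq_matI) auto
  then have "U = form_tuples {d + 1 - e..d} - form_zeros {d + 1 - e..d} {F}"
    by (auto simp: U_def form_zeros_def)
  then show ?thesis unfolding openin_form_tuple_space by blast
qed

text \<open>The homogeneous components of \<open>f1\<close> in the degrees \<open>d + 1 - e\<close>
  to \<open>d\<close> form such a tuple, since the determinant depends on these degrees
  only.\<close>

lemma U_nonempty: "U \<noteq> {}"
proof -
  define T where "T = (\<lambda>i. if i \<in> {d + 1 - e..d} then subpoly (\<lambda>a. mono_degree a = i) f1 else 0)"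
  have T: "T \<in> form_tuples {d + 1 - e..d}"
    by (auto simp: form_tuples_def T_def subpoly_forms)
  have "w (\<Sum>i=d + 1 - e..d. T i) = w f1"
  proof (rule w_cong)
    fix a :: "'n monomial" assume "d + 1 - e \<le> mono_degree a" "mono_degree a \<le> d"
    then have "mono_degree a \<in> {d + 1 - e..d}" by simp
    from lookup_sum_tuple[OF T this] this
    show "Poly_Mapping.lookup (\<Sum>i=d + 1 - e..d. T i) a = Poly_Mapping.lookup f1 a"
      by (simp add: T_def lookup_subpoly)
  qed
  moreover have "cdet N en (w f1) \<noteq> 0" using f1 cdet_w_nonzero by blast
  ultimately have "T \<in> U" using T by (simp add: U_def)
  then show ?thesis by blast
qed

lemma hilbert_function_U:
  assumes "T \<in> U"
  shows "hilbert_function (ideal_gen (T ` {d + 1 - e..d})) (d + 1) = N - r"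
proof -
  have T: "T \<in> form_tuples {d + 1 - e..d}" "cdet N en (w (\<Sum>i=d + 1 - e..d. T i)) \<noteq> 0"
    using assms by (auto simp: U_def)
  have "cv.dim (mult_image e (d + 1) (\<Sum>i=d + 1 - e..d. T i)) = r"
    using T(2) cdet_w_nonzero by (intro generic_dim) blast
  then show ?thesis using hilbert_function_eq[OF T(1) e] N by simp
qed

end

theorem theorem6p1:
  fixes d e :: nat
  assumes "d \<ge> 1" and "e \<ge> 1" and "int d - int e + 1 \<ge> 0"
  shows "\<exists>U :: (nat \<Rightarrow> 'n::finite cpoly) set.
           openin (form_tuple_space {d + 1 - e..d}) U \<and> U \<noteq> {} \<and>
           (\<forall>T\<in>U. enat (hilbert_function (ideal_gen (T ` {d + 1 - e..d})) (d + 1)) =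
              codimension (proj_space (d + 1))
                (taylor_variety d e (d + 1) :: 'n cpoly set set))"
proof -
  have "e \<le> d + 1" using assms(3) by linarith
  from generic_rank_exists[OF this, where 'n = 'n] obtain r N and bs gs en :: "nat \<Rightarrow> 'n monomial" and f1
    where "generic_rank d e r N bs gs en f1" by blast
  then interpret generic_rank d e r N bs gs en f1 .
  show ?thesis
    using openin_U U_nonempty hilbert_function_U codimension_taylor_variety
    by (intro exI[of _ U]) simp
qed

end
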